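(* Let $n\ge 1$ and let $\ell\ge 0$ be real. There exists a constant $C>0$, independent of $t$ and of the initial data, such that for all $u_0\in H^{\ell+1}(\mathbf{R}^n)\cap L^1(\mathbf{R}^n)$ and $u_1\in H^{\ell}(\mathbf{R}^n)\cap L^1(\mathbf{R}^n)$, the solution $u$ to the Cauchy problem $$u_{tt}-\Delta u+\Delta^2 u_t=0\quad (t>0,\ x\in\mathbf{R}^n),\qquad u(0,x)=u_0(x),\quad u_t(0,x)=u_1(x)\quad (x\in\mathbf{R}^n)$$ satisfies, for all $t>0$, $$E(t)\le C(1+t)^{-\frac{n+2}{4}}\|u_0\|_{L^1}^2+C(1+t)^{-\frac n4}\|u_1\|_{L^1}^2+C(1+t)^{-\ell}\big(\|D^{\ell+1}u_0\|^2+\|D^{\ell}u_1\|^2\big),$$ where $E(t):=\|u_t(t,\cdot)\|_{L^2(\mathbf{R}^n)}^2+\|\nabla u(t,\cdot)\|_{L^2(\mathbf{R}^n)}^2$.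
   Context: The Fourier transform is $\hat f(\xi)=(2\pi)^{-n/2}\int_{\mathbf{R}^n}e^{-ix\cdot\xi}f(x)\,dx$ (extended to $L^2$ as usual), taken in the $x$ variable only. For $s\ge0$ and $f\in H^s(\mathbf{R}^n)$, $\|D^s f\|:=\||\xi|^s\hat f\|_{L^2(\mathbf{R}^n)}$. For $[u_0,u_1]\in H^1(\mathbf{R}^n)\times L^2(\mathbf{R}^n)$, "the solution" $u$ is the unique mild solution $u\in C([0,\infty);H^1(\mathbf{R}^n))\cap C^1([0,\infty);L^2(\mathbf{R}^n))$. In Fourier space it is given by $$\hat u(t,\xi)=E_0(t,\xi)\widehat{u_0}(\xi)+E_1(t,\xi)\Big(\tfrac{|\xi|^4}{2}\widehat{u_0}(\xi)+\widehat{u_1}(\xi)\Big),$$ where, for $|\xi|\le\sqrt[3]{2}$, with $\omega=\tfrac12\sqrt{4|\xi|^2-|\xi|^8}$, $E_0=e^{-\frac12 t|\xi|^4}\cos(t\omega)$ and $E_1=e^{-\frac12 t|\xi|^4}\sin(t\omega)/\omega$; and for $|\xi|\ge\sqrt[3]{2}$, with $\kappa=\tfrac12\sqrt{|\xi|^8-4|\xi|^2}$, $E_0=e^{-\frac12 t|\xi|^4}\cosh(t\kappa)$ and $E_1=e^{-\frac12 t|\xi|^4}\sinh(t\kappa)/\kappa$ (the quotients being extended by continuity where $\omega=0$ or $\kappa=0$). Equivalently, for a.e. $\xi$, $\hat u(\cdot,\xi)$ solves $\hat u_{tt}+|\xi|^4\hat u_t+|\xi|^2\hat u=0$ with $\hat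 u(0,\xi)=\widehat{u_0}(\xi)$, $\hat u_t(0,\xi)=\widehat{u_1}(\xi)$. By Plancherel, $E(t)=\|\hat u_t(t,\cdot)\|_{L^2}^2+\||\xi|\hat u(t,\cdot)\|_{L^2}^2$. *)

theory Defs
  imports "HOL-Analysis.Analysis"
begin

text \<open>
  Functions on \<open>R\<^sup>n\<close> are complex-valued functions on \<^typ>\<open>real ^ 'n\<close>. An element of \<open>L\<^sup>p\<close> is
  represented by any of its Borel representatives.
\<close>

definition square_integrable :: "('a::euclidean_space \<Rightarrow> 'b::euclidean_space) \<Rightarrow> bool" where
  "square_integrable f \<longleftrightarrow>
     f \<in> borel_measurable lborel \<and> integrable lborel (\<lambda>x. (norm (f x))\<^sup>2)"

definition L1_norm :: "('a::euclidean_space \<Rightarrow> 'b::euclidean_space) \<Rightarrow> real" where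
  "L1_norm f = (LINT x|lborel. norm (f x))"

text \<open>
  The Bochner integral of a non-integrable function is \<open>0\<close>, so the two norms are meaningful only
  for integrable, respectively square integrable, arguments.
\<close>

definition L2_norm :: "('a::euclidean_space \<Rightarrow> 'b::euclidean_space) \<Rightarrow> real" where
  "L2_norm f = sqrt (LINT x|lborel. (norm (f x))\<^sup>2)"

definition fourier_integral :: "(real ^ 'n::finite \<Rightarrow> complex) \<Rightarrow> real ^ 'n \<Rightarrow> complex" where
  "fourier_integral f \<xi> =
     complex_of_real ((2 * pi) powr (- real CARD('n) / 2)) *
     (LINT x|lborel. exp (- \<i> * complex_of_real (x \<bullet> \<xi>)) * f x)"

text \<open>
  The Fourier transform on \<open>L\<^sup>2\<close>: the \<open>L\<^sup>2\<close>-limit of the Fourier integrals of the truncations of \<open>f\<close>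
  to balls, which lie in \<open>L\<^sup>1 \<inter> L\<^sup>2\<close>. It is determined almost everywhere, and \<open>fourier f\<close> picks one
  representative.
\<close>

definition has_fourier ::
    "(real ^ 'n::finite \<Rightarrow> complex) \<Rightarrow> (real ^ 'n \<Rightarrow> complex) \<Rightarrow> bool" where
  "has_fourier f g \<longleftrightarrow>
     square_integrable f \<and> square_integrable g \<and>
     ((\<lambda>R. L2_norm (\<lambda>\<xi>.
         fourier_integral (\<lambda>x. indicator (cball 0 R) x * f x) \<xi> - g \<xi>)) \<longlongrightarrow> 0) at_top"

definition fourier :: "(real ^ 'n::finite \<Rightarrow> complex) \<Rightarrow> real ^ 'n \<Rightarrow> complex" where
  "fourier f = (SOME g. has_fourier f g)"

text \<open>
  The existence of a Fourier transform is automatic for every \<open>f\<close> in \<open>L\<^sup>2\<close> (Plancherel).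
\<close>

definition sobolev :: "real \<Rightarrow> (real ^ 'n::finite \<Rightarrow> complex) set" where
  "sobolev s = {f. (\<exists>g. has_fourier f g) \<and>
     square_integrable (\<lambda>\<xi>. complex_of_real ((1 + (norm \<xi>)\<^sup>2) powr (s / 2)) * fourier f \<xi>)}"

definition sobolev_norm :: "real \<Rightarrow> (real ^ 'n::finite \<Rightarrow> complex) \<Rightarrow> real" where
  "sobolev_norm s f =
     L2_norm (\<lambda>\<xi>. complex_of_real ((1 + (norm \<xi>)\<^sup>2) powr (s / 2)) * fourier f \<xi>)"

text \<open>
  The norm of \<open>D\<^sup>s f\<close>. At \<open>\<xi> = 0\<close> the library has \<open>0 powr 0 = 0\<close>; this affects a null set only.
\<close>

definition D_norm :: "real \<Rightarrow> (real ^ 'n::finite \<Rightarrow> complex) \<Rightarrow> real" where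
  "D_norm s f = L2_norm (\<lambda>\<xi>. complex_of_real (norm \<xi> powr s) * fourier f \<xi>)"

text \<open>
  Weak gradient in \<open>L\<^sup>2\<close>, tested against \<open>C\<^sup>1\<close> functions with bounded support (the convention of
  Gilbarg and Trudinger; by mollification \<open>C\<^sup>\<infinity>\<close> test functions give the same notion). The
  derivative of the test function \<open>\<phi>\<close> at \<open>x\<close> is the linear map \<open>\<phi>' x\<close>.
\<close>

definition weak_gradient ::
    "(real ^ 'n::finite \<Rightarrow> complex) \<Rightarrow> (real ^ 'n \<Rightarrow> complex ^ 'n) \<Rightarrow> bool" where
  "weak_gradient f g \<longleftrightarrow>
     square_integrable f \<and> square_integrable g \<and>
     (\<forall>(\<phi> :: real ^ 'n \<Rightarrow> complex) \<phi>'.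
        (\<forall>x. (\<phi> has_derivative \<phi>' x) (at x)) \<and>
        (\<forall>h. continuous_on UNIV (\<lambda>x. \<phi>' x h)) \<and>
        bounded {x. \<phi> x \<noteq> 0} \<longrightarrow>
        (\<forall>j. (LINT x|lborel. f x * \<phi>' x (axis j 1)) = - (LINT x|lborel. (g x $ j) * \<phi> x)))"

text \<open>
  The multipliers \<open>E\<^sub>0(t,\<xi>)\<close> and \<open>E\<^sub>1(t,\<xi>)\<close> as functions of \<open>t\<close> and \<open>r = |\<xi>|\<close>. Since \<open>omega r = 0\<close>
  at \<open>r = root 3 2\<close>, while \<open>kappa r > 0\<close> for all larger \<open>r\<close>, only the quotient by \<open>omega\<close> needs to
  be extended by continuity, with value \<open>t\<close>.
\<close>

definition omega :: "real \<Rightarrow> real" where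
  "omega r = sqrt (4 * r ^ 2 - r ^ 8) / 2"

definition kappa :: "real \<Rightarrow> real" where
  "kappa r = sqrt (r ^ 8 - 4 * r ^ 2) / 2"

definition E0 :: "real \<Rightarrow> real \<Rightarrow> real" where
  "E0 t r = exp (- t * r ^ 4 / 2) *
     (if r \<le> root 3 2 then cos (t * omega r) else cosh (t * kappa r))"

definition E1 :: "real \<Rightarrow> real \<Rightarrow> real" where
  "E1 t r = exp (- t * r ^ 4 / 2) *
     (if r \<le> root 3 2
      then (if omega r = 0 then t else sin (t * omega r) / omega r)
      else sinh (t * kappa r) / kappa r)"

definition solution_multiplier :: "real \<Rightarrow> real \<Rightarrow> complex \<Rightarrow> complex \<Rightarrow> complex" where
  "solution_multiplier t r a b = complex_of_real (E0 t r) * a +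
     complex_of_real (E1 t r) * (complex_of_real (r ^ 4 / 2) * a + b)"

text \<open>
  \<open>mild_solution u0 u1 u v\<close>: the function \<open>u\<close> is the mild solution of
  \<open>u\<^sub>t\<^sub>t - \<Delta>u + \<Delta>\<^sup>2 u\<^sub>t = 0\<close>, \<open>u(0) = u0\<close>, \<open>u\<^sub>t(0) = u1\<close>, and \<open>v = u\<^sub>t\<close>. The conditions say, in this
  order, that \<open>u\<close> is continuous from \<open>[0,\<infinity>)\<close> to \<open>H\<^sup>1\<close>, that \<open>u\<close> is continuously differentiable from
  \<open>[0,\<infinity>)\<close> to \<open>L\<^sup>2\<close> with derivative \<open>v\<close>, and that \<open>u\<close> has the Fourier representation given by the
  solution semigroup.
\<close>

definition mild_solution ::
    "(real ^ 'n::finite \<Rightarrow> complex) \<Rightarrow> (real ^ 'n \<Rightarrow> complex) \<Rightarrow>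
     (real \<Rightarrow> real ^ 'n \<Rightarrow> complex) \<Rightarrow> (real \<Rightarrow> real ^ 'n \<Rightarrow> complex) \<Rightarrow> bool" where
  "mild_solution u0 u1 u v \<longleftrightarrow> (\<forall>t\<ge>0.
     u t \<in> sobolev 1 \<and>
     ((\<lambda>s. sobolev_norm 1 (\<lambda>x. u s x - u t x)) \<longlongrightarrow> 0) (at t within {0..}) \<and>
     square_integrable (v t) \<and>
     ((\<lambda>s. L2_norm (\<lambda>x. (u s x - u t x) / complex_of_real (s - t) - v t x)) \<longlongrightarrow> 0)
       (at t within {0..}) \<and>
     ((\<lambda>s. L2_norm (\<lambda>x. v s x - v t x)) \<longlongrightarrow> 0) (at t within {0..}) \<and>
     has_fourier (u t)
       (\<lambda>\<xi>. solution_multiplier t (norm \<xi>) (fourier u0 \<xi>) (fourier u1 \<xi>)))"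

text \<open>
  The Fourier representation solves, frequency by frequency, the Fourier transform of the Cauchy
  problem: \<open>w'' + r\<^sup>4 w' + r\<^sup>2 w = 0\<close>, \<open>w(0) = a\<close>, \<open>w'(0) = b\<close>.
\<close>

lemma E0_E1_ode:
  assumes "r \<ge> 0"
  defines "e0 \<equiv> \<lambda>t. - (r ^ 4) / 2 * E0 t r - (r ^ 2 - r ^ 8 / 4) * E1 t r"
    and "e1 \<equiv> \<lambda>t. E0 t r - (r ^ 4) / 2 * E1 t r"
  shows "((\<lambda>t. E0 t r) has_real_derivative e0 t) (at t)"
    and "((\<lambda>t. E1 t r) has_real_derivative e1 t) (at t)"
    and "E0 0 r = 1" and "E1 0 r = 0"
proof -
  consider (osc) "r \<le> root 3 2" "omega r \<noteq> 0" | (deg) "r \<le> root 3 2" "omega r = 0"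
    | (over) "r > root 3 2"
    by linarith
  hence "((\<lambda>t. E0 t r) has_real_derivative e0 t) (at t) \<and>
         ((\<lambda>t. E1 t r) has_real_derivative e1 t) (at t) \<and> E0 0 r = 1 \<and> E1 0 r = 0"
  proof cases
    case osc
    have "r ^ 3 \<le> 2"
      using power_mono[OF osc(1) assms(1), of 3] by simp
    hence "r ^ 3 * r ^ 3 \<le> 2 * 2"
      using assms(1) by (intro mult_mono) auto
    hence "r ^ 2 * (r ^ 6) \<le> r ^ 2 * 4"
      by (intro mult_left_mono) (auto simp: power_add[symmetric])
    hence "4 * r ^ 2 - r ^ 8 \<ge> 0"
      by (simp add: power_add[symmetric])
    hence om: "(omega r)\<^sup>2 = r ^ 2 - r ^ 8 / 4"
      by (simp add: omega_def power_divide)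
    have e0: "e0 t = exp (- t * r ^ 4 / 2) *
        (- (r ^ 4) / 2 * cos (t * omega r) - omega r * sin (t * omega r))"
      using osc unfolding e0_def om[symmetric]
      by (simp add: E0_def E1_def field_simps power2_eq_square)
    have e1: "e1 t = exp (- t * r ^ 4 / 2) *
        (cos (t * omega r) - r ^ 4 / 2 * (sin (t * omega r) / omega r))"
      using osc unfolding e1_def by (simp add: E0_def E1_def field_simps)
    show ?thesis
      using osc unfolding E0_def E1_def e0 e1
      by (auto intro!: derivative_eq_intros simp: field_simps)
  next
    case deg
    have "r ^ 3 \<le> 2"
      using power_mono[OF deg(1) assms(1), of 3] by simp
    hence "r ^ 3 * r ^ 3 \<le> 2 * 2"
      using assms(1) by (intro mult_mono) auto
    hence "r ^ 2 * (r ^ 6) \<le> r ^ 2 * 4"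
      by (intro mult_left_mono) (auto simp: power_add[symmetric])
    hence "4 * r ^ 2 - r ^ 8 \<ge> 0"
      by (simp add: power_add[symmetric])
    hence "(omega r)\<^sup>2 = r ^ 2 - r ^ 8 / 4"
      by (simp add: omega_def power_divide)
    hence om: "r ^ 2 - r ^ 8 / 4 = 0"
      using deg by simp
    have "e0 t = - (r ^ 4) / 2 * exp (- t * r ^ 4 / 2)"
      using deg unfolding e0_def om by (simp add: E0_def E1_def)
    moreover have "e1 t = exp (- t * r ^ 4 / 2) * (1 - (r ^ 4) / 2 * t)"
      using deg unfolding e1_def by (simp add: E0_def E1_def field_simps)
    ultimately show ?thesis
      using deg unfolding E0_def E1_def
      by (auto intro!: derivative_eq_intros simp: field_simps)
  next
    case over
    have "r ^ 3 > 2"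
      using power_strict_mono[OF over, of 3] by simp
    hence "r > 0"
      using assms(1) by (cases "r = 0") auto
    have "r ^ 3 * r ^ 3 > 2 * 2"
      using \<open>r ^ 3 > 2\<close> \<open>r > 0\<close> by (intro mult_strict_mono) auto
    with \<open>r > 0\<close> have "r ^ 2 * (r ^ 6) > r ^ 2 * 4"
      by (intro mult_strict_left_mono) (auto simp: power_add[symmetric])
    hence "r ^ 8 - 4 * r ^ 2 > 0"
      by (simp add: power_add[symmetric])
    hence ka: "(kappa r)\<^sup>2 = - (r ^ 2 - r ^ 8 / 4)" and kp: "kappa r > 0"
      by (auto simp: kappa_def power_divide)
    have "e0 t = - (r ^ 4) / 2 * E0 t r + (kappa r)\<^sup>2 * E1 t r"
      unfolding e0_def ka by (simp add: algebra_simps)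
    also have "\<dots> = exp (- t * r ^ 4 / 2) *
        (- (r ^ 4) / 2 * cosh (t * kappa r) + kappa r * sinh (t * kappa r))"
      using over kp by (simp add: E0_def E1_def field_simps power2_eq_square)
    finally have e0: "e0 t = exp (- t * r ^ 4 / 2) *
        (- (r ^ 4) / 2 * cosh (t * kappa r) + kappa r * sinh (t * kappa r))" .
    have e1: "e1 t = exp (- t * r ^ 4 / 2) *
        (cosh (t * kappa r) - r ^ 4 / 2 * (sinh (t * kappa r) / kappa r))"
      using over unfolding e1_def by (simp add: E0_def E1_def field_simps)
    show ?thesis
      using over kp unfolding E0_def E1_def e0 e1
      by (auto intro!: derivative_eq_intros simp: field_simps)
  qed
  thus "((\<lambda>t. E0 t r) has_real_derivative e0 t) (at t)"
    and "((\<lambda>t. E1 t r) has_real_derivative e1 t) (at t)"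
    and "E0 0 r = 1" and "E1 0 r = 0" by auto
qed

lemma solution_multiplier_ode:
  fixes r :: real and a b :: complex
  assumes "r \<ge> 0"
  defines "w \<equiv> \<lambda>t. solution_multiplier t r a b"
  obtains w' where
    "\<And>t. (w has_vector_derivative w' t) (at t)"
    "\<And>t. (w' has_vector_derivative
        - complex_of_real (r ^ 4) * w' t - complex_of_real (r ^ 2) * w t) (at t)"
    "w 0 = a" "w' 0 = b"
proof -
  define c where "c = complex_of_real (r ^ 4 / 2) * a + b"
  define e0 where "e0 = (\<lambda>t. - (r ^ 4) / 2 * E0 t r - (r ^ 2 - r ^ 8 / 4) * E1 t r)"
  define e1 where "e1 = (\<lambda>t. E0 t r - (r ^ 4) / 2 * E1 t r)"
  have ode: "((\<lambda>t. E0 t r) has_real_derivative e0 t) (at t)"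
    "((\<lambda>t. E1 t r) has_real_derivative e1 t) (at t)" "E0 0 r = 1" "E1 0 r = 0" for t
    using E0_E1_ode[OF assms(1)] unfolding e0_def e1_def by blast+
  note d0 = ode(1)[unfolded has_real_derivative_iff_has_vector_derivative]
  note d1 = ode(2)[unfolded has_real_derivative_iff_has_vector_derivative]
  have lin: "((\<lambda>t. complex_of_real (f t) * z) has_vector_derivative complex_of_real f' * z) (at t)"
    if "(f has_vector_derivative f') (at t)" for f f' t z
    using that by (intro has_vector_derivative_mult_left has_vector_derivative_of_real)
      (simp add: has_real_derivative_iff_has_vector_derivative)
  define w' where "w' = (\<lambda>t. complex_of_real (e0 t) * a + complex_of_real (e1 t) * c)"
  have w: "w = (\<lambda>t. complex_of_real (E0 t r) * a + complex_of_real (E1 t r) * c)"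
    by (simp add: w_def solution_multiplier_def c_def)
  have dd0: "(e0 has_vector_derivative - (r ^ 4) / 2 * e0 t - (r ^ 2 - r ^ 8 / 4) * e1 t) (at t)" for t
    using DERIV_diff[OF DERIV_cmult[OF ode(1)] DERIV_cmult[OF ode(2)]]
    unfolding has_real_derivative_iff_has_vector_derivative
    by (subst (1) e0_def)
  have dd1: "(e1 has_vector_derivative e0 t - r ^ 4 / 2 * e1 t) (at t)" for t
    using DERIV_diff[OF ode(1) DERIV_cmult[OF ode(2)]]
    unfolding has_real_derivative_iff_has_vector_derivative
    by (subst (1) e1_def)
  show thesis
  proof
    show "(w has_vector_derivative w' t) (at t)" for t
      unfolding w w'_def by (intro has_vector_derivative_add lin d0 d1)
    show "(w' has_vector_derivative
        - complex_of_real (r ^ 4) * w' t - complex_of_real (r ^ 2) * w t) (at t)" for t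
    proof -
      have r8: "r ^ 8 = r ^ 4 * r ^ 4" by (simp add: power_add[symmetric])
      have q0: "- (r ^ 4) / 2 * e0 t - (r ^ 2 - r ^ 8 / 4) * e1 t = - (r ^ 4) * e0 t - r ^ 2 * E0 t r"
        unfolding e0_def e1_def r8 by algebra
      have q1: "e0 t - (r ^ 4) / 2 * e1 t = - (r ^ 4) * e1 t - r ^ 2 * E1 t r"
        unfolding e0_def e1_def r8 by algebra
      have "(w' has_vector_derivative
          complex_of_real (- (r ^ 4) * e0 t - r ^ 2 * E0 t r) * a
          + complex_of_real (- (r ^ 4) * e1 t - r ^ 2 * E1 t r) * c) (at t)"
        unfolding w'_def using dd0[of t] dd1[of t] unfolding q0 q1
        by (intro has_vector_derivative_add lin)
      thus ?thesis
        by (rule back_subst[where P = "\<lambda>d. (w' has_vector_derivative d) (at t)"])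
          (simp add: w w'_def algebra_simps)
    qed
    show "w 0 = a" by (simp add: w ode)
    show "w' 0 = b" by (simp add: w'_def e0_def e1_def ode c_def)
  qed
qed

end

theory Submission
  imports Defs "HOL-Probability.Probability"
begin

text \<open>
  Frequency by frequency, \<open>L = (|w'|\<^sup>2 + r\<^sup>2|w|\<^sup>2) / 2 + \<rho> (Re (w' \<cdot> cnj w) + r\<^sup>4|w|\<^sup>2 / 2)\<close> is a Lyapunov
  function of \<open>w'' + r\<^sup>4 w' + r\<^sup>2 w = 0\<close>, comparable to the energy. It yields energy decay like
  \<open>e\<^bsup>-\<rho>t\<^esup>\<close> with \<open>\<rho> = r\<^sup>4/2\<close> at low and \<open>\<rho> = r\<^bsup>-2\<^esup>/2\<close> at high frequencies. For \<open>|\<xi>| \<le> 1\<close> the Fourier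
  transforms of the data are bounded by their \<open>L\<^sup>1\<close> norms, and rescaling \<open>\<xi>\<close> by \<open>(1 + t)\<^bsup>1/4\<^esup>\<close> gives the
  polynomial rates; for \<open>|\<xi>| > 1\<close> a factor \<open>(1 + t)\<^bsup>-l\<^esup>\<close> is bought with \<open>l\<close> derivatives of the data.

  Only one half of Plancherel's theorem is needed to return to physical space: the \<open>L\<^sup>2\<close> norms of
  \<open>u\<^sub>t\<close> and \<open>\<nabla>u\<close> are bounded by duality with \<open>C\<^sup>1\<close> test functions \<open>\<phi>\<close>, replacing derivatives by
  difference quotients of \<open>u\<close> in time and of \<open>\<phi>\<close> in space. The pairing with \<open>\<phi>\<close> is transferred to
  Fourier space by Parseval's identity, which is obtained by Gaussian regularisation.
\<close>

section \<open>Square integrable functions\<close>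

text \<open>The decay degenerates at both ends of the spectrum. For small r the roots of z^2 + r^4 z
  + r^2 = 0 have real part -r^4/2. For large r the mode is overdamped, and its slow root is about
  -r^(-2): strong damping prevents fast decay. At the low end the frequencies of size t^(-1/4)
  dominate; they fill a volume of order t^(-n/4), and the weight |xi|^2 on the transform of
  \<open>u0\<close> contributes another t^(-1/2). At the high end exp(-t/r^2) is not uniformly small
  in r, so decay must be paid for with regularity. A Lyapunov function treats the oscillating,
  critical and overdamped regimes alike, without bounds on \<open>E0\<close> and \<open>E1\<close>.

  The velocity is known only as an L2 limit of quotients and the gradient only weakly. Since only
  upper bounds on the energy are wanted, bounding pairings with test functions avoids computing the
  transforms of either. Gaussians are the regulariser because their transform is again a positive
  kernel of mass one: positivity and mass give the contraction on L2, concentration gives Parseval's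
  identity in the limit.\<close>

lemma square_integrable_measurable [measurable_dest]:
  "square_integrable f \<Longrightarrow> f \<in> borel_measurable lborel"
  by (simp add: square_integrable_def)

lemma square_integrableD:
  "square_integrable f \<Longrightarrow> integrable lborel (\<lambda>x. (norm (f x))\<^sup>2)"
  by (simp add: square_integrable_def)

lemma L2_norm_nonneg [simp]: "0 \<le> L2_norm f"
  by (simp add: L2_norm_def)

lemma L2_norm_square: "(L2_norm f)\<^sup>2 = (LINT x|lborel. (norm (f x))\<^sup>2)"
  by (simp add: L2_norm_def)

lemma square_integrable_bound:
  fixes f :: "'a::euclidean_space \<Rightarrow> 'b::euclidean_space" and g :: "'a \<Rightarrow> 'c::euclidean_space"
  assumes "square_integrable g" "f \<in> borel_measurable lborel"
    and "AE x in lborel. norm (f x) \<le> norm (g x)"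
  shows "square_integrable f"
  unfolding square_integrable_def
proof
  show "f \<in> borel_measurable lborel" by fact
  show "integrable lborel (\<lambda>x. (norm (f x))\<^sup>2)"
    by (rule Bochner_Integration.integrable_bound[OF square_integrableD[OF assms(1)]])
      (use assms in \<open>auto elim!: eventually_mono intro!: power_mono\<close>)
qed

lemma L2_norm_mono:
  fixes f :: "'a::euclidean_space \<Rightarrow> 'b::euclidean_space" and g :: "'a \<Rightarrow> 'c::euclidean_space"
  assumes "square_integrable g" "f \<in> borel_measurable lborel"
    and "AE x in lborel. norm (f x) \<le> norm (g x)"
  shows "L2_norm f \<le> L2_norm g"
  unfolding L2_norm_def
proof (rule real_sqrt_le_mono, rule integral_mono_AE)
  show "AE x in lborel. (norm (f x))\<^sup>2 \<le> (norm (g x))\<^sup>2"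
    using assms(3) by (auto elim!: eventually_mono intro!: power_mono)
qed (use assms square_integrable_bound[OF assms] in \<open>auto dest: square_integrableD\<close>)

lemma square_integrable_add:
  fixes f g :: "'a::euclidean_space \<Rightarrow> 'b::euclidean_space"
  assumes "square_integrable f" "square_integrable g"
  shows "square_integrable (\<lambda>x. f x + g x)"
proof -
  have "integrable lborel (\<lambda>x. 2 * (norm (f x))\<^sup>2 + 2 * (norm (g x))\<^sup>2)"
    using assms by (intro Bochner_Integration.integrable_add integrable_mult_right) (auto dest: square_integrableD)
  moreover have "(norm (f x + g x))\<^sup>2 \<le> 2 * (norm (f x))\<^sup>2 + 2 * (norm (g x))\<^sup>2" for x
  proof -
    have "(norm (f x + g x))\<^sup>2 \<le> (norm (f x) + norm (g x))\<^sup>2"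
      by (intro power_mono norm_triangle_ineq) auto
    also have "\<dots> \<le> 2 * (norm (f x))\<^sup>2 + 2 * (norm (g x))\<^sup>2"
      using sum_squares_bound[of "norm (f x)" "norm (g x)"] by (simp add: power2_sum)
    finally show ?thesis .
  qed
  moreover have [measurable]: "(\<lambda>x. f x + g x) \<in> borel_measurable lborel"
    using square_integrable_measurable[OF assms(1)] square_integrable_measurable[OF assms(2)] by measurable
  ultimately show ?thesis
    unfolding square_integrable_def
    by (auto intro!: Bochner_Integration.integrable_bound[of lborel "\<lambda>x. 2 * (norm (f x))\<^sup>2 + 2 * (norm (g x))\<^sup>2"])
qed

lemma square_integrable_diff:
  fixes f g :: "'a::euclidean_space \<Rightarrow> 'b::euclidean_space"
  assumes "square_integrable f" "square_integrable g"
  shows "square_integrable (\<lambda>x. f x - g x)"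
proof -
  have "square_integrable (\<lambda>x. - g x)"
    using assms(2) by (simp add: square_integrable_def)
  from square_integrable_add[OF assms(1) this] show ?thesis by simp
qed

lemma nn_integral_norm_square:
  assumes "square_integrable f"
  shows "(\<integral>\<^sup>+x. ennreal ((norm (f x))\<^sup>2) \<partial>lborel) = ennreal ((L2_norm f)\<^sup>2)"
  using assms by (simp add: L2_norm_square square_integrableD nn_integral_eq_integral)

text \<open>Fatou's lemma bounds a nonnegative integral before integrability is known; this turns
  such a bound into membership in L2 together with the norm estimate.\<close>

lemma square_integrableI_nn:
  assumes "f \<in> borel_measurable lborel"
    and "(\<integral>\<^sup>+x. ennreal ((norm (f x))\<^sup>2) \<partial>lborel) \<le> ennreal (M\<^sup>2)" "0 \<le> M"
  shows "square_integrable f" "L2_norm f \<le> M"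
proof -
  show *: "square_integrable f"
    unfolding square_integrable_def using assms
    by (auto intro!: integrableI_bounded simp: order.strict_trans1 ennreal_less_top)
  have "(L2_norm f)\<^sup>2 \<le> M\<^sup>2"
    using assms(2) unfolding nn_integral_norm_square[OF *] by simp
  thus "L2_norm f \<le> M" using assms(3) by (rule power2_le_imp_le)
qed

lemma borel_measurable_cnj [measurable]: "cnj \<in> borel_measurable borel"
  by (intro borel_measurable_continuous_onI continuous_intros)

lemma Cauchy_Schwarz_norm:
  fixes f g :: "'a::euclidean_space \<Rightarrow> complex"
  assumes f: "square_integrable f" and g: "square_integrable g"
  shows "integrable lborel (\<lambda>x. f x * g x)"
    and "integrable lborel (\<lambda>x. f x * cnj (g x))"
    and "norm (LINT x|lborel. f x * g x) \<le> L2_norm f * L2_norm g"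
    and "norm (LINT x|lborel. f x * cnj (g x)) \<le> L2_norm f * L2_norm g"
proof -
  note [measurable] = square_integrable_measurable[OF f] square_integrable_measurable[OF g]
  have "(\<integral>\<^sup>+x. ennreal (norm (f x)) * ennreal (norm (g x)) \<partial>lborel)\<^sup>2 \<le>
      (\<integral>\<^sup>+x. ennreal (norm (f x)) ^ 2 \<partial>lborel) * (\<integral>\<^sup>+x. ennreal (norm (g x)) ^ 2 \<partial>lborel)"
    by (rule Cauchy_Schwarz_nn_integral) auto
  also have "\<dots> = ennreal ((L2_norm f * L2_norm g)\<^sup>2)"
    using nn_integral_norm_square[OF f] nn_integral_norm_square[OF g]
    by (simp add: ennreal_power power_mult_distrib ennreal_mult)
  finally have sq: "(\<integral>\<^sup>+x. ennreal (norm (f x)) * ennreal (norm (g x)) \<partial>lborel)\<^sup>2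
      \<le> ennreal ((L2_norm f * L2_norm g)\<^sup>2)" .
  \<comment> \<open>A priori \<open>X\<close> may be infinite; the bound on its square excludes
    this.\<close>
  have root: "X \<le> ennreal c" if "X\<^sup>2 \<le> ennreal (c\<^sup>2)" "0 \<le> c" for X c
    using that by (cases X) (auto simp: ennreal_power top_unique intro: ennreal_leI power2_le_imp_le)
  have *: "(\<integral>\<^sup>+x. ennreal (norm (f x * g x)) \<partial>lborel) \<le> ennreal (L2_norm f * L2_norm g)"
    using root[OF sq] by (simp add: norm_mult ennreal_mult)
  show 1: "integrable lborel (\<lambda>x. f x * g x)"
    using * by (intro integrableI_bounded) (auto simp: order.strict_trans1 ennreal_less_top)
  show "norm (LINT x|lborel. f x * g x) \<le> L2_norm f * L2_norm g"
    using order_trans[OF integral_norm_bound_ennreal[OF 1] *] by simp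
  show 2: "integrable lborel (\<lambda>x. f x * cnj (g x))"
    using * by (intro integrableI_bounded) (auto simp: order.strict_trans1 ennreal_less_top norm_mult)
  show "norm (LINT x|lborel. f x * cnj (g x)) \<le> L2_norm f * L2_norm g"
    using order_trans[OF integral_norm_bound_ennreal[OF 2], of "ennreal (L2_norm f * L2_norm g)"] *
    by (simp add: norm_mult)
qed

text \<open>Minkowski's inequality: pair f + g with its own conjugate, apply Cauchy-Schwarz to the
  two summands, and divide by the norm of f + g unless it vanishes.\<close>

lemma L2_norm_triangle:
  fixes f g :: "'a::euclidean_space \<Rightarrow> complex"
  assumes f: "square_integrable f" and g: "square_integrable g"
  shows "L2_norm (\<lambda>x. f x + g x) \<le> L2_norm f + L2_norm g"
proof -
  note fg = square_integrable_add[OF f g]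
  have eq: "complex_of_real ((norm (f x + g x))\<^sup>2) = f x * cnj (f x + g x) + g x * cnj (f x + g x)" for x
    by (metis complex_norm_square distrib_right)
  have "(L2_norm (\<lambda>x. f x + g x))\<^sup>2 = norm (LINT x|lborel. complex_of_real ((norm (f x + g x))\<^sup>2))"
    by (simp only: integral_complex_of_real norm_of_real L2_norm_square[symmetric]) simp
  also have "\<dots> = norm ((LINT x|lborel. f x * cnj (f x + g x)) + (LINT x|lborel. g x * cnj (f x + g x)))"
    unfolding eq
    by (subst Bochner_Integration.integral_add[OF Cauchy_Schwarz_norm(2)[OF f fg] Cauchy_Schwarz_norm(2)[OF g fg]]) (rule refl)
  also have "\<dots> \<le> L2_norm f * L2_norm (\<lambda>x. f x + g x) + L2_norm g * L2_norm (\<lambda>x. f x + g x)"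
    by (intro order_trans[OF norm_triangle_ineq] add_mono Cauchy_Schwarz_norm(4) f g fg)
  finally have *: "L2_norm (\<lambda>x. f x + g x) * L2_norm (\<lambda>x. f x + g x)
      \<le> (L2_norm f + L2_norm g) * L2_norm (\<lambda>x. f x + g x)"
    by (simp only: power2_eq_square distrib_right)
  show ?thesis
  proof (cases "L2_norm (\<lambda>x. f x + g x) = 0")
    case True
    thus ?thesis by (simp only: add_nonneg_nonneg L2_norm_nonneg)
  next
    case False
    hence "0 < L2_norm (\<lambda>x. f x + g x)" by (simp add: order_less_le)
    with * show ?thesis by (simp only: mult_le_cancel_right_pos)
  qed
qed

lemma continuous_bounded_support_bounded:
  fixes f :: "'a::euclidean_space \<Rightarrow> 'b::real_normed_vector"
  assumes f: "continuous_on UNIV f" and bd: "bounded {x. f x \<noteq> 0}"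
  obtains R B where "0 \<le> B" "\<And>x. norm (f x) \<le> B" "\<And>x. f x \<noteq> 0 \<Longrightarrow> norm x \<le> R"
proof -
  obtain R where R: "\<And>x. f x \<noteq> 0 \<Longrightarrow> norm x \<le> R"
    using bd by (auto simp: bounded_iff)
  have "compact (f ` cball 0 R)"
    by (intro compact_continuous_image continuous_on_subset[OF f]) auto
  then obtain B where B: "\<And>x. norm x \<le> R \<Longrightarrow> norm (f x) \<le> B"
    using compact_imp_bounded by (fastforce simp: bounded_iff)
  \<comment> \<open>If \<open>R\<close> is negative, the ball is empty and \<open>B\<close> is
    arbitrary; the absolute value makes the bound nonnegative in this case too.\<close>
  have "norm (f x) \<le> \<bar>B\<bar>" for x
    using B[of x] R[of x] by (cases "f x = 0") auto
  with R show thesis by (intro that[of "\<bar>B\<bar>"]) auto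
qed

lemma continuous_bounded_support_integrable:
  fixes f :: "'a::euclidean_space \<Rightarrow> 'b::euclidean_space"
  assumes f: "continuous_on UNIV f" and bd: "bounded {x. f x \<noteq> 0}"
  shows "integrable lborel f" "square_integrable f"
proof -
  obtain R where R: "\<And>x. f x \<noteq> 0 \<Longrightarrow> norm x \<le> R"
    using bd by (auto simp: bounded_iff)
  \<comment> \<open>Stated for every \<open>g\<close> supported where \<open>f\<close> is, so that
    it serves both \<open>f\<close> and |f|^2.\<close>
  have int: "integrable lborel g" if "continuous_on UNIV g" "\<And>x. g x \<noteq> 0 \<Longrightarrow> f x \<noteq> 0" for g :: "'a \<Rightarrow> 'c::euclidean_space"
  proof -
    have "integrable lborel (\<lambda>x. indicator (cball 0 R) x *\<^sub>R g x)"
      using borel_integrable_compact[of "cball 0 R" g] that(1)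
      by (auto intro: continuous_on_subset simp: indicator_scaleR_eq_if)
    moreover have "indicator (cball 0 R) x *\<^sub>R g x = g x" for x
      using R[of x] that(2)[of x] by (cases "g x = 0") (auto simp: indicator_def)
    ultimately show ?thesis by simp
  qed
  show "integrable lborel f" by (rule int) (use f in auto)
  have "f \<in> borel_measurable lborel" using borel_measurable_continuous_onI[OF f] by simp
  moreover have "integrable lborel (\<lambda>x. (norm (f x))\<^sup>2)"
    by (rule int) (use f in \<open>auto intro!: continuous_intros\<close>)
  ultimately show "square_integrable f" by (simp add: square_integrable_def)
qed

section \<open>Density of test functions\<close>

lemma L2_norm_dominated_convergence:
  fixes F :: "nat \<Rightarrow> 'a::euclidean_space \<Rightarrow> 'b::euclidean_space"
  assumes w: "square_integrable w" and m: "\<And>k. F k \<in> borel_measurable lborel" "G \<in> borel_measurable lborel"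
    and bound: "\<And>k. AE x in lborel. norm (F k x - G x) \<le> norm (w x)"
    and lim: "AE x in lborel. (\<lambda>k. F k x) \<longlonglongrightarrow> G x"
  shows "(\<lambda>k. L2_norm (\<lambda>x. F k x - G x)) \<longlonglongrightarrow> 0"
proof -
  note [measurable] = m
  have "(\<lambda>k. LINT x|lborel. (norm (F k x - G x))\<^sup>2) \<longlonglongrightarrow> (LINT x|(lborel :: 'a measure). 0)"
  proof (rule integral_dominated_convergence)
    show "integrable lborel (\<lambda>x. (norm (w x))\<^sup>2)" using w by (rule square_integrableD)
    show "AE x in lborel. (\<lambda>k. (norm (F k x - G x))\<^sup>2) \<longlonglongrightarrow> 0"
      using lim
    proof eventually_elim
      case (elim x)
      hence "(\<lambda>k. (norm (F k x - G x))\<^sup>2) \<longlonglongrightarrow> (norm (G x - G x))\<^sup>2"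
        by (intro tendsto_intros)
      thus ?case by simp
    qed
    show "AE x in lborel. norm ((norm (F k x - G x))\<^sup>2) \<le> (norm (w x))\<^sup>2" for k
      using bound[of k] by eventually_elim (simp add: power_mono)
  qed auto
  from tendsto_real_sqrt[OF this] show ?thesis by (simp add: L2_norm_def)
qed

section \<open>Continuously differentiable functions and cutoffs\<close>

definition C1 :: "('a::real_normed_vector \<Rightarrow> 'b::real_normed_vector) \<Rightarrow> bool" where
  "C1 f \<longleftrightarrow> (\<exists>f'. (\<forall>x. (f has_derivative f' x) (at x)) \<and> (\<forall>h. continuous_on UNIV (\<lambda>x. f' x h)))"

lemma C1_continuous: "C1 f \<Longrightarrow> continuous_on UNIV f"
  unfolding C1_def by (auto intro!: continuous_at_imp_continuous_on intro: has_derivative_continuous)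

lemma C1_const: "C1 (\<lambda>x. c)"
  unfolding C1_def by (rule exI[of _ "\<lambda>x h. 0"]) auto

lemma C1_bounded_linear: "bounded_linear f \<Longrightarrow> C1 f"
  unfolding C1_def by (rule exI[of _ "\<lambda>x. f"]) (auto intro: bounded_linear_imp_has_derivative)

lemma C1_add: "C1 f \<Longrightarrow> C1 g \<Longrightarrow> C1 (\<lambda>x. f x + g x)"
  unfolding C1_def
proof (elim exE conjE)
  fix f' g'
  assume "\<forall>x. (f has_derivative f' x) (at x)" "\<forall>h. continuous_on UNIV (\<lambda>x. f' x h)"
    "\<forall>x. (g has_derivative g' x) (at x)" "\<forall>h. continuous_on UNIV (\<lambda>x. g' x h)"
  thus "\<exists>k. (\<forall>x. ((\<lambda>x. f x + g x) has_derivative k x) (at x)) \<and> (\<forall>h. continuous_on UNIV (\<lambda>x. k x h))"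
    by (intro exI[of _ "\<lambda>x h. f' x h + g' x h"]) (auto intro!: has_derivative_add continuous_on_add)
qed

lemma C1_mult:
  fixes f g :: "'a::real_normed_vector \<Rightarrow> 'b::real_normed_algebra"
  shows "C1 f \<Longrightarrow> C1 g \<Longrightarrow> C1 (\<lambda>x. f x * g x)"
proof -
  assume C: "C1 f" "C1 g"
  from C obtain f' g' where d: "\<And>x. (f has_derivative f' x) (at x)" "\<And>h. continuous_on UNIV (\<lambda>x. f' x h)"
    "\<And>x. (g has_derivative g' x) (at x)" "\<And>h. continuous_on UNIV (\<lambda>x. g' x h)"
    unfolding C1_def by blast
  have "\<forall>x. ((\<lambda>x. f x * g x) has_derivative (\<lambda>h. f x * g' x h + f' x h * g x)) (at x)"
    using d by (auto intro!: has_derivative_mult)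
  moreover have "\<forall>h. continuous_on UNIV (\<lambda>x. f x * g' x h + f' x h * g x)"
    using d C1_continuous[OF C(1)] C1_continuous[OF C(2)] by (auto intro!: continuous_on_add continuous_on_mult)
  ultimately show ?thesis
    unfolding C1_def by (intro exI[of _ "\<lambda>x h. f x * g' x h + f' x h * g x"] conjI)
qed

lemma C1_bounded_linear_compose: "bounded_linear k \<Longrightarrow> C1 f \<Longrightarrow> C1 (\<lambda>x. k (f x))"
  unfolding C1_def
proof (elim exE conjE)
  fix f'
  assume k: "bounded_linear k" and "\<forall>x. (f has_derivative f' x) (at x)" "\<forall>h. continuous_on UNIV (\<lambda>x. f' x h)"
  thus "\<exists>g. (\<forall>x. ((\<lambda>x. k (f x)) has_derivative g x) (at x)) \<and> (\<forall>h. continuous_on UNIV (\<lambda>x. g x h))"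
    by (intro exI[of _ "\<lambda>x h. k (f' x h)"])
      (auto intro: bounded_linear.has_derivative bounded_linear.continuous_on)
qed

lemma C1_real_polynomial_function: "real_polynomial_function p \<Longrightarrow> C1 p"
  by (induction rule: real_polynomial_function.induct)
    (auto intro: C1_bounded_linear C1_const C1_add C1_mult)

lemma C1_polynomial_function:
  fixes p :: "'a::real_normed_vector \<Rightarrow> complex"
  assumes "polynomial_function p"
  shows "C1 p"
proof -
  have "C1 (\<lambda>x. Re (p x))" "C1 (\<lambda>x. Im (p x))"
    using assms C1_real_polynomial_function[of "Re \<circ> p"] C1_real_polynomial_function[of "Im \<circ> p"]
      bounded_linear_Re bounded_linear_Im
    unfolding polynomial_function_def by (auto simp: o_def)
  hence "C1 (\<lambda>x. complex_of_real (Re (p x)) + \<i> * complex_of_real (Im (p x)))"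
    by (intro C1_add C1_mult C1_const C1_bounded_linear_compose[OF bounded_linear_of_real])
  thus ?thesis by (simp flip: complex_eq)
qed

text \<open>Squaring removes the kink of \<open>max 0 s\<close>: at 0 the difference quotient is
  \<open>max 0 y\<close> itself, which tends to 0.\<close>

lemma DERIV_max_0_power2: "((\<lambda>s. (max 0 s)\<^sup>2) has_real_derivative 2 * max 0 s) (at s)"
proof -
  consider "s > 0" | "s < 0" | "s = 0" by linarith
  thus ?thesis
  proof cases
    case 1
    have "((\<lambda>s. s\<^sup>2) has_real_derivative 2 * max 0 s) (at s)"
      using 1 by (auto intro!: derivative_eq_intros)
    thus ?thesis
      by (rule has_field_derivative_transform_within_open[of _ _ _ "{0<..}"]) (use 1 in auto)
  next
    case 2
    have "((\<lambda>s. 0) has_real_derivative 2 * max 0 s) (at s)"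
      using 2 by (auto intro!: derivative_eq_intros)
    thus ?thesis
      by (rule has_field_derivative_transform_within_open[of _ _ _ "{..<0}"]) (use 2 in auto)
  next
    case 3
    have "((\<lambda>y::real. max 0 y) \<longlongrightarrow> max 0 0) (at 0)"
      by (intro tendsto_intros)
    moreover have "max 0 y = ((max 0 y)\<^sup>2 - (max 0 0)\<^sup>2) / (y - 0)" for y :: real
      by (auto simp: max_def power2_eq_square)
    ultimately show ?thesis
      unfolding has_field_derivative_iff 3 by simp
  qed
qed

text \<open>A truncated paraboloid, squared. The outer square makes it C1 across the sphere of
  radius R, and using |x|^2 instead of |x| keeps it differentiable at the origin.\<close>

definition cutoff :: "real \<Rightarrow> 'a::real_inner \<Rightarrow> real" where
  "cutoff R x = (max 0 (1 - (norm x)\<^sup>2 / R\<^sup>2))\<^sup>2"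

lemma cutoff_bounds: "0 \<le> cutoff R x" "cutoff R x \<le> 1"
  by (auto simp: cutoff_def intro!: power_le_one)

lemma cutoff_eq_0:
  assumes "0 < R" "R \<le> norm x"
  shows "cutoff R x = 0"
proof -
  have "R\<^sup>2 \<le> (norm x)\<^sup>2" using assms by (intro power_mono) auto
  hence "1 - (norm x)\<^sup>2 / R\<^sup>2 \<le> 0" using assms by simp
  thus ?thesis by (simp add: cutoff_def)
qed

lemma C1_cutoff: "C1 (cutoff R :: 'a::real_inner \<Rightarrow> real)"
proof -
  have "((\<lambda>x. 1 - (norm x)\<^sup>2 / R\<^sup>2) has_derivative (\<lambda>h. - (2 * (x \<bullet> h)) / R\<^sup>2)) (at x)" for x :: 'a
    unfolding power2_norm_eq_inner divide_inverse
    by (auto intro!: derivative_eq_intros simp: inner_commute)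
  hence "((\<lambda>x. (max 0 (1 - (norm x)\<^sup>2 / R\<^sup>2))\<^sup>2) has_derivative
      (\<lambda>h. (2 * max 0 (1 - (norm x)\<^sup>2 / R\<^sup>2)) * (- (2 * (x \<bullet> h)) / R\<^sup>2))) (at x)" for x :: 'a
    using has_derivative_compose[OF _ DERIV_max_0_power2[unfolded has_field_derivative_def]] by fast
  moreover have "continuous_on UNIV (\<lambda>x. (2 * max 0 (1 - (norm x)\<^sup>2 / R\<^sup>2)) * (- (2 * (x \<bullet> h)) / R\<^sup>2))" for h :: 'a
    unfolding divide_inverse by (intro continuous_intros)
  ultimately show ?thesis
    unfolding C1_def cutoff_def[abs_def]
    by (intro exI[of _ "\<lambda>x h. (2 * max 0 (1 - (norm x)\<^sup>2 / R\<^sup>2)) * (- (2 * (x \<bullet> h)) / R\<^sup>2)"]) auto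
qed

lemma cutoff_tendsto: "(\<lambda>k. cutoff (real (Suc k)) x) \<longlonglongrightarrow> 1"
proof -
  have "(\<lambda>k. (norm x)\<^sup>2 / (real (Suc k))\<^sup>2) \<longlonglongrightarrow> 0"
    by (intro tendsto_divide_0[OF tendsto_const] filterlim_at_top_imp_at_infinity
        filterlim_pow_at_top filterlim_compose[OF filterlim_real_sequentially filterlim_Suc]) simp
  hence "(\<lambda>k. (max 0 (1 - (norm x)\<^sup>2 / (real (Suc k))\<^sup>2))\<^sup>2) \<longlonglongrightarrow> (max 0 (1 - 0))\<^sup>2"
    by (intro tendsto_intros)
  thus ?thesis by (simp add: cutoff_def)
qed

text \<open>The class against which \<open>weak_gradient\<close> tests: \<open>C1\<close> asks for
  continuity of each directional derivative, as that definition does. One class thus serves both for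
  density in L2 and for integration by parts.\<close>

definition test_function :: "(real ^ 'n::finite \<Rightarrow> complex) \<Rightarrow> bool" where
  "test_function \<phi> \<longleftrightarrow> bounded {x. \<phi> x \<noteq> 0} \<and> C1 \<phi>"

lemma test_function_continuous: "test_function \<phi> \<Longrightarrow> continuous_on UNIV \<phi>"
  by (simp add: test_function_def C1_continuous)

lemma test_function_cutoff:
  assumes "polynomial_function p" "0 < R"
  shows "test_function (\<lambda>x. complex_of_real (cutoff R x) * p x)"
  unfolding test_function_def
proof
  show "bounded {x. complex_of_real (cutoff R x) * p x \<noteq> 0}"
    by (rule bounded_subset[OF bounded_cball[of 0 R]]) (use cutoff_eq_0[OF assms(2)] in \<open>force simp: not_le[symmetric]\<close>)
  show "C1 (\<lambda>x. complex_of_real (cutoff R x) * p x)"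
    by (intro C1_mult C1_bounded_linear_compose[OF bounded_linear_of_real] C1_cutoff C1_polynomial_function assms)
qed

text \<open>Lebesgue measurability yields continuous functions that converge to \<open>H\<close> off
  a negligible set, but without a common bound. Composing them with the nearest point projection
  onto the ball of radius \<open>K\<close> supplies the bound; the projection is continuous and
  fixes the values of \<open>H\<close>, so the limit is unchanged.\<close>

lemma bounded_measurable_approx:
  fixes H :: "'a::euclidean_space \<Rightarrow> 'b::euclidean_space"
  assumes m: "H \<in> borel_measurable lborel" and b: "\<And>x. norm (H x) \<le> K"
  obtains g where "\<And>n::nat. continuous_on UNIV (g n)" "\<And>n x. norm (g n x) \<le> K"
    "AE x in lborel. (\<lambda>n. g n x) \<longlonglongrightarrow> H x"
proof -
  have "H \<in> borel_measurable lebesgue" using m by (simp add: measurable_completion)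
  hence "H measurable_on UNIV" by (rule lebesgue_measurable_imp_measurable_on) simp
  then obtain N g where N: "negligible N" and g: "\<And>n. continuous_on UNIV (g n)"
      "\<And>x. x \<notin> N \<Longrightarrow> (\<lambda>n. g n x) \<longlonglongrightarrow> H x"
    unfolding measurable_on_def by auto
  have "0 \<le> K" using b[of 0] norm_ge_zero order_trans by blast
  hence ball: "convex (cball (0::'b) K)" "closed (cball (0::'b) K)" "cball (0::'b) K \<noteq> {}" by auto
  define c where "c = closest_point (cball (0::'b) K)"
  have "AE x in lebesgue. x \<notin> N"
    using N by (intro AE_not_in) (simp add: negligible_iff_null_sets)
  hence "AE x in lborel. x \<notin> N" by (simp add: AE_completion_iff)
  show thesis
  proof
    show "continuous_on UNIV (\<lambda>x. c (g n x))" for n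
      unfolding c_def by (rule continuous_on_compose2[OF continuous_on_closest_point[OF ball, of UNIV] g(1)]) auto
    show "norm (c (g n x)) \<le> K" for n x
      using closest_point_in_set[OF ball(2,3), of "g n x"] by (simp add: c_def)
    show "AE x in lborel. (\<lambda>n. c (g n x)) \<longlonglongrightarrow> H x"
      using \<open>AE x in lborel. x \<notin> N\<close>
    proof eventually_elim
      case (elim x)
      have "(\<lambda>n. c (g n x)) \<longlonglongrightarrow> c (H x)"
        using continuous_at_closest_point[OF ball, of "H x"] g(2)[OF elim]
        unfolding c_def by (rule isCont_tendsto_compose)
      moreover have "c (H x) = H x" unfolding c_def using b by (intro closest_point_self) auto
      ultimately show ?case by simp
    qed
  qed
qed

text \<open>
  Truncating \<open>F\<close> in value makes it an almost everywhere limit of uniformly bounded continuous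
  functions; these are replaced by Weierstrass polynomials, and the cutoff makes the result
  compactly supported.
\<close>

lemma test_functions_dense:
  fixes F :: "real ^ 'n::finite \<Rightarrow> complex"
  assumes F: "square_integrable F" and e: "0 < e"
  obtains \<phi> where "test_function \<phi>" "square_integrable \<phi>" "L2_norm (\<lambda>x. \<phi> x - F x) < e"
proof -
  note [measurable] = square_integrable_measurable[OF F]
  have [measurable]: "cutoff R \<in> borel_measurable borel" for R
    by (intro borel_measurable_continuous_onI C1_continuous C1_cutoff)
  define H where "H k x = (if norm (F x) \<le> real k then F x else 0)" for k :: nat and x
  have [measurable]: "H k \<in> borel_measurable lborel" for k
    unfolding H_def[abs_def] by measurable
  \<comment> \<open>The index \<open>Suc k\<close> keeps the radius of the cutoff positive.\<close>
  define G where "G k x = complex_of_real (cutoff (real (Suc k)) x) * H k x" for k x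
  have [measurable]: "G k \<in> borel_measurable lborel" for k
    unfolding G_def[abs_def] by measurable
  \<comment> \<open>\<open>F\<close> serves as majorant: \<open>G k x\<close> is \<open>F x\<close>
    times a number in [0, 1], so the difference is at most |F x|.\<close>
  have "(\<lambda>k. L2_norm (\<lambda>x. G k x - F x)) \<longlonglongrightarrow> 0"
  proof (rule L2_norm_dominated_convergence[OF F])
    have "norm (G k x - F x) \<le> norm (F x)" for k x
    proof -
      define c where "c = cutoff (real (Suc k)) x"
      have c: "\<bar>c - 1\<bar> \<le> 1"
        using cutoff_bounds[of "real (Suc k)" x] unfolding c_def abs_le_iff by linarith
      show ?thesis
      proof (cases "norm (F x) \<le> real k")
        case True
        hence "G k x - F x = complex_of_real (c - 1) * F x"
          by (simp add: G_def H_def c_def left_diff_distrib)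
        thus ?thesis using c by (simp only: norm_mult norm_of_real mult_left_le_one_le norm_ge_zero abs_ge_zero)
      next
        case False
        hence "G k x = 0" by (simp only: G_def H_def if_False mult_zero_right)
        thus ?thesis by simp
      qed
    qed
    thus "AE x in lborel. norm (G k x - F x) \<le> norm (F x)" for k by simp
    have "(\<lambda>k. G k x) \<longlonglongrightarrow> F x" for x
    proof -
      have "eventually (\<lambda>k. norm (F x) \<le> real k) sequentially"
        using filterlim_real_sequentially by (auto simp: filterlim_at_top)
      hence "eventually (\<lambda>k. F x = H k x) sequentially"
        by eventually_elim (simp add: H_def)
      hence "(\<lambda>k. H k x) \<longlonglongrightarrow> F x" by (rule tendsto_eventually[OF eventually_mono]) simp
      hence "(\<lambda>k. complex_of_real (cutoff (real (Suc k)) x) * H k x) \<longlonglongrightarrow> complex_of_real 1 * F x"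
        by (intro tendsto_intros cutoff_tendsto)
      thus ?thesis by (simp add: G_def)
    qed
    thus "AE x in lborel. (\<lambda>k. G k x) \<longlonglongrightarrow> F x" by simp
  qed auto
  hence "eventually (\<lambda>k. L2_norm (\<lambda>x. G k x - F x) < e / 2) sequentially"
    using e by (intro order_tendstoD) auto
  then obtain k where k: "L2_norm (\<lambda>x. G k x - F x) < e / 2"
    using eventually_happens'[OF sequentially_bot] by blast
  define R where "R = real (Suc k)"
  have R: "0 < R" by (simp add: R_def)
  have GR: "G k x = complex_of_real (cutoff R x) * H k x" for x
    by (simp only: G_def R_def)
  obtain g where g: "\<And>n. continuous_on UNIV (g n)" "\<And>n x. norm (g n x) \<le> real k"
      "AE x in lborel. (\<lambda>n. g n x) \<longlonglongrightarrow> H k x"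
    by (rule bounded_measurable_approx[of "H k" "real k"]) (auto simp: H_def)
  have "\<exists>p. polynomial_function p \<and> (\<forall>x\<in>cball 0 R. norm (g n x - p x) < inverse (real (Suc n)))" for n
    by (rule Stone_Weierstrass_polynomial_function) (auto intro: continuous_on_subset[OF g(1)])
  then obtain p where p: "\<And>n. polynomial_function (p n)"
      "\<And>n x. norm x \<le> R \<Longrightarrow> norm (g n x - p n x) < inverse (real (Suc n))"
    by (metis mem_cball_0)
  define P where "P n x = complex_of_real (cutoff R x) * p n x" for n x
  have tP: "test_function (P n)" for n
    unfolding P_def[abs_def] by (rule test_function_cutoff) (use p R in auto)
  have sP: "square_integrable (P n)" for n
    using tP[of n] test_function_continuous[OF tP]
    by (intro continuous_bounded_support_integrable) (auto simp: test_function_def)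
  note [measurable] = square_integrable_measurable[OF sP]
  have "(\<lambda>n. L2_norm (\<lambda>x. P n x - G k x)) \<longlonglongrightarrow> 0"
  proof (rule L2_norm_dominated_convergence)
    \<comment> \<open>On the ball the polynomials are at most k + 1 in modulus, the approximation
      error being at most 1, and \<open>H k\<close> is at most k. Off the ball the cutoff
      annihilates both functions.\<close>
    define w where "w x = (2 * real k + 1) * indicator (cball 0 R) x" for x :: "real ^ 'n"
    have "integrable lborel (\<lambda>x. (norm (w x))\<^sup>2)"
    proof -
      have "(norm (w x))\<^sup>2 = (2 * real k + 1)\<^sup>2 * indicator (cball 0 R) x" for x
        by (simp add: w_def indicator_def)
      moreover have "integrable lborel (indicator (cball 0 R :: (real ^ 'n) set) :: _ \<Rightarrow> real)"
        by (intro integrable_real_indicator emeasure_bounded_finite) auto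
      ultimately show ?thesis by simp
    qed
    moreover have "w \<in> borel_measurable lborel" unfolding w_def[abs_def] by (auto intro!: borel_measurable_times borel_measurable_indicator)
    ultimately show "square_integrable w" by (simp add: square_integrable_def)
    have "norm (P n x - G k x) \<le> norm (w x)" for n x
    proof (cases "norm x \<le> R")
      case True
      have "norm (p n x) \<le> norm (g n x) + norm (g n x - p n x)"
        using norm_triangle_ineq4[of "g n x" "g n x - p n x"] by simp
      also have "\<dots> \<le> real k + 1"
        using g(2)[of n x] less_imp_le[OF p(2)[OF True, of n]] inverse_le_1_iff[of "real (Suc n)"]
        by (intro add_mono) (auto intro: order_trans)
      finally have "norm (p n x - H k x) \<le> (real k + 1) + real k"
        by (intro order_trans[OF norm_triangle_ineq4] add_mono) (auto simp: H_def)
      hence "cutoff R x * norm (p n x - H k x) \<le> 1 * (2 * real k + 1)"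
        by (intro mult_mono) (auto simp: cutoff_bounds)
      moreover have "norm (P n x - G k x) = cutoff R x * norm (p n x - H k x)"
        unfolding P_def GR right_diff_distrib[symmetric]
        by (simp add: norm_mult cutoff_bounds)
      ultimately show ?thesis using True by (simp add: w_def)
    next
      case False
      thus ?thesis using cutoff_eq_0[OF R, of x] by (simp add: P_def GR w_def)
    qed
    thus "AE x in lborel. norm (P n x - G k x) \<le> norm (w x)" for n by simp
    show "AE x in lborel. (\<lambda>n. P n x) \<longlonglongrightarrow> G k x"
      using g(3)
    proof eventually_elim
      case (elim x)
      show ?case
      proof (cases "norm x \<le> R")
        case True
        have "(\<lambda>n. g n x - p n x) \<longlonglongrightarrow> 0"
          by (rule tendsto_0_le[OF LIMSEQ_inverse_real_of_nat, of _ 1])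
            (use p(2)[OF True] in \<open>auto intro!: always_eventually less_imp_le\<close>)
        from tendsto_diff[OF elim this] have "(\<lambda>n. p n x) \<longlonglongrightarrow> H k x" by simp
        thus ?thesis unfolding P_def GR by (intro tendsto_intros)
      next
        case False
        thus ?thesis using cutoff_eq_0[OF R, of x] by (simp add: P_def GR)
      qed
    qed
  qed auto
  hence "eventually (\<lambda>n. L2_norm (\<lambda>x. P n x - G k x) < e / 2) sequentially"
    using e by (intro order_tendstoD) auto
  then obtain n where n: "L2_norm (\<lambda>x. P n x - G k x) < e / 2"
    using eventually_happens'[OF sequentially_bot] by blast
  have sG: "square_integrable (G k)"
  proof (rule square_integrable_bound[OF F])
    have "norm (G k x) \<le> norm (F x)" for x
      using cutoff_bounds[of R x]
      by (auto simp: GR H_def norm_mult intro!: mult_left_le_one_le)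
    thus "AE x in lborel. norm (G k x) \<le> norm (F x)" by simp
  qed auto
  show thesis
  proof
    have "L2_norm (\<lambda>x. (P n x - G k x) + (G k x - F x)) \<le>
        L2_norm (\<lambda>x. P n x - G k x) + L2_norm (\<lambda>x. G k x - F x)"
      by (intro L2_norm_triangle square_integrable_diff sP sG F)
    thus "L2_norm (\<lambda>x. P n x - F x) < e" using k n by simp
  qed (rule tP sP)+
qed

text \<open>Ideally F would be paired with itself, but only test functions are allowed. With \<phi>
  within e of F, the square of the norm of F is the pairing with \<phi> minus the pairing with
  \<phi> - F, and the second term is of order e. Letting e tend to 0 and dividing by the norm gives
  the bound with no loss in the constant.\<close>

lemma L2_norm_le_by_duality:
  fixes F :: "real ^ 'n::finite \<Rightarrow> complex"
  assumes F: "square_integrable F" and M: "0 \<le> M"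
    and dual: "\<And>\<phi>. test_function \<phi> \<Longrightarrow> norm (LINT x|lborel. F x * cnj (\<phi> x)) \<le> M * L2_norm \<phi>"
  shows "L2_norm F \<le> M"
proof -
  have *: "(L2_norm F)\<^sup>2 \<le> M * L2_norm F + e * (L2_norm F + M)" if e: "0 < e" for e
  proof -
    obtain \<phi> where \<phi>: "test_function \<phi>" "square_integrable \<phi>" "L2_norm (\<lambda>x. \<phi> x - F x) < e"
      using test_functions_dense[OF F e] .
    note sd = square_integrable_diff[OF \<phi>(2) F]
    have eq: "complex_of_real ((norm (F x))\<^sup>2) = F x * cnj (\<phi> x) - F x * cnj (\<phi> x - F x)" for x
      by (simp add: complex_norm_square right_diff_distrib del: of_real_power)
    have "(L2_norm F)\<^sup>2 = norm (LINT x|lborel. complex_of_real ((norm (F x))\<^sup>2))"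
      by (simp only: integral_complex_of_real norm_of_real L2_norm_square[symmetric]) simp
    also have "\<dots> = norm (LINT x|lborel. F x * cnj (\<phi> x) - F x * cnj (\<phi> x - F x))"
      by (simp only: eq)
    also have "\<dots> = norm ((LINT x|lborel. F x * cnj (\<phi> x)) - (LINT x|lborel. F x * cnj (\<phi> x - F x)))"
      by (subst Bochner_Integration.integral_diff[OF Cauchy_Schwarz_norm(2)[OF F \<phi>(2)] Cauchy_Schwarz_norm(2)[OF F sd]]) (rule refl)
    also have "\<dots> \<le> M * L2_norm \<phi> + L2_norm F * e"
      using dual[OF \<phi>(1)] Cauchy_Schwarz_norm(4)[OF F sd] mult_left_mono[OF less_imp_le[OF \<phi>(3)], of "L2_norm F"]
      by (intro order_trans[OF norm_triangle_ineq4] add_mono) (auto intro: order_trans)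
    also have "M * L2_norm \<phi> \<le> M * (e + L2_norm F)"
      using L2_norm_triangle[OF sd F] \<phi>(3) M by (intro mult_left_mono) auto
    finally show ?thesis by (simp add: algebra_simps)
  qed
  have "((\<lambda>e. M * L2_norm F + e * (L2_norm F + M)) \<longlongrightarrow> M * L2_norm F + 0 * (L2_norm F + M)) (at_right 0)"
    by (intro tendsto_intros)
  moreover have "eventually (\<lambda>e. (L2_norm F)\<^sup>2 \<le> M * L2_norm F + e * (L2_norm F + M)) (at_right 0)"
    using eventually_at_right_less[of "0::real"] by eventually_elim (rule *)
  ultimately have "(L2_norm F)\<^sup>2 \<le> M * L2_norm F + 0 * (L2_norm F + M)"
    by (rule tendsto_lowerbound) simp
  hence "L2_norm F * L2_norm F \<le> M * L2_norm F" by (simp add: power2_eq_square)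
  moreover have "L2_norm F = 0 \<or> 0 < L2_norm F" using L2_norm_nonneg[of F] by linarith
  ultimately show ?thesis using M by (auto simp only: mult_le_cancel_right_pos)
qed

section \<open>Gaussian integrals\<close>

lemma lborel_integral_affine:
  fixes f :: "'a::euclidean_space \<Rightarrow> 'b::{banach, second_countable_topology}"
  assumes c: "c \<noteq> 0" and [measurable]: "f \<in> borel_measurable borel"
  shows "(LINT x|lborel. f x) = \<bar>c\<bar> ^ DIM('a) *\<^sub>R (LINT x|lborel. f (t + c *\<^sub>R x))"
  by (subst lborel_affine[OF c, of t])
    (simp add: integral_density integral_distr)

lemma integrable_scaleR_right_iff:
  fixes f :: "'a \<Rightarrow> 'b::{banach, second_countable_topology}"
  assumes "c \<noteq> 0"
  shows "integrable M (\<lambda>x. c *\<^sub>R f x) \<longleftrightarrow> integrable M f"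
proof
  assume "integrable M (\<lambda>x. c *\<^sub>R f x)"
  hence "integrable M (\<lambda>x. inverse c *\<^sub>R (c *\<^sub>R f x))" by (rule integrable_scaleR_right)
  thus "integrable M f" using assms by simp
qed simp

lemma lborel_integrable_affine_iff:
  fixes f :: "'a::euclidean_space \<Rightarrow> 'b::{banach, second_countable_topology}"
  assumes c: "c \<noteq> 0" and [measurable]: "f \<in> borel_measurable borel"
  shows "integrable lborel f \<longleftrightarrow> integrable lborel (\<lambda>x. f (t + c *\<^sub>R x))"
  using c by (subst lborel_affine[OF c, of t])
    (simp add: integrable_density integrable_distr_eq integrable_scaleR_right_iff)

text \<open>Up to the factor sqrt(2 pi) this is the characteristic function of the standard normal
  distribution.\<close>

lemma integral_std_normal_1D:
  "integrable lborel (\<lambda>y::real. exp (\<i> * complex_of_real (s * y)) * complex_of_real (exp (- y\<^sup>2 / 2)))"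
  "(LINT y|lborel. exp (\<i> * complex_of_real (s * y)) * complex_of_real (exp (- y\<^sup>2 / 2))) =
     complex_of_real (sqrt (2 * pi) * exp (- s\<^sup>2 / 2))"
proof -
  have eq: "exp (\<i> * complex_of_real (s * y)) * complex_of_real (exp (- y\<^sup>2 / 2)) =
     complex_of_real (sqrt (2 * pi)) * (std_normal_density y *\<^sub>R exp (\<i> * complex_of_real (s * y)))" for y
    by (simp add: std_normal_density_def scaleR_conv_of_real)
  have 1: "integrable lborel (\<lambda>y. std_normal_density y *\<^sub>R exp (\<i> * complex_of_real (s * y)))"
    by (rule Bochner_Integration.integrable_bound[OF integrable_std_normal_moment[of 0]])
      (auto simp: normal_density_nonneg)
  show "integrable lborel (\<lambda>y. exp (\<i> * complex_of_real (s * y)) * complex_of_real (exp (- y\<^sup>2 / 2)))"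
    unfolding eq by (intro integrable_mult_right 1)
  have "(LINT y|lborel. std_normal_density y *\<^sub>R exp (\<i> * complex_of_real (s * y))) =
      char std_normal_distribution s"
    unfolding char_def by (subst integral_density) (auto simp: normal_density_nonneg)
  thus "(LINT y|lborel. exp (\<i> * complex_of_real (s * y)) * complex_of_real (exp (- y\<^sup>2 / 2))) =
     complex_of_real (sqrt (2 * pi) * exp (- s\<^sup>2 / 2))"
    unfolding eq integral_mult_right_zero by (simp add: char_std_normal_distribution)
qed

text \<open>Both the oscillating factor and the Gaussian are products over the coordinates, and
  \<open>lborel\<close> is the image of the product measure, so the integral is a product of
  one-dimensional ones.\<close>

lemma integral_std_gaussian:
  fixes x :: "'a::euclidean_space"
  shows "integrable lborel (\<lambda>\<xi>::'a. exp (\<i> * complex_of_real (x \<bullet> \<xi>)) * complex_of_real (exp (- (norm \<xi>)\<^sup>2 / 2)))" (is ?A)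
    and "(LINT \<xi>|lborel. exp (\<i> * complex_of_real (x \<bullet> \<xi>)) * complex_of_real (exp (- (norm \<xi>)\<^sup>2 / 2))) =
      complex_of_real ((2 * pi) powr (real DIM('a) / 2) * exp (- (norm x)\<^sup>2 / 2))" (is ?B)
proof -
  interpret product_sigma_finite "\<lambda>b::'a. lborel :: real measure" ..
  define f where "f b y = exp (\<i> * complex_of_real ((x \<bullet> b) * y)) * complex_of_real (exp (- y\<^sup>2 / 2))" for b y
  define g where "g \<xi> = exp (\<i> * complex_of_real (x \<bullet> \<xi>)) * complex_of_real (exp (- (norm \<xi>)\<^sup>2 / 2))" for \<xi> :: 'a
  have nrm: "(norm z)\<^sup>2 = (\<Sum>b\<in>Basis. (z \<bullet> b)\<^sup>2)" for z :: 'a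
    unfolding power2_norm_eq_inner euclidean_inner[of z z] by (simp add: power2_eq_square)
  have g: "g \<xi> = (\<Prod>b\<in>Basis. f b (\<xi> \<bullet> b))" for \<xi>
  proof -
    have "exp (\<i> * complex_of_real (x \<bullet> \<xi>)) = (\<Prod>b\<in>Basis. exp (\<i> * complex_of_real ((x \<bullet> b) * (\<xi> \<bullet> b))))"
      by (simp add: euclidean_inner[of x \<xi>] sum_distrib_left exp_sum)
    moreover have "exp (- (norm \<xi>)\<^sup>2 / 2) = (\<Prod>b\<in>Basis. exp (- (\<xi> \<bullet> b)\<^sup>2 / 2))"
      by (simp add: nrm exp_sum[symmetric] sum_negf[symmetric] sum_divide_distrib)
    ultimately show ?thesis by (simp add: g_def f_def prod.distrib)
  qed
  have [measurable]: "f b \<in> borel_measurable borel" for b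
    unfolding f_def[abs_def] by measurable
  have [measurable]: "g \<in> borel_measurable borel"
    unfolding g_def[abs_def] by measurable
  have gf: "g (\<Sum>b\<in>Basis. h b *\<^sub>R b) = (\<Prod>b\<in>Basis. f b (h b))" for h
    unfolding g by (intro prod.cong) auto
  have T: "(\<lambda>h. \<Sum>b\<in>Basis. h b *\<^sub>R b :: 'a) \<in> (\<Pi>\<^sub>M b\<in>Basis. lborel) \<rightarrow>\<^sub>M borel"
    by measurable
  have int: "integrable lborel (f b)" for b
    unfolding f_def by (rule integral_std_normal_1D)
  have "integrable lborel g"
    unfolding lborel_eq[where 'a='a] integrable_distr_eq[OF T \<open>g \<in> borel_measurable borel\<close>] gf
    by (intro product_integrable_prod int) auto
  thus ?A unfolding g_def .
  have "(LINT \<xi>|lborel. g \<xi>) = (\<Prod>b\<in>Basis. integral\<^sup>L lborel (f b))"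
    unfolding lborel_eq[where 'a='a] integral_distr[OF T \<open>g \<in> borel_measurable borel\<close>] gf
    by (intro product_integral_prod int) auto
  also have "\<dots> = (\<Prod>b\<in>Basis. complex_of_real (sqrt (2 * pi) * exp (- (x \<bullet> b)\<^sup>2 / 2)))"
    unfolding f_def[abs_def] by (intro prod.cong refl integral_std_normal_1D)
  also have "\<dots> = complex_of_real ((\<Prod>b\<in>(Basis::'a set). sqrt (2 * pi)) * (\<Prod>b\<in>Basis. exp (- (x \<bullet> b)\<^sup>2 / 2)))"
    by (simp only: of_real_prod[symmetric] prod.distrib)
  also have "(\<Prod>b\<in>Basis. exp (- (x \<bullet> b)\<^sup>2 / 2)) = exp (- (norm x)\<^sup>2 / 2)"
    by (simp add: nrm exp_sum[symmetric] sum_negf[symmetric] sum_divide_distrib)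
  also have "(\<Prod>b\<in>(Basis::'a set). sqrt (2 * pi)) = (2 * pi) powr (real DIM('a) / 2)"
    by (simp add: powr_half_sqrt[symmetric] powr_realpow[symmetric] powr_powr)
  finally show ?B unfolding g_def .
qed

text \<open>The density of a centred normal distribution with variance e^2 in every coordinate, that
  is, the heat kernel at time e^2/2.\<close>

definition heat :: "real \<Rightarrow> 'a::euclidean_space \<Rightarrow> real" where
  "heat e z = (2 * pi) powr (- real DIM('a) / 2) / e ^ DIM('a) * exp (- (norm z)\<^sup>2 / (2 * e\<^sup>2))"

lemma heat_nonneg: "0 \<le> e \<Longrightarrow> 0 \<le> heat e z"
  by (simp add: heat_def)

lemma heat_minus: "heat e (x - y) = heat e (y - x)"
  by (simp add: heat_def norm_minus_commute)

lemma heat_scale: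
  fixes z :: "'a::euclidean_space"
  assumes "e > 0"
  shows "e ^ DIM('a) * heat e (e *\<^sub>R z) = heat 1 z"
  using assms by (simp add: heat_def power_mult_distrib)

lemma borel_measurable_heat [measurable]: "heat e \<in> borel_measurable borel"
  unfolding heat_def[abs_def] by measurable

text \<open>Rescaling the variable by e moves e into the frequency x/e. The factor (2 pi)^n consists
  of the (2 pi)^(n/2) of the standard integral and another (2 pi)^(n/2) compensating the
  normalisation inside \<open>heat\<close>.\<close>

lemma integral_gaussian:
  fixes x :: "'a::euclidean_space"
  assumes e: "e > 0"
  shows "integrable lborel (\<lambda>\<xi>::'a. exp (\<i> * complex_of_real (x \<bullet> \<xi>)) * complex_of_real (exp (- e\<^sup>2 * (norm \<xi>)\<^sup>2 / 2)))" (is ?A)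
    and "(LINT \<xi>|lborel. exp (\<i> * complex_of_real (x \<bullet> \<xi>)) * complex_of_real (exp (- e\<^sup>2 * (norm \<xi>)\<^sup>2 / 2))) =
      complex_of_real ((2 * pi) ^ DIM('a) * heat e x)" (is ?B)
proof -
  define g where "g \<xi> = exp (\<i> * complex_of_real ((x /\<^sub>R e) \<bullet> \<xi>)) * complex_of_real (exp (- (norm \<xi>)\<^sup>2 / 2))" for \<xi> :: 'a
  have [measurable]: "g \<in> borel_measurable borel"
    unfolding g_def[abs_def] by measurable
  have eq: "g (0 + e *\<^sub>R \<xi>) = exp (\<i> * complex_of_real (x \<bullet> \<xi>)) * complex_of_real (exp (- e\<^sup>2 * (norm \<xi>)\<^sup>2 / 2))" for \<xi>
  proof -
    have "(x /\<^sub>R e) \<bullet> (0 + e *\<^sub>R \<xi>) = x \<bullet> \<xi>" using e by simp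
    moreover have "(norm (0 + e *\<^sub>R \<xi>))\<^sup>2 = e\<^sup>2 * (norm \<xi>)\<^sup>2" by (simp add: power_mult_distrib)
    ultimately show ?thesis by (simp only: g_def mult_minus_left)
  qed
  show ?A
    using integral_std_gaussian(1)[of "x /\<^sub>R e"] e lborel_integrable_affine_iff[of e g 0]
    unfolding eq g_def[symmetric] by auto
  have "complex_of_real ((2 * pi) powr (real DIM('a) / 2) * exp (- (norm (x /\<^sub>R e))\<^sup>2 / 2)) = (LINT \<xi>|lborel. g \<xi>)"
    unfolding g_def by (rule integral_std_gaussian(2)[symmetric])
  also have "\<dots> = \<bar>e\<bar> ^ DIM('a) *\<^sub>R (LINT \<xi>|lborel. g (0 + e *\<^sub>R \<xi>))"
    using e by (intro lborel_integral_affine) auto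
  finally have "complex_of_real ((2 * pi) powr (real DIM('a) / 2) * exp (- (norm (x /\<^sub>R e))\<^sup>2 / 2)) /\<^sub>R e ^ DIM('a)
      = (\<bar>e\<bar> ^ DIM('a) *\<^sub>R (LINT \<xi>|lborel. g (0 + e *\<^sub>R \<xi>))) /\<^sub>R e ^ DIM('a)"
    by (rule arg_cong)
  also have "\<dots> = (LINT \<xi>|lborel. g (0 + e *\<^sub>R \<xi>))"
    using e by (simp only: scaleR_scaleR abs_of_pos) simp
  finally have "(LINT \<xi>|lborel. g (0 + e *\<^sub>R \<xi>)) =
      complex_of_real ((2 * pi) powr (real DIM('a) / 2) * exp (- (norm (x /\<^sub>R e))\<^sup>2 / 2)) /\<^sub>R e ^ DIM('a)"
    by (rule sym)
  also have "\<dots> = complex_of_real ((2 * pi) powr (real DIM('a) / 2) * exp (- (norm (x /\<^sub>R e))\<^sup>2 / 2) / e ^ DIM('a))"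
    by (simp only: scaleR_conv_of_real divide_inverse of_real_mult of_real_inverse mult_ac)
  also have "(2 * pi) powr (real DIM('a) / 2) * exp (- (norm (x /\<^sub>R e))\<^sup>2 / 2) / e ^ DIM('a) = (2 * pi) ^ DIM('a) * heat e x"
  proof -
    have "(2 * pi) ^ DIM('a) * (2 * pi) powr (- real DIM('a) / 2) = (2 * pi) powr (real DIM('a) / 2)"
    proof -
      have "(2 * pi) ^ DIM('a) * (2 * pi) powr (- real DIM('a) / 2) = (2 * pi) powr real DIM('a) * (2 * pi) powr (- real DIM('a) / 2)"
        by (subst powr_realpow) auto
      also have "\<dots> = (2 * pi) powr (real DIM('a) / 2)" unfolding powr_add[symmetric] by simp
      finally show ?thesis .
    qed
    moreover have "- (norm (x /\<^sub>R e))\<^sup>2 / 2 = - (norm x)\<^sup>2 / (2 * e\<^sup>2)"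
    proof -
      have "(norm (x /\<^sub>R e))\<^sup>2 = (norm x)\<^sup>2 / e\<^sup>2"
        using e by (simp add: power_mult_distrib power_inverse field_simps)
      thus ?thesis by simp
    qed
    ultimately show ?thesis unfolding heat_def
      by (simp only: mult.assoc[symmetric] times_divide_eq_left times_divide_eq_right)
  qed
  finally show ?B unfolding eq .
qed

lemma integral_heat:
  fixes x :: "'a::euclidean_space"
  assumes e: "e > 0"
  shows "integrable lborel (heat e :: 'a \<Rightarrow> real)" "(LINT z|lborel. heat e (z :: 'a)) = 1"
proof -
  \<comment> \<open>The kernel is read as the integrand of \<open>integral_std_gaussian\<close> at
    frequency 0.\<close>
  have h1: "heat 1 z = (2 * pi) powr (- real DIM('a) / 2) * Re (exp (\<i> * complex_of_real (0 \<bullet> z)) * complex_of_real (exp (- (norm z)\<^sup>2 / 2)))" for z :: 'a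
    by (simp add: heat_def)
  have i1: "integrable lborel (heat 1 :: 'a \<Rightarrow> real)"
    unfolding h1[abs_def] using integral_std_gaussian(1)[of "0::'a"]
    by (intro integrable_mult_right integrable_Re)
  have l1: "(LINT z|lborel. heat 1 (z :: 'a)) = 1"
    unfolding h1 using integral_std_gaussian[of "0::'a"]
    by (simp add: integral_Re powr_add[symmetric])
  have eq: "heat e (0 + e *\<^sub>R z) = heat 1 z / e ^ DIM('a)" for z :: 'a
    using heat_scale[OF e, of z] e by (simp add: field_simps)
  show "integrable lborel (heat e :: 'a \<Rightarrow> real)"
    using e i1 lborel_integrable_affine_iff[of e "heat e :: 'a \<Rightarrow> real" 0] by (simp only: eq) simp
  show "(LINT z|lborel. heat e (z :: 'a)) = 1"
    using e l1 lborel_integral_affine[of e "heat e :: 'a \<Rightarrow> real" 0] by (simp only: eq) simp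
qed

text \<open>The substitution y = x + e z moves e from the kernel into the argument of \<psi>. With
  the kernel fixed, dominated convergence can be applied as e tends to 0.\<close>

lemma integral_heat_conv:
  fixes \<psi> :: "'a::euclidean_space \<Rightarrow> complex"
  assumes e: "e > 0" and [measurable]: "\<psi> \<in> borel_measurable borel"
  shows "(LINT y|lborel. \<psi> y * complex_of_real (heat e (x - y))) = (LINT z|lborel. \<psi> (x + e *\<^sub>R z) * complex_of_real (heat 1 z))"
proof -
  have "(LINT y|lborel. \<psi> y * complex_of_real (heat e (x - y))) =
     \<bar>e\<bar> ^ DIM('a) *\<^sub>R (LINT z|lborel. \<psi> (x + e *\<^sub>R z) * complex_of_real (heat e (x - (x + e *\<^sub>R z))))"
    using e by (intro lborel_integral_affine) auto
  also have "\<dots> = (LINT z|lborel. e ^ DIM('a) *\<^sub>R (\<psi> (x + e *\<^sub>R z) * complex_of_real (heat e (x - (x + e *\<^sub>R z)))))"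
    using e by simp
  also have "\<dots> = (LINT z|lborel. \<psi> (x + e *\<^sub>R z) * complex_of_real (heat 1 z))"
  proof (rule Bochner_Integration.integral_cong[OF refl])
    fix z
    have "heat e (x - (x + e *\<^sub>R z)) = heat e (e *\<^sub>R z)" by (simp add: heat_def)
    thus "e ^ DIM('a) *\<^sub>R (\<psi> (x + e *\<^sub>R z) * complex_of_real (heat e (x - (x + e *\<^sub>R z)))) = \<psi> (x + e *\<^sub>R z) * complex_of_real (heat 1 z)"
      unfolding heat_scale[OF e, symmetric] by (simp add: scaleR_conv_of_real)
  qed
  finally show ?thesis .
qed

lemma heat_conv_tendsto:
  fixes \<psi> :: "'a::euclidean_space \<Rightarrow> complex"
  assumes c: "continuous_on UNIV \<psi>" and b: "\<And>x. norm (\<psi> x) \<le> B"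
    and e: "\<And>k. e k > 0" "e \<longlonglongrightarrow> 0"
  shows "(\<lambda>k. LINT y|lborel. \<psi> y * complex_of_real (heat (e k) (x - y))) \<longlonglongrightarrow> \<psi> x"
proof -
  have [measurable]: "\<psi> \<in> borel_measurable borel" using c by (rule borel_measurable_continuous_onI)
  have "(\<lambda>k. LINT z|lborel. \<psi> (x + e k *\<^sub>R z) * complex_of_real (heat 1 z)) \<longlonglongrightarrow> (LINT z|(lborel::'a measure). \<psi> x * complex_of_real (heat 1 z))"
  proof (rule integral_dominated_convergence)
    show "integrable lborel (\<lambda>z. B * heat 1 (z::'a))"
      by (intro integrable_mult_right integral_heat) simp
    have "(\<lambda>k. \<psi> (x + e k *\<^sub>R z) * complex_of_real (heat 1 z)) \<longlonglongrightarrow> \<psi> x * complex_of_real (heat 1 z)" for z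
    proof -
      have "(\<lambda>k. x + e k *\<^sub>R z) \<longlonglongrightarrow> x + 0 *\<^sub>R z" by (intro tendsto_intros e)
      hence "(\<lambda>k. \<psi> (x + e k *\<^sub>R z)) \<longlonglongrightarrow> \<psi> x"
        using c by (auto simp: continuous_on_eq_continuous_at intro: isCont_tendsto_compose)
      thus ?thesis by (intro tendsto_intros)
    qed
    thus "AE z in lborel. (\<lambda>k. \<psi> (x + e k *\<^sub>R z) * complex_of_real (heat 1 z)) \<longlonglongrightarrow> \<psi> x * complex_of_real (heat 1 z)" by simp
    show "AE z in lborel. norm (\<psi> (x + e k *\<^sub>R z) * complex_of_real (heat 1 z)) \<le> B * heat 1 z" for k
      by (simp add: norm_mult heat_nonneg b mult_right_mono)
  qed measurable
  thus ?thesis using integral_heat(2)[of 1, where 'a='a]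
    by (simp add: integral_heat_conv e)
qed

section \<open>The Fourier integral on \<open>L\<^sup>1 \<inter> L\<^sup>2\<close>\<close>

text \<open>Integrability is not assumed because the Bochner integral of a non-integrable function
  is 0. Inner integrals can thus be estimated inside an outer one without checking them point by
  point.\<close>

lemma norm_integral_le_nn_integral:
  fixes f :: "'a \<Rightarrow> 'b::{banach, second_countable_topology}"
  shows "ennreal (norm (LINT x|M. f x)) \<le> (\<integral>\<^sup>+x. ennreal (norm (f x)) \<partial>M)"
  by (cases "integrable M f") (auto intro: integral_norm_bound_ennreal simp: not_integrable_integral_eq)

text \<open>Meant for oscillating kernels of modulus one: the double integral is dominated by that
  of the product of \<open>a x\<close> and \<open>b y\<close>.\<close>

lemma integrable_kernel:
  fixes a b :: "'a::euclidean_space \<Rightarrow> complex" and k :: "'a \<Rightarrow> 'a \<Rightarrow> complex"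
  assumes a: "integrable lborel a" and b: "integrable lborel b"
    and k [measurable]: "case_prod k \<in> borel_measurable (borel \<Otimes>\<^sub>M borel)"
    and k1: "\<And>x y. norm (k x y) \<le> 1"
  shows "integrable (lborel \<Otimes>\<^sub>M lborel) (\<lambda>(x, y). a x * k x y * b y)"
proof -
  have [measurable]: "a \<in> borel_measurable borel" "b \<in> borel_measurable borel" using a b by auto
  have "integrable (lborel \<Otimes>\<^sub>M lborel) (\<lambda>(x, y). a x * b y)"
  proof (rule lborel_pair.Fubini_integrable)
    show "integrable lborel (\<lambda>x. LINT y|lborel. norm (case (x, y) of (x, y) \<Rightarrow> a x * b y))"
      using a by (simp add: norm_mult)
    show "AE x in lborel. integrable lborel (\<lambda>y. case (x, y) of (x, y) \<Rightarrow> a x * b y)"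
      using b by simp
  qed measurable
  thus ?thesis
  proof (rule Bochner_Integration.integrable_bound)
    show "(\<lambda>(x, y). a x * k x y * b y) \<in> borel_measurable (lborel \<Otimes>\<^sub>M lborel)" by measurable
    have "norm (a x * k x y * b y) \<le> norm (a x * b y)" for x y
      using k1[of x y] mult_left_le[of "norm (k x y)" "norm (a x) * norm (b y)"] by (simp add: norm_mult mult_ac)
    thus "AE z in lborel \<Otimes>\<^sub>M lborel. norm (case z of (x, y) \<Rightarrow> a x * k x y * b y) \<le> norm (case z of (x, y) \<Rightarrow> a x * b y)"
      by auto
  qed
qed

lemma Fubini_kernel:
  fixes a b :: "'a::euclidean_space \<Rightarrow> complex" and k :: "'a \<Rightarrow> 'a \<Rightarrow> complex"
  assumes "integrable lborel a" "integrable lborel b"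
    and "case_prod k \<in> borel_measurable (borel \<Otimes>\<^sub>M borel)" "\<And>x y. norm (k x y) \<le> 1"
  shows "(LINT y|lborel. (LINT x|lborel. a x * k x y) * b y) = (LINT x|lborel. a x * (LINT y|lborel. k x y * b y))"
proof -
  have "(LINT y|lborel. (LINT x|lborel. a x * k x y * b y)) = (LINT x|lborel. (LINT y|lborel. a x * k x y * b y))"
    by (rule lborel_pair.Fubini_integral) (use integrable_kernel[OF assms] in \<open>simp add: case_prod_unfold\<close>)
  hence "(LINT y|lborel. (LINT x|lborel. a x * k x y) * b y) = (LINT x|lborel. (LINT y|lborel. a x * k x y * b y))"
    by (simp only: integral_mult_left_zero)
  thus ?thesis by (simp only: mult.assoc integral_mult_right_zero)
qed

lemma fourier_integral_measurable [measurable]: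
  assumes [measurable]: "f \<in> borel_measurable borel"
  shows "fourier_integral f \<in> borel_measurable borel"
  unfolding fourier_integral_def[abs_def] by measurable

lemma norm_exp_i_real [simp]: "norm (exp (- \<i> * complex_of_real x)) = 1" "norm (exp (\<i> * complex_of_real x)) = 1"
  using norm_exp_i_times[of x] norm_exp_i_times[of "- x"] by simp_all

lemma norm_fourier_integral_le:
  fixes f :: "real ^ 'n::finite \<Rightarrow> complex"
  shows "norm (fourier_integral f \<xi>) \<le> (2 * pi) powr (- real CARD('n) / 2) * L1_norm f"
proof -
  have "norm (LINT x|lborel. exp (- \<i> * complex_of_real (x \<bullet> \<xi>)) * f x) \<le>
      (LINT x|lborel. norm (exp (- \<i> * complex_of_real (x \<bullet> \<xi>)) * f x))"
    by (rule integral_norm_bound)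
  also have "\<dots> = L1_norm f" by (simp only: L1_norm_def norm_mult norm_exp_i_real mult_1)
  finally show ?thesis by (simp add: fourier_integral_def norm_mult mult_left_mono)
qed

lemma integrable_bounded_mult:
  fixes g h :: "'a::euclidean_space \<Rightarrow> complex"
  assumes "integrable lborel h" "g \<in> borel_measurable borel" "\<And>x. norm (g x) \<le> B"
  shows "integrable lborel (\<lambda>x. g x * h x)"
proof (rule Bochner_Integration.integrable_bound)
  show "integrable lborel (\<lambda>x. B * norm (h x))" using assms(1) by simp
  have "norm (g x * h x) \<le> \<bar>B * norm (h x)\<bar>" for x
    using assms(3)[of x] norm_ge_zero[of "g x"] by (auto simp: norm_mult abs_mult intro!: mult_right_mono)
  thus "AE x in lborel. norm (g x * h x) \<le> norm (B * norm (h x))" by simp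
qed (use assms in measurable)

text \<open>
  The Gaussian factor makes all iterated integrals absolutely convergent, so that Fubini applies
  before the regularisation parameter \<open>e\<close> tends to \<open>0\<close>.
\<close>

lemma fourier_integral_gaussian_pairing:
  fixes f h :: "real ^ 'n::finite \<Rightarrow> complex"
  assumes f: "integrable lborel f" and h: "integrable lborel h" and e: "e > 0"
  shows "(LINT \<xi>|lborel. fourier_integral f \<xi> * (cnj (fourier_integral h \<xi>) * complex_of_real (exp (- e\<^sup>2 * (norm \<xi>)\<^sup>2 / 2)))) =
    (LINT x|lborel. f x * (LINT y|lborel. cnj (h y) * complex_of_real (heat e (x - y))))"
proof -
  define c where "c = (2 * pi) powr (- real CARD('n) / 2)"
  define G where "G \<xi> = complex_of_real (exp (- e\<^sup>2 * (norm \<xi>)\<^sup>2 / 2))" for \<xi> :: "real ^ 'n"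
  define H where "H \<xi> = cnj (fourier_integral h \<xi>) * G \<xi>" for \<xi>
  have [measurable]: "f \<in> borel_measurable borel" "h \<in> borel_measurable borel" using f h by auto
  have G: "integrable lborel G"
    using integral_gaussian(1)[OF e, of "0 :: real ^ 'n"] unfolding G_def by simp
  have H: "integrable lborel H"
    unfolding H_def by (rule integrable_bounded_mult[OF G, of _ "c * L1_norm h"])
      (use norm_fourier_integral_le[of h] in \<open>auto simp: c_def\<close>)
  \<comment> \<open>The normalising constants of the two Fourier integrals cancel the constant of
    the Gaussian integral.\<close>
  have cc: "c * (c * (2 * pi) ^ CARD('n)) = 1"
  proof -
    have "c * (c * (2 * pi) ^ CARD('n)) = c * (c * (2 * pi) powr real CARD('n))" by (subst powr_realpow) auto
    also have "\<dots> = 1" unfolding c_def powr_add[symmetric] by simp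
    finally show ?thesis .
  qed
  have inner: "(LINT \<xi>|lborel. exp (- \<i> * complex_of_real (x \<bullet> \<xi>)) * H \<xi>) =
      complex_of_real (c * (2 * pi) ^ CARD('n)) * (LINT y|lborel. cnj (h y) * complex_of_real (heat e (x - y)))" for x
  proof -
    define E where "E \<xi> = exp (- \<i> * complex_of_real (x \<bullet> \<xi>)) * G \<xi>" for \<xi>
    have E: "integrable lborel E" unfolding E_def
      by (rule integrable_bounded_mult[OF G, of _ 1]) auto
    have cF: "cnj (fourier_integral h \<xi>) = complex_of_real c * (LINT y|lborel. cnj (h y) * exp (\<i> * complex_of_real (y \<bullet> \<xi>)))" for \<xi>
    proof -
      have "cnj (exp (- \<i> * complex_of_real (y \<bullet> \<xi>)) * h y) = cnj (h y) * exp (\<i> * complex_of_real (y \<bullet> \<xi>))" for y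
        by (simp add: exp_cnj mult.commute)
      thus ?thesis
        unfolding fourier_integral_def c_def[symmetric] complex_cnj_mult[of "complex_of_real c"] Bochner_Integration.integral_cnj[symmetric]
        by (simp only: complex_cnj_complex_of_real)
    qed
    have "(LINT \<xi>|lborel. exp (- \<i> * complex_of_real (x \<bullet> \<xi>)) * H \<xi>) =
        complex_of_real c * (LINT \<xi>|lborel. (LINT y|lborel. cnj (h y) * exp (\<i> * complex_of_real (y \<bullet> \<xi>))) * E \<xi>)"
      unfolding integral_mult_right_zero[symmetric]
      by (intro Bochner_Integration.integral_cong refl) (simp only: H_def E_def cF mult_ac)
    \<comment> \<open>First of two exchanges: \<open>E\<close> combines the Gaussian with the
      exponential in x, so the \<xi>-integral becomes that of a Gaussian at frequency y - x. The
      exchange of x and \<xi> follows further down, with \<open>H\<close> as the integrable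
      weight.\<close>
    also have "(LINT \<xi>|lborel. (LINT y|lborel. cnj (h y) * exp (\<i> * complex_of_real (y \<bullet> \<xi>))) * E \<xi>) =
        (LINT y|lborel. cnj (h y) * (LINT \<xi>|lborel. exp (\<i> * complex_of_real (y \<bullet> \<xi>)) * E \<xi>))"
    proof (rule Fubini_kernel)
      show "integrable lborel (\<lambda>y. cnj (h y))" using h by simp
    qed (use E in \<open>auto\<close>)
    also have "\<dots> = (LINT y|lborel. cnj (h y) * complex_of_real ((2 * pi) ^ CARD('n) * heat e (x - y)))"
    proof (intro Bochner_Integration.integral_cong refl arg_cong2[where f = times])
      fix y
      have "exp (\<i> * complex_of_real (y \<bullet> \<xi>)) * E \<xi> = exp (\<i> * complex_of_real ((y - x) \<bullet> \<xi>)) * complex_of_real (exp (- e\<^sup>2 * (norm \<xi>)\<^sup>2 / 2))" for \<xi>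
        unfolding E_def G_def mult.assoc[symmetric] exp_add[symmetric] by (simp add: inner_diff_left algebra_simps)
      thus "(LINT \<xi>|lborel. exp (\<i> * complex_of_real (y \<bullet> \<xi>)) * E \<xi>) = complex_of_real ((2 * pi) ^ CARD('n) * heat e (x - y))"
        using integral_gaussian(2)[OF e, of "y - x"] by (simp only: heat_minus[of e x y]) simp
    qed
    also have "\<dots> = complex_of_real ((2 * pi) ^ CARD('n)) * (LINT y|lborel. cnj (h y) * complex_of_real (heat e (x - y)))"
      unfolding integral_mult_right_zero[symmetric]
      by (intro Bochner_Integration.integral_cong refl) (simp only: of_real_mult mult_ac)
    finally show ?thesis by (simp only: of_real_mult mult.assoc)
  qed
  have Ff: "fourier_integral f \<xi> = complex_of_real c * (LINT x|lborel. f x * exp (- \<i> * complex_of_real (x \<bullet> \<xi>)))" for \<xi>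
    unfolding fourier_integral_def c_def[symmetric] by (simp only: mult.commute[of "f _"])
  have "(LINT \<xi>|lborel. fourier_integral f \<xi> * H \<xi>) =
     complex_of_real c * (LINT \<xi>|lborel. (LINT x|lborel. f x * exp (- \<i> * complex_of_real (x \<bullet> \<xi>))) * H \<xi>)"
    by (simp only: Ff mult.assoc integral_mult_right_zero)
  also have "(LINT \<xi>|lborel. (LINT x|lborel. f x * exp (- \<i> * complex_of_real (x \<bullet> \<xi>))) * H \<xi>) =
      (LINT x|lborel. f x * (LINT \<xi>|lborel. exp (- \<i> * complex_of_real (x \<bullet> \<xi>)) * H \<xi>))"
    by (rule Fubini_kernel) (use f H in \<open>auto\<close>)
  also have "complex_of_real c * \<dots> = (LINT x|lborel. complex_of_real (c * (c * (2 * pi) ^ CARD('n))) *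
      (f x * (LINT y|lborel. cnj (h y) * complex_of_real (heat e (x - y)))))"
    unfolding integral_mult_right_zero[symmetric] inner
    by (intro Bochner_Integration.integral_cong refl) (simp only: of_real_mult mult_ac)
  finally show ?thesis unfolding cc H_def G_def by simp
qed

lemma nn_integral_heat:
  fixes x :: "'a::euclidean_space"
  assumes "e > 0"
  shows "(\<integral>\<^sup>+y. ennreal (heat e (x - y)) \<partial>lborel) = 1"
proof -
  have "integrable lborel (\<lambda>y. heat e (x - y))"
    using integral_heat(1)[OF assms, where 'a='a] lborel_integrable_affine_iff[of "-1" "heat e :: 'a \<Rightarrow> real" x] by simp
  moreover have "(LINT y|lborel. heat e (x - y)) = 1"
    using integral_heat(2)[OF assms, where 'a='a] lborel_integral_affine[of "-1" "heat e :: 'a \<Rightarrow> real" x] by simp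
  ultimately show ?thesis
    using assms by (subst nn_integral_eq_integral) (auto simp: heat_nonneg)
qed

text \<open>Schur's test: |f(x)| |f(y)| is at most half of |f(x)|^2 + |f(y)|^2, and the kernel has
  mass one in each variable. The bound does not depend on e.\<close>

lemma heat_form_bound:
  fixes f :: "'a::euclidean_space \<Rightarrow> complex"
  assumes f: "square_integrable f" and e: "e > 0"
  shows "norm (LINT x|lborel. f x * (LINT y|lborel. cnj (f y) * complex_of_real (heat e (x - y)))) \<le> (L2_norm f)\<^sup>2"
proof -
  note [measurable] = square_integrable_measurable[OF f, simplified]
  define q where "q x = ennreal ((norm (f x))\<^sup>2 / 2)" for x
  define K where "K x y = ennreal (heat e (x - y))" for x y :: 'a
  have [measurable]: "q \<in> borel_measurable borel" unfolding q_def[abs_def] by measurable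
  have [measurable]: "case_prod K \<in> borel_measurable (borel \<Otimes>\<^sub>M borel)" unfolding K_def[abs_def] by measurable
  have "ennreal (norm (LINT x|lborel. f x * (LINT y|lborel. cnj (f y) * complex_of_real (heat e (x - y))))) \<le>
      (\<integral>\<^sup>+x. ennreal (norm (f x)) * ennreal (norm (LINT y|lborel. cnj (f y) * complex_of_real (heat e (x - y)))) \<partial>lborel)"
    using norm_integral_le_nn_integral[of lborel "\<lambda>x. f x * (LINT y|lborel. cnj (f y) * complex_of_real (heat e (x - y)))"]
    by (simp only: norm_mult ennreal_mult norm_ge_zero)
  also have "\<dots> \<le> (\<integral>\<^sup>+x. ennreal (norm (f x)) * (\<integral>\<^sup>+y. ennreal (norm (cnj (f y) * complex_of_real (heat e (x - y)))) \<partial>lborel) \<partial>lborel)"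
    by (intro nn_integral_mono mult_left_mono norm_integral_le_nn_integral) auto
  also have "\<dots> = (\<integral>\<^sup>+x. (\<integral>\<^sup>+y. ennreal (norm (f x) * norm (f y)) * K x y \<partial>lborel) \<partial>lborel)"
  proof (intro nn_integral_cong)
    fix x
    have "ennreal (norm (f x)) * (\<integral>\<^sup>+y. ennreal (norm (cnj (f y) * complex_of_real (heat e (x - y)))) \<partial>lborel)
      = (\<integral>\<^sup>+y. ennreal (norm (f x)) * ennreal (norm (cnj (f y) * complex_of_real (heat e (x - y)))) \<partial>lborel)"
      by (rule nn_integral_cmult[symmetric]) measurable
    also have "\<dots> = (\<integral>\<^sup>+y. ennreal (norm (f x) * norm (f y)) * K x y \<partial>lborel)"
      using e by (intro nn_integral_cong) (simp add: norm_mult ennreal_mult heat_nonneg K_def mult_ac)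
    finally show "ennreal (norm (f x)) * (\<integral>\<^sup>+y. ennreal (norm (cnj (f y) * complex_of_real (heat e (x - y)))) \<partial>lborel)
      = (\<integral>\<^sup>+y. ennreal (norm (f x) * norm (f y)) * K x y \<partial>lborel)" .
  qed
  also have "\<dots> \<le> (\<integral>\<^sup>+x. (\<integral>\<^sup>+y. (q x + q y) * K x y \<partial>lborel) \<partial>lborel)"
  proof (intro nn_integral_mono mult_right_mono)
    fix x y
    have "norm (f x) * norm (f y) \<le> (norm (f x))\<^sup>2 / 2 + (norm (f y))\<^sup>2 / 2"
      using sum_squares_bound[of "norm (f x)" "norm (f y)"] by simp
    thus "ennreal (norm (f x) * norm (f y)) \<le> q x + q y"
      unfolding q_def by (simp add: ennreal_plus[symmetric] ennreal_leI del: ennreal_plus)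
  qed auto
  also have "\<dots> = (\<integral>\<^sup>+x. (\<integral>\<^sup>+y. q x * K x y \<partial>lborel) + (\<integral>\<^sup>+y. q y * K x y \<partial>lborel) \<partial>lborel)"
    by (simp add: distrib_right nn_integral_add)
  also have "\<dots> = (\<integral>\<^sup>+x. (\<integral>\<^sup>+y. q x * K x y \<partial>lborel) \<partial>lborel) + (\<integral>\<^sup>+x. (\<integral>\<^sup>+y. q y * K x y \<partial>lborel) \<partial>lborel)"
    by (rule nn_integral_add) measurable
  also have "(\<integral>\<^sup>+x. (\<integral>\<^sup>+y. q y * K x y \<partial>lborel) \<partial>lborel) = (\<integral>\<^sup>+y. (\<integral>\<^sup>+x. q y * K x y \<partial>lborel) \<partial>lborel)"
    by (rule lborel_pair.Fubini') measurable
  also have "(\<integral>\<^sup>+x. (\<integral>\<^sup>+y. q x * K x y \<partial>lborel) \<partial>lborel) = (\<integral>\<^sup>+x. q x \<partial>lborel)"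
  proof (rule nn_integral_cong)
    fix x
    show "(\<integral>\<^sup>+y. q x * K x y \<partial>lborel) = q x"
      unfolding K_def by (subst nn_integral_cmult) (auto simp: nn_integral_heat e)
  qed
  also have "(\<integral>\<^sup>+y. (\<integral>\<^sup>+x. q y * K x y \<partial>lborel) \<partial>lborel) = (\<integral>\<^sup>+y. q y \<partial>lborel)"
  proof (rule nn_integral_cong)
    fix y
    have "(\<integral>\<^sup>+x. q y * K x y \<partial>lborel) = (\<integral>\<^sup>+x. q y * ennreal (heat e (y - x)) \<partial>lborel)"
      unfolding K_def by (intro nn_integral_cong) (simp only: heat_minus)
    also have "\<dots> = q y"
      by (subst nn_integral_cmult) (auto simp: nn_integral_heat e)
    finally show "(\<integral>\<^sup>+x. q y * K x y \<partial>lborel) = q y" .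
  qed
  also have "(\<integral>\<^sup>+x. q x \<partial>lborel) + (\<integral>\<^sup>+x. q x \<partial>lborel) = (\<integral>\<^sup>+x. q x + q x \<partial>lborel)"
    by (rule nn_integral_add[symmetric]) measurable
  also have "\<dots> = (\<integral>\<^sup>+x. ennreal ((norm (f x))\<^sup>2) \<partial>lborel)"
    by (intro nn_integral_cong) (simp add: q_def ennreal_plus[symmetric] del: ennreal_plus)
  also have "\<dots> = ennreal ((L2_norm f)\<^sup>2)" by (rule nn_integral_norm_square[OF f])
  finally show ?thesis by simp
qed

text \<open>Pairing f with itself in the regularised identity gives a weighted square integral of
  the transform, bounded by the squared L2 norm of f uniformly in e. The weights increase to 1 as e
  tends to 0, and Fatou's lemma removes them.\<close>

lemma fourier_integral_L2:
  fixes f :: "real ^ 'n::finite \<Rightarrow> complex"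
  assumes f: "integrable lborel f" "square_integrable f"
  shows "square_integrable (fourier_integral f)" "L2_norm (fourier_integral f) \<le> L2_norm f"
proof -
  have [measurable]: "f \<in> borel_measurable borel" using f by auto
  define e where "e k = inverse (real (Suc k))" for k
  have e: "e k > 0" "e \<longlonglongrightarrow> 0" for k
    using LIMSEQ_inverse_real_of_nat unfolding e_def[abs_def] by simp_all
  define W where "W k \<xi> = exp (- (e k)\<^sup>2 * (norm \<xi>)\<^sup>2 / 2)" for k and \<xi> :: "real ^ 'n"
  have [measurable]: "W k \<in> borel_measurable borel" for k unfolding W_def[abs_def] by measurable
  have WG: "integrable lborel (W k)" for k
    using integral_gaussian(1)[OF e(1)[of k], of "0 :: real ^ 'n", THEN integrable_Re] unfolding W_def by simp
  have "(\<integral>\<^sup>+\<xi>. ennreal ((norm (fourier_integral f \<xi>))\<^sup>2 * W k \<xi>) \<partial>lborel) \<le> ennreal ((L2_norm f)\<^sup>2)" for k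
  proof -
    have int: "integrable lborel (\<lambda>\<xi>. (norm (fourier_integral f \<xi>))\<^sup>2 * W k \<xi>)"
    proof (rule Bochner_Integration.integrable_bound)
      show "integrable lborel (\<lambda>\<xi>. ((2 * pi) powr (- real CARD('n) / 2) * L1_norm f)\<^sup>2 * W k \<xi>)" using WG by simp
      show "AE \<xi> in lborel. norm ((norm (fourier_integral f \<xi>))\<^sup>2 * W k \<xi>) \<le> norm (((2 * pi) powr (- real CARD('n) / 2) * L1_norm f)\<^sup>2 * W k \<xi>)"
        using norm_fourier_integral_le[of f] by (auto simp: abs_mult W_def intro!: mult_right_mono power_mono)
    qed measurable
    have "complex_of_real (LINT \<xi>|lborel. (norm (fourier_integral f \<xi>))\<^sup>2 * W k \<xi>) =
        (LINT \<xi>|lborel. fourier_integral f \<xi> * (cnj (fourier_integral f \<xi>) * complex_of_real (W k \<xi>)))"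
      unfolding integral_complex_of_real[symmetric]
      by (simp only: of_real_mult complex_norm_square mult.assoc)
    also have "\<dots> = (LINT x|lborel. f x * (LINT y|lborel. cnj (f y) * complex_of_real (heat (e k) (x - y))))"
      unfolding W_def by (rule fourier_integral_gaussian_pairing[OF f(1) f(1) e(1)])
    finally have "\<bar>LINT \<xi>|lborel. (norm (fourier_integral f \<xi>))\<^sup>2 * W k \<xi>\<bar> \<le> (L2_norm f)\<^sup>2"
      using heat_form_bound[OF f(2) e(1)[of k]] by (metis norm_of_real)
    thus ?thesis using int by (subst nn_integral_eq_integral) (auto simp: W_def intro!: ennreal_leI)
  qed note bound = this
  have lim: "(\<lambda>k. ennreal ((norm (fourier_integral f \<xi>))\<^sup>2 * W k \<xi>)) \<longlonglongrightarrow> ennreal ((norm (fourier_integral f \<xi>))\<^sup>2)" for \<xi>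
  proof (rule tendsto_ennrealI)
    have "(\<lambda>k. (norm (fourier_integral f \<xi>))\<^sup>2 * W k \<xi>) \<longlonglongrightarrow> (norm (fourier_integral f \<xi>))\<^sup>2 * exp (- 0\<^sup>2 * (norm \<xi>)\<^sup>2 / 2)"
      unfolding W_def by (intro tendsto_intros e) simp
    thus "(\<lambda>k. (norm (fourier_integral f \<xi>))\<^sup>2 * W k \<xi>) \<longlonglongrightarrow> (norm (fourier_integral f \<xi>))\<^sup>2" by simp
  qed
  have "(\<integral>\<^sup>+\<xi>. ennreal ((norm (fourier_integral f \<xi>))\<^sup>2) \<partial>lborel) =
      (\<integral>\<^sup>+\<xi>. liminf (\<lambda>k. ennreal ((norm (fourier_integral f \<xi>))\<^sup>2 * W k \<xi>)) \<partial>lborel)"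
    using lim by (intro nn_integral_cong) (metis lim_imp_Liminf sequentially_bot)
  also have "\<dots> \<le> liminf (\<lambda>k. \<integral>\<^sup>+\<xi>. ennreal ((norm (fourier_integral f \<xi>))\<^sup>2 * W k \<xi>) \<partial>lborel)"
    by (rule nn_integral_liminf) measurable
  also have "\<dots> \<le> ennreal ((L2_norm f)\<^sup>2)"
    using bound by (auto intro!: Liminf_le)
  finally show "square_integrable (fourier_integral f)" "L2_norm (fourier_integral f) \<le> L2_norm f"
    by (auto intro!: square_integrableI_nn[of _ "L2_norm f"])
qed

text \<open>Both sides of the regularised identity converge as e tends to 0. In Fourier space the
  product of two L2 transforms is the majorant. In physical space the heat averages of \<phi>
  converge pointwise, as \<phi> is continuous, and stay below its bound \<open>B\<close>, so
  \<open>B\<close> times |f| is a majorant.\<close>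

lemma Parseval_L1:
  fixes f \<phi> :: "real ^ 'n::finite \<Rightarrow> complex"
  assumes f: "integrable lborel f" "square_integrable f" and \<phi>: "continuous_on UNIV \<phi>" "bounded {x. \<phi> x \<noteq> 0}"
  shows "(LINT \<xi>|lborel. fourier_integral f \<xi> * cnj (fourier_integral \<phi> \<xi>)) = (LINT x|lborel. f x * cnj (\<phi> x))"
proof -
  note p = continuous_bounded_support_integrable[OF \<phi>]
  obtain B where B: "0 \<le> B" "\<And>x. norm (\<phi> x) \<le> B"
    using continuous_bounded_support_bounded[OF \<phi>] by metis
  have [measurable]: "f \<in> borel_measurable borel" "\<phi> \<in> borel_measurable borel" using f p by auto
  define e where "e k = inverse (real (Suc k))" for k
  have e: "e k > 0" "e \<longlonglongrightarrow> 0" for k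
    using LIMSEQ_inverse_real_of_nat unfolding e_def[abs_def] by simp_all
  define W where "W k \<xi> = complex_of_real (exp (- (e k)\<^sup>2 * (norm \<xi>)\<^sup>2 / 2))" for k and \<xi> :: "real ^ 'n"
  have [measurable]: "W k \<in> borel_measurable borel" for k unfolding W_def[abs_def] by measurable
  have "(\<lambda>k. LINT \<xi>|lborel. fourier_integral f \<xi> * (cnj (fourier_integral \<phi> \<xi>) * W k \<xi>)) \<longlonglongrightarrow>
      (LINT \<xi>|lborel. fourier_integral f \<xi> * cnj (fourier_integral \<phi> \<xi>))"
  proof (rule integral_dominated_convergence)
    show "integrable lborel (\<lambda>\<xi>. norm (fourier_integral f \<xi> * cnj (fourier_integral \<phi> \<xi>)))"
      by (intro integrable_norm Cauchy_Schwarz_norm fourier_integral_L2 f p)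
    have "(\<lambda>k. fourier_integral f \<xi> * (cnj (fourier_integral \<phi> \<xi>) * W k \<xi>)) \<longlonglongrightarrow>
       fourier_integral f \<xi> * (cnj (fourier_integral \<phi> \<xi>) * complex_of_real (exp (- 0\<^sup>2 * (norm \<xi>)\<^sup>2 / 2)))" for \<xi>
      unfolding W_def by (intro tendsto_intros e) simp
    thus "AE \<xi> in lborel. (\<lambda>k. fourier_integral f \<xi> * (cnj (fourier_integral \<phi> \<xi>) * W k \<xi>)) \<longlonglongrightarrow> fourier_integral f \<xi> * cnj (fourier_integral \<phi> \<xi>)"
      by simp
    show "AE \<xi> in lborel. norm (fourier_integral f \<xi> * (cnj (fourier_integral \<phi> \<xi>) * W k \<xi>)) \<le> norm (fourier_integral f \<xi> * cnj (fourier_integral \<phi> \<xi>))" for k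
      by (auto simp: norm_mult W_def mult.assoc[symmetric] intro!: mult_left_le)
  qed measurable
  moreover have "(\<lambda>k. LINT x|lborel. f x * (LINT y|lborel. cnj (\<phi> y) * complex_of_real (heat (e k) (x - y)))) \<longlonglongrightarrow> (LINT x|lborel. f x * cnj (\<phi> x))"
  proof (rule integral_dominated_convergence)
    show "integrable lborel (\<lambda>x. B * norm (f x))" using f by simp
    have "(\<lambda>k. LINT y|lborel. cnj (\<phi> y) * complex_of_real (heat (e k) (x - y))) \<longlonglongrightarrow> cnj (\<phi> x)" for x
      by (rule heat_conv_tendsto[where B = B]) (use \<phi> B e in \<open>auto intro!: continuous_intros\<close>)
    thus "AE x in lborel. (\<lambda>k. f x * (LINT y|lborel. cnj (\<phi> y) * complex_of_real (heat (e k) (x - y)))) \<longlonglongrightarrow> f x * cnj (\<phi> x)"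
      by (auto intro!: tendsto_intros)
    have "norm (LINT y|lborel. cnj (\<phi> y) * complex_of_real (heat (e k) (x - y))) \<le> B" for k x
    proof -
      have "ennreal (norm (LINT y|lborel. cnj (\<phi> y) * complex_of_real (heat (e k) (x - y)))) \<le>
          (\<integral>\<^sup>+y. ennreal (norm (cnj (\<phi> y) * complex_of_real (heat (e k) (x - y)))) \<partial>lborel)"
        by (rule norm_integral_le_nn_integral)
      also have "\<dots> \<le> (\<integral>\<^sup>+y. ennreal B * ennreal (heat (e k) (x - y)) \<partial>lborel)"
        using B e(1)[of k] by (intro nn_integral_mono) (auto simp: norm_mult heat_nonneg ennreal_mult[symmetric] intro!: ennreal_leI mult_right_mono)
      also have "\<dots> = ennreal B"
        by (subst nn_integral_cmult) (auto simp: nn_integral_heat e)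
      finally show ?thesis using B by simp
    qed
    thus "AE x in lborel. norm (f x * (LINT y|lborel. cnj (\<phi> y) * complex_of_real (heat (e k) (x - y)))) \<le> B * norm (f x)" for k
      by (intro AE_I2) (metis mult.commute mult_right_mono norm_ge_zero norm_mult)
  qed measurable
  ultimately show ?thesis
    unfolding W_def fourier_integral_gaussian_pairing[OF f(1) p(1) e(1)] by (rule LIMSEQ_unique)
qed

section \<open>The Fourier transform on \<open>L\<^sup>2\<close>\<close>

lemma norm_diff_le_has_vector_derivative:
  fixes f :: "real \<Rightarrow> 'b::real_normed_vector"
  assumes f: "\<And>x. a \<le> x \<Longrightarrow> x \<le> b \<Longrightarrow> (f has_vector_derivative f' x) (at x)"
    and B: "\<And>x. a \<le> x \<Longrightarrow> x \<le> b \<Longrightarrow> norm (f' x) \<le> B" and ab: "a \<le> b"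
  shows "norm (f b - f a) \<le> B * (b - a)"
proof -
  have "norm (f b - f a) \<le> B * norm (b - a)"
  proof (rule differentiable_bound[of "{a..b}" f "\<lambda>x h. h *\<^sub>R f' x"])
    show "(f has_derivative (\<lambda>h. h *\<^sub>R f' x)) (at x within {a..b})" if "x \<in> {a..b}" for x
      using f[of x] that by (auto simp: has_vector_derivative_def intro: has_derivative_at_withinI)
    show "onorm (\<lambda>h. h *\<^sub>R f' x) \<le> B" if "x \<in> {a..b}" for x
      using B[of x] that by (intro onorm_le) (auto simp: mult.commute[of B] intro!: mult_left_mono)
  qed (use ab in auto)
  thus ?thesis using ab by simp
qed

text \<open>On a ball, L2 is contained in L1 by Cauchy-Schwarz against the indicator. The
  truncations in \<open>has_fourier\<close> thereby come within reach of the results on L1 and L2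
  jointly.\<close>

lemma truncation_integrable:
  fixes f :: "'a::euclidean_space \<Rightarrow> complex"
  assumes f: "square_integrable f"
  shows "integrable lborel (\<lambda>x. indicator (cball 0 R) x * f x)"
    and "square_integrable (\<lambda>x. indicator (cball 0 R) x * f x)"
proof -
  note [measurable] = square_integrable_measurable[OF f, simplified]
  have [measurable]: "cball (0::'a) R \<in> sets borel" by auto
  have "integrable lborel (indicator (cball (0::'a) R) :: _ \<Rightarrow> real)"
    by (intro integrable_real_indicator emeasure_bounded_finite) auto
  moreover have "(norm (indicator (cball 0 R) x :: complex))\<^sup>2 = indicator (cball 0 R) x" for x :: 'a
    by (simp add: indicator_def)
  ultimately have "square_integrable (\<lambda>x::'a. indicator (cball 0 R) x :: complex)"
    by (simp add: square_integrable_def)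
  from Cauchy_Schwarz_norm(1)[OF this f]
  show "integrable lborel (\<lambda>x. indicator (cball 0 R) x * f x)" .
  show "square_integrable (\<lambda>x. indicator (cball 0 R) x * f x)"
    by (rule square_integrable_bound[OF f]) (auto simp: indicator_def)
qed

text \<open>Once the ball of radius R contains the support of \<phi>, truncating f does not change
  its pairing with \<phi>. The discrepancy \<open>d\<close> is then bounded by the L2 distance of
  the truncated transforms from g, which tends to 0.\<close>

lemma has_fourier_Parseval:
  fixes f g \<phi> :: "real ^ 'n::finite \<Rightarrow> complex"
  assumes fg: "has_fourier f g" and \<phi>: "continuous_on UNIV \<phi>" "bounded {x. \<phi> x \<noteq> 0}"
  shows "(LINT \<xi>|lborel. g \<xi> * cnj (fourier_integral \<phi> \<xi>)) = (LINT x|lborel. f x * cnj (\<phi> x))"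
proof -
  define T where "T R x = indicator (cball 0 R) x * f x" for R x
  have f: "square_integrable f" and g: "square_integrable g"
    and lim: "((\<lambda>R. L2_norm (\<lambda>\<xi>. fourier_integral (T R) \<xi> - g \<xi>)) \<longlongrightarrow> 0) at_top"
    using fg by (auto simp: has_fourier_def T_def[abs_def])
  note T = truncation_integrable[OF f, folded T_def]
  note p = continuous_bounded_support_integrable[OF \<phi>]
  note F\<phi> = fourier_integral_L2[OF p]
  obtain R0 where R0: "\<And>x. \<phi> x \<noteq> 0 \<Longrightarrow> norm x \<le> R0"
    using continuous_bounded_support_bounded[OF \<phi>] by metis
  define d where "d = norm ((LINT x|lborel. f x * cnj (\<phi> x)) - (LINT \<xi>|lborel. g \<xi> * cnj (fourier_integral \<phi> \<xi>)))"
  have "d \<le> L2_norm (\<lambda>\<xi>. fourier_integral (T R) \<xi> - g \<xi>) * L2_norm (fourier_integral \<phi>)" if R: "R0 \<le> R" for R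
  proof -
    have "T R x * cnj (\<phi> x) = f x * cnj (\<phi> x)" for x
      using R0[of x] R by (cases "\<phi> x = 0") (auto simp: T_def)
    hence "(LINT x|lborel. f x * cnj (\<phi> x)) = (LINT x|lborel. T R x * cnj (\<phi> x))" by (simp only:)
    also have "\<dots> = (LINT \<xi>|lborel. fourier_integral (T R) \<xi> * cnj (fourier_integral \<phi> \<xi>))"
      by (rule Parseval_L1[symmetric, OF T \<phi>])
    finally have "d = norm (LINT \<xi>|lborel. (fourier_integral (T R) \<xi> - g \<xi>) * cnj (fourier_integral \<phi> \<xi>))"
      unfolding d_def left_diff_distrib
      by (simp add: Bochner_Integration.integral_diff[OF Cauchy_Schwarz_norm(2)[OF fourier_integral_L2(1)[OF T] F\<phi>(1)] Cauchy_Schwarz_norm(2)[OF g F\<phi>(1)]])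
    also have "\<dots> \<le> L2_norm (\<lambda>\<xi>. fourier_integral (T R) \<xi> - g \<xi>) * L2_norm (fourier_integral \<phi>)"
      by (intro Cauchy_Schwarz_norm square_integrable_diff fourier_integral_L2 T g F\<phi>)
    finally show ?thesis .
  qed
  hence "eventually (\<lambda>R. d \<le> L2_norm (\<lambda>\<xi>. fourier_integral (T R) \<xi> - g \<xi>) * L2_norm (fourier_integral \<phi>)) at_top"
    using eventually_ge_at_top[of R0] by (rule eventually_mono[rotated])
  with tendsto_mult_right[OF lim, of "L2_norm (fourier_integral \<phi>)"] have "d \<le> 0 * L2_norm (fourier_integral \<phi>)"
    by (rule tendsto_lowerbound) simp
  thus ?thesis by (simp add: d_def)
qed

text \<open>The entry point of the L1 norms of the data into the final estimate. Truncation does not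
  increase the L1 norm, so the bound is uniform in R and survives the L2 limit, though only almost
  everywhere.\<close>

lemma has_fourier_AE_bound:
  fixes f g :: "real ^ 'n::finite \<Rightarrow> complex"
  assumes fg: "has_fourier f g" and int: "integrable lborel f"
  shows "AE \<xi> in lborel. norm (g \<xi>) \<le> (2 * pi) powr (- real CARD('n) / 2) * L1_norm f"
proof -
  define T where "T R x = indicator (cball 0 R) x * f x" for R x
  define K where "K = (2 * pi) powr (- real CARD('n) / 2) * L1_norm f"
  have f: "square_integrable f" and g: "square_integrable g"
    and lim: "((\<lambda>R. L2_norm (\<lambda>\<xi>. fourier_integral (T R) \<xi> - g \<xi>)) \<longlongrightarrow> 0) at_top"
    using fg by (auto simp: has_fourier_def T_def[abs_def])
  note [measurable] = square_integrable_measurable[OF f, simplified] square_integrable_measurable[OF g, simplified]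
  note T = truncation_integrable[OF f, folded T_def]
  have TK: "norm (fourier_integral (T R) \<xi>) \<le> K" for R \<xi>
  proof -
    have "L1_norm (T R) \<le> L1_norm f"
      unfolding L1_norm_def using int T by (intro integral_mono) (auto simp: T_def indicator_def)
    hence "(2 * pi) powr (- real CARD('n) / 2) * L1_norm (T R) \<le> K"
      unfolding K_def by (rule mult_left_mono) simp
    with norm_fourier_integral_le[of "T R" \<xi>] show ?thesis by simp
  qed
  \<comment> \<open>The excess of \<open>|g|\<close> over \<open>K\<close> is dominated by the distance to every truncated transform,
    all of which are bounded by \<open>K\<close>; hence its \<open>L\<^sup>2\<close> norm vanishes.\<close>
  define m where "m \<xi> = max 0 (norm (g \<xi>) - K)" for \<xi>
  have [measurable]: "m \<in> borel_measurable borel" unfolding m_def[abs_def] by measurable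
  have m: "norm (m \<xi>) \<le> norm (fourier_integral (T R) \<xi> - g \<xi>)" for R \<xi>
    using TK[of R \<xi>] norm_triangle_ineq2[of "g \<xi>" "fourier_integral (T R) \<xi>"]
    by (auto simp: m_def norm_minus_commute)
  have sd: "square_integrable (\<lambda>\<xi>. fourier_integral (T R) \<xi> - g \<xi>)" for R
    by (intro square_integrable_diff fourier_integral_L2 T g)
  have sm: "square_integrable m" by (rule square_integrable_bound[OF sd[of 0]]) (use m in auto)
  have "L2_norm m \<le> L2_norm (\<lambda>\<xi>. fourier_integral (T R) \<xi> - g \<xi>)" for R
    by (rule L2_norm_mono[OF sd]) (use m in auto)
  hence "L2_norm m \<le> 0"
    by (intro tendsto_lowerbound[OF lim]) auto
  hence "(LINT \<xi>|lborel. (norm (m \<xi>))\<^sup>2) = 0"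
    unfolding L2_norm_square[symmetric] using L2_norm_nonneg[of m] by simp
  hence "AE \<xi> in lborel. (norm (m \<xi>))\<^sup>2 = 0"
    using integral_nonneg_eq_0_iff_AE[OF square_integrableD[OF sm]] by simp
  thus ?thesis by eventually_elim (auto simp: m_def K_def max_def split: if_splits)
qed

text \<open>In the pairing with \<phi>, v is replaced by a difference quotient of u at the cost of
  an error that vanishes in the limit. Parseval turns this quotient into one of g, which is
  dominated by |M|; the contraction property then returns from the transform of \<phi> to
  \<phi>.\<close>

lemma L2_norm_velocity_le:
  fixes u g :: "real \<Rightarrow> real ^ 'n::finite \<Rightarrow> complex"
  assumes ug: "\<And>s. t \<le> s \<Longrightarrow> has_fourier (u s) (g s)" and t: "0 \<le> t"
    and v: "square_integrable v" and M: "square_integrable M"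
    and lim: "((\<lambda>s. L2_norm (\<lambda>x. (u s x - u t x) / complex_of_real (s - t) - v x)) \<longlongrightarrow> 0) (at t within {0..})"
    and bound: "\<And>s \<xi>. t < s \<Longrightarrow> norm (g s \<xi> - g t \<xi>) \<le> (s - t) * norm (M \<xi>)"
  shows "L2_norm v \<le> L2_norm M"
proof (rule L2_norm_le_by_duality[OF v L2_norm_nonneg])
  fix \<phi> :: "real ^ 'n \<Rightarrow> complex" assume "test_function \<phi>"
  hence \<phi>: "continuous_on UNIV \<phi>" "bounded {x. \<phi> x \<noteq> 0}"
    using test_function_continuous[of \<phi>] by (auto simp: test_function_def)
  note p = continuous_bounded_support_integrable[OF \<phi>]
  note F\<phi> = fourier_integral_L2[OF p]
  have su: "square_integrable (u s)" "square_integrable (g s)" if "t \<le> s" for s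
    using ug[OF that] by (auto simp: has_fourier_def)
  define I where "I = norm (LINT x|lborel. v x * cnj (\<phi> x))"
  have est: "I \<le> L2_norm M * L2_norm \<phi> + L2_norm (\<lambda>x. (u s x - u t x) / complex_of_real (s - t) - v x) * L2_norm \<phi>"
    if s: "t < s" for s
  proof -
    define w where "w x = (u s x - u t x) / complex_of_real (s - t)" for x
    have wu: "w x = inverse (complex_of_real (s - t)) * (u s x - u t x)" for x
      by (simp only: w_def divide_inverse mult.commute)
    have sdiff: "square_integrable (\<lambda>x. u s x - u t x)" "square_integrable (\<lambda>x. g s x - g t x)"
      using s by (auto intro!: square_integrable_diff su)
    have sw: "square_integrable w"
      using sdiff(1) unfolding square_integrable_def wu[abs_def] norm_mult power_mult_distrib
      by (auto intro!: borel_measurable_times)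
    note sd = square_integrable_diff[OF sw v]
    have "(LINT x|lborel. v x * cnj (\<phi> x)) = (LINT x|lborel. w x * cnj (\<phi> x) - (w x - v x) * cnj (\<phi> x))"
      by (simp add: left_diff_distrib)
    also have "\<dots> = (LINT x|lborel. w x * cnj (\<phi> x)) - (LINT x|lborel. (w x - v x) * cnj (\<phi> x))"
      by (rule Bochner_Integration.integral_diff[OF Cauchy_Schwarz_norm(2)[OF sw p(2)] Cauchy_Schwarz_norm(2)[OF sd p(2)]])
    finally have "I \<le> norm (LINT x|lborel. w x * cnj (\<phi> x)) + L2_norm (\<lambda>x. w x - v x) * L2_norm \<phi>"
      unfolding I_def using norm_triangle_ineq4[of "LINT x|lborel. w x * cnj (\<phi> x)" "LINT x|lborel. (w x - v x) * cnj (\<phi> x)"]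
        Cauchy_Schwarz_norm(4)[OF sd p(2)] by simp
    moreover have "norm (LINT x|lborel. w x * cnj (\<phi> x)) \<le> L2_norm M * L2_norm \<phi>"
    proof -
      have "(LINT x|lborel. w x * cnj (\<phi> x)) = inverse (complex_of_real (s - t)) * (LINT x|lborel. (u s x - u t x) * cnj (\<phi> x))"
        by (simp only: wu mult.assoc integral_mult_right_zero)
      also have "(LINT x|lborel. (u s x - u t x) * cnj (\<phi> x)) = (LINT x|lborel. u s x * cnj (\<phi> x)) - (LINT x|lborel. u t x * cnj (\<phi> x))"
        unfolding left_diff_distrib
        using s by (intro Bochner_Integration.integral_diff Cauchy_Schwarz_norm(2) su p) auto
      also have "\<dots> = (LINT \<xi>|lborel. g s \<xi> * cnj (fourier_integral \<phi> \<xi>)) - (LINT \<xi>|lborel. g t \<xi> * cnj (fourier_integral \<phi> \<xi>))"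
        using s has_fourier_Parseval[OF ug[of s] \<phi>] has_fourier_Parseval[OF ug[of t] \<phi>] by simp
      also have "\<dots> = (LINT \<xi>|lborel. (g s \<xi> - g t \<xi>) * cnj (fourier_integral \<phi> \<xi>))"
        unfolding left_diff_distrib
        using s by (intro Bochner_Integration.integral_diff[symmetric] Cauchy_Schwarz_norm(2) su F\<phi>) auto
      finally have "norm (LINT x|lborel. w x * cnj (\<phi> x)) =
          norm (LINT \<xi>|lborel. (g s \<xi> - g t \<xi>) * cnj (fourier_integral \<phi> \<xi>)) / (s - t)"
        using s by (simp only: norm_mult norm_inverse norm_of_real abs_of_pos diff_gt_0_iff_gt divide_inverse mult.commute)
      also have "norm (LINT \<xi>|lborel. (g s \<xi> - g t \<xi>) * cnj (fourier_integral \<phi> \<xi>)) \<le>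
          L2_norm (\<lambda>\<xi>. g s \<xi> - g t \<xi>) * L2_norm (fourier_integral \<phi>)"
        by (rule Cauchy_Schwarz_norm(4)[OF sdiff(2) F\<phi>(1)])
      also have "\<dots> \<le> ((s - t) * L2_norm M) * L2_norm \<phi>"
      proof (intro mult_mono F\<phi>(2))
        have "square_integrable (\<lambda>\<xi>. (s - t) * norm (M \<xi>))"
          using M unfolding square_integrable_def by (auto simp: power_mult_distrib)
        hence "L2_norm (\<lambda>\<xi>. g s \<xi> - g t \<xi>) \<le> L2_norm (\<lambda>\<xi>. (s - t) * norm (M \<xi>))"
          using s bound[of s] square_integrable_measurable[OF sdiff(2)]
          by (intro L2_norm_mono) (auto simp: abs_mult)
        also have "\<dots> = (s - t) * L2_norm M"
          using s by (simp add: L2_norm_def power_mult_distrib real_sqrt_mult)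
        finally show "L2_norm (\<lambda>\<xi>. g s \<xi> - g t \<xi>) \<le> (s - t) * L2_norm M" .
      qed (use s in auto)
      also have "((s - t) * L2_norm M) * L2_norm \<phi> / (s - t) = L2_norm M * L2_norm \<phi>" using s by simp
      finally show ?thesis using s by (simp add: divide_right_mono)
    qed
    ultimately show ?thesis unfolding w_def by simp
  qed
  \<comment> \<open>Times to the right of t stay in the half line and differ from t, so the limit
    can be taken along them even when t = 0.\<close>
  have "filterlim (\<lambda>k. t + inverse (real (Suc k))) (at t within {0..}) sequentially"
    unfolding filterlim_at
    using t LIMSEQ_inverse_real_of_nat_add[of t] by (auto simp: add_nonneg_nonneg)
  from filterlim_compose[OF lim this]
  have l0: "(\<lambda>k. L2_norm (\<lambda>x. (u (t + inverse (real (Suc k))) x - u t x) / complex_of_real ((t + inverse (real (Suc k))) - t) - v x)) \<longlonglongrightarrow> 0" .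
  have "(\<lambda>k. L2_norm M * L2_norm \<phi> + L2_norm (\<lambda>x. (u (t + inverse (real (Suc k))) x - u t x) / complex_of_real ((t + inverse (real (Suc k))) - t) - v x) * L2_norm \<phi>)
      \<longlonglongrightarrow> L2_norm M * L2_norm \<phi> + 0 * L2_norm \<phi>"
    by (intro tendsto_add tendsto_mult_right tendsto_const l0)
  hence "I \<le> L2_norm M * L2_norm \<phi> + 0 * L2_norm \<phi>"
  proof (rule tendsto_lowerbound)
    have "t < t + inverse (real (Suc k))" for k by simp
    from est[OF this] show "\<forall>\<^sub>F k in sequentially. I \<le> L2_norm M * L2_norm \<phi> + L2_norm (\<lambda>x. (u (t + inverse (real (Suc k))) x - u t x) / complex_of_real ((t + inverse (real (Suc k))) - t) - v x) * L2_norm \<phi>"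
      by (intro always_eventually allI)
  qed simp
  thus "norm (LINT x|lborel. v x * cnj (\<phi> x)) \<le> L2_norm M * L2_norm \<phi>" by (simp add: I_def)
qed

section \<open>Spatial derivatives and the weak gradient\<close>

lemma fourier_integral_translate:
  fixes \<phi> :: "real ^ 'n::finite \<Rightarrow> complex"
  assumes [measurable]: "\<phi> \<in> borel_measurable borel"
  shows "fourier_integral (\<lambda>x. \<phi> (x + h)) \<xi> = exp (\<i> * complex_of_real (h \<bullet> \<xi>)) * fourier_integral \<phi> \<xi>"
proof -
  have "(LINT x|lborel. exp (- \<i> * complex_of_real (x \<bullet> \<xi>)) * \<phi> x) =
      (LINT x|lborel. exp (- \<i> * complex_of_real ((h + 1 *\<^sub>R x) \<bullet> \<xi>)) * \<phi> (h + 1 *\<^sub>R x))"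
    by (subst lborel_integral_affine[of 1 _ h]) auto
  also have "\<dots> = (LINT x|lborel. exp (- \<i> * complex_of_real (h \<bullet> \<xi>)) * (exp (- \<i> * complex_of_real (x \<bullet> \<xi>)) * \<phi> (x + h)))"
    by (intro Bochner_Integration.integral_cong refl)
      (simp only: inner_add_left of_real_add distrib_left exp_add mult_ac scaleR_one add.commute[of h])
  also have "\<dots> = exp (- \<i> * complex_of_real (h \<bullet> \<xi>)) * (LINT x|lborel. exp (- \<i> * complex_of_real (x \<bullet> \<xi>)) * \<phi> (x + h))"
    by (rule integral_mult_right_zero)
  finally have "exp (\<i> * complex_of_real (h \<bullet> \<xi>)) * (LINT x|lborel. exp (- \<i> * complex_of_real (x \<bullet> \<xi>)) * \<phi> x) =
     (LINT x|lborel. exp (- \<i> * complex_of_real (x \<bullet> \<xi>)) * \<phi> (x + h))"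
    by (simp add: mult.assoc[symmetric] exp_add[symmetric])
  thus ?thesis by (simp add: fourier_integral_def mult.left_commute)
qed

lemma norm_exp_i_minus_1_le: "norm (exp (\<i> * complex_of_real s) - 1) \<le> \<bar>s\<bar>"
  using iexp_approx1[of s 0] by simp

text \<open>A difference quotient of \<psi> in direction a with step t has as its transform that of
  \<psi> times (exp(i t a.xi) - 1)/t, a factor of modulus at most |a.xi|. This weight is shifted
  onto g before Cauchy-Schwarz, so the bound involves only the L2 norm of \<psi> and none of its
  derivatives.\<close>

lemma fourier_pairing_derivative_le:
  fixes f g :: "real ^ 'n::finite \<Rightarrow> complex"
  assumes fg: "has_fourier f g"
    and d: "\<And>x. (\<psi> has_derivative \<psi>' x) (at x)" "\<And>h. continuous_on UNIV (\<lambda>x. \<psi>' x h)" "bounded {x. \<psi> x \<noteq> 0}"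
    and sg: "square_integrable (\<lambda>\<xi>. complex_of_real (a \<bullet> \<xi>) * g \<xi>)"
  shows "norm (LINT x|lborel. f x * cnj (\<psi>' x a)) \<le> L2_norm (\<lambda>\<xi>. complex_of_real (a \<bullet> \<xi>) * g \<xi>) * L2_norm \<psi>"
proof -
  have f: "square_integrable f" and g: "square_integrable g" using fg by (auto simp: has_fourier_def)
  have c: "continuous_on UNIV \<psi>"
    using d(1) by (auto intro!: continuous_at_imp_continuous_on intro: has_derivative_continuous)
  note p = continuous_bounded_support_integrable[OF c d(3)]
  note F\<psi> = fourier_integral_L2[OF p]
  have [measurable]: "\<psi> \<in> borel_measurable borel" using p by auto
  obtain R where R: "\<And>x. \<psi> x \<noteq> 0 \<Longrightarrow> norm x \<le> R"
    using continuous_bounded_support_bounded[OF c d(3)] by metis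
  \<comment> \<open>The derivative inherits the bounded support and is therefore bounded. Its bound
    \<open>B\<close> controls all difference quotients by the mean value inequality.\<close>
  have zero: "\<psi>' x h = 0" if x: "norm x > R" for x h
  proof -
    have "((\<lambda>x. 0) has_derivative \<psi>' x) (at x)"
      by (rule has_derivative_transform_within_open[OF d(1), of "- cball 0 R"]) (use x R in force)+
    from has_derivative_unique[OF this has_derivative_const[of 0]] show ?thesis by simp
  qed
  have "bounded {x. \<psi>' x a \<noteq> 0}"
    by (rule bounded_subset[OF bounded_cball[of 0 R]]) (use zero in \<open>force simp: not_less[symmetric]\<close>)
  then obtain B where B: "0 \<le> B" "\<And>x. norm (\<psi>' x a) \<le> B"
    using continuous_bounded_support_bounded[OF d(2)] by metis
  define t where "t k = inverse (real (Suc k))" for k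
  have t0: "0 < t k" "t k \<le> 1" for k by (auto simp: t_def field_simps)
  have t: "t \<longlonglongrightarrow> 0" unfolding t_def by (rule LIMSEQ_inverse_real_of_nat)
  define D where "D k x = (\<psi> (x + t k *\<^sub>R a) - \<psi> x) / complex_of_real (t k)" for k x
  have Dc: "continuous_on UNIV (D k)" for k
    unfolding D_def using t0[of k] by (intro continuous_intros continuous_on_compose2[OF c]) auto
  have Db: "D k x = 0" if "norm x > R + norm a" for k x
  proof -
    have "norm x \<le> norm (x + t k *\<^sub>R a) + norm (t k *\<^sub>R a)"
      using norm_triangle_ineq4[of "x + t k *\<^sub>R a" "t k *\<^sub>R a"] by simp
    moreover have "norm (t k *\<^sub>R a) \<le> norm a" using t0[of k] by (simp add: mult_left_le_one_le)
    ultimately have "norm (x + t k *\<^sub>R a) > R" using that by linarith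
    hence "\<psi> (x + t k *\<^sub>R a) = 0" using R[of "x + t k *\<^sub>R a"] by linarith
    moreover have "\<psi> x = 0" using R[of x] that norm_ge_zero[of a] by linarith
    ultimately show ?thesis by (simp add: D_def)
  qed
  have DB: "norm (D k x) \<le> B" for k x
  proof -
    have "((\<lambda>s. \<psi> (x + s *\<^sub>R a)) has_vector_derivative \<psi>' (x + s *\<^sub>R a) a) (at s)" for s
    proof -
      have "((\<lambda>s. x + s *\<^sub>R a) has_derivative (\<lambda>h. h *\<^sub>R a)) (at s)"
        by (auto intro!: derivative_eq_intros)
      from has_derivative_compose[OF this d(1)]
      have "((\<lambda>s. \<psi> (x + s *\<^sub>R a)) has_derivative (\<lambda>h. \<psi>' (x + s *\<^sub>R a) (h *\<^sub>R a))) (at s)" .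
      thus ?thesis
        unfolding has_vector_derivative_def linear_scale[OF has_derivative_linear[OF d(1)]] .
    qed
    from norm_diff_le_has_vector_derivative[OF this B(2), of 0 "t k"] t0[of k]
    have "norm (\<psi> (x + t k *\<^sub>R a) - \<psi> x) \<le> B * t k" by simp
    thus ?thesis using t0[of k] by (simp add: D_def norm_divide divide_simps)
  qed
  have Dlim: "(\<lambda>k. D k x) \<longlonglongrightarrow> \<psi>' x a" for x
  proof -
    have "((\<lambda>s. x + s *\<^sub>R a) has_derivative (\<lambda>h. h *\<^sub>R a)) (at 0)"
      by (auto intro!: derivative_eq_intros)
    from has_derivative_compose[OF this, of \<psi> "\<psi>' x"] d(1)[of x]
    have "((\<lambda>s. \<psi> (x + s *\<^sub>R a)) has_derivative (\<lambda>h. \<psi>' x (h *\<^sub>R a))) (at 0)" by simp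
    hence "((\<lambda>s. \<psi> (x + s *\<^sub>R a)) has_vector_derivative \<psi>' x a) (at 0)"
      unfolding has_vector_derivative_def linear_scale[OF has_derivative_linear[OF d(1)]] .
    hence l: "(\<lambda>h. norm (\<psi> (x + h *\<^sub>R a) - \<psi> x - h *\<^sub>R \<psi>' x a) / norm h) \<midarrow>0\<rightarrow> 0"
      by (simp add: has_vector_derivative_def has_derivative_at)
    have quot: "norm (\<psi> (x + h *\<^sub>R a) - \<psi> x - h *\<^sub>R \<psi>' x a) / norm h = norm ((\<psi> (x + h *\<^sub>R a) - \<psi> x) /\<^sub>R h - \<psi>' x a)" if "h \<noteq> 0" for h
    proof -
      have "(\<psi> (x + h *\<^sub>R a) - \<psi> x) /\<^sub>R h - \<psi>' x a = (\<psi> (x + h *\<^sub>R a) - \<psi> x - h *\<^sub>R \<psi>' x a) /\<^sub>R h"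
        using that by (simp add: scaleR_diff_right)
      thus ?thesis by (simp only: norm_scaleR norm_inverse real_norm_def abs_inverse divide_inverse mult.commute)
    qed
    have "\<forall>\<^sub>F h in at 0. norm (\<psi> (x + h *\<^sub>R a) - \<psi> x - h *\<^sub>R \<psi>' x a) / norm h = norm ((\<psi> (x + h *\<^sub>R a) - \<psi> x) /\<^sub>R h - \<psi>' x a)"
      unfolding eventually_at_filter by (intro always_eventually allI impI quot)
    from LIM_zero_cancel[OF tendsto_norm_zero_cancel[OF Lim_transform_eventually[OF l this]]]
    have "((\<lambda>s. (\<psi> (x + s *\<^sub>R a) - \<psi> x) /\<^sub>R s) \<longlongrightarrow> \<psi>' x a) (at 0)" .
    moreover have "filterlim t (at 0) sequentially"
      unfolding filterlim_at using t t0 by (auto intro!: always_eventually simp: less_imp_neq[symmetric])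
    ultimately have "(\<lambda>k. (\<psi> (x + t k *\<^sub>R a) - \<psi> x) /\<^sub>R t k) \<longlonglongrightarrow> \<psi>' x a"
      by (rule filterlim_compose)
    thus ?thesis by (simp add: D_def scaleR_conv_of_real divide_inverse mult.commute)
  qed
  have Dbd: "bounded {x. D k x \<noteq> 0}" for k
    by (rule bounded_subset[OF bounded_cball[of 0 "R + norm a"]]) (use Db in \<open>force simp: not_less[symmetric]\<close>)
  have FD: "norm (g \<xi> * cnj (fourier_integral (D k) \<xi>)) \<le> norm ((complex_of_real (a \<bullet> \<xi>) * g \<xi>) * fourier_integral \<psi> \<xi>)" for k \<xi>
  proof -
    have [measurable]: "(\<lambda>x. \<psi> (x + h)) \<in> borel_measurable borel" for h by measurable
    have i: "integrable lborel (\<lambda>x. exp (- \<i> * complex_of_real (x \<bullet> \<xi>)) * \<psi> (x + h))" for h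
    proof (rule integrable_bounded_mult[where B = 1])
      show "integrable lborel (\<lambda>x. \<psi> (x + h))"
        using lborel_integrable_affine_iff[of 1 \<psi> h] p(1) by (simp add: add.commute)
    qed auto
    have "(LINT x|lborel. exp (- \<i> * complex_of_real (x \<bullet> \<xi>)) * D k x) =
       inverse (complex_of_real (t k)) * (LINT x|lborel. exp (- \<i> * complex_of_real (x \<bullet> \<xi>)) * \<psi> (x + t k *\<^sub>R a) - exp (- \<i> * complex_of_real (x \<bullet> \<xi>)) * \<psi> (x + 0))"
      unfolding integral_mult_right_zero[symmetric]
      by (intro Bochner_Integration.integral_cong refl) (simp add: D_def divide_inverse right_diff_distrib mult_ac)
    also have "\<dots> = inverse (complex_of_real (t k)) * ((LINT x|lborel. exp (- \<i> * complex_of_real (x \<bullet> \<xi>)) * \<psi> (x + t k *\<^sub>R a)) - (LINT x|lborel. exp (- \<i> * complex_of_real (x \<bullet> \<xi>)) * \<psi> (x + 0)))"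
      by (subst Bochner_Integration.integral_diff[OF i i]) (rule refl)
    finally have "fourier_integral (D k) \<xi> = inverse (complex_of_real (t k)) * (fourier_integral (\<lambda>x. \<psi> (x + t k *\<^sub>R a)) \<xi> - fourier_integral (\<lambda>x. \<psi> (x + 0)) \<xi>)"
      by (simp only: fourier_integral_def right_diff_distrib mult_ac)
    also have "\<dots> = inverse (complex_of_real (t k)) * ((exp (\<i> * complex_of_real ((t k *\<^sub>R a) \<bullet> \<xi>)) - 1) * fourier_integral \<psi> \<xi>)"
      by (simp only: fourier_integral_translate[OF \<open>\<psi> \<in> borel_measurable borel\<close>]) (simp add: left_diff_distrib)
    finally have eq: "norm (fourier_integral (D k) \<xi>) = norm (exp (\<i> * complex_of_real ((t k *\<^sub>R a) \<bullet> \<xi>)) - 1) / t k * norm (fourier_integral \<psi> \<xi>)"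
      using t0(1)[of k] by (simp only: norm_mult norm_inverse norm_of_real abs_of_pos divide_inverse mult_ac)
    have "norm (exp (\<i> * complex_of_real ((t k *\<^sub>R a) \<bullet> \<xi>)) - 1) / t k \<le> \<bar>a \<bullet> \<xi>\<bar>"
      using norm_exp_i_minus_1_le[of "(t k *\<^sub>R a) \<bullet> \<xi>"] t0[of k] by (simp add: abs_mult divide_simps mult.commute)
    hence "norm (fourier_integral (D k) \<xi>) \<le> \<bar>a \<bullet> \<xi>\<bar> * norm (fourier_integral \<psi> \<xi>)"
      unfolding eq by (rule mult_right_mono) simp
    from mult_left_mono[OF this, of "norm (g \<xi>)"]
    show ?thesis by (simp add: norm_mult mult_ac)
  qed
  define S where "S = L2_norm (\<lambda>\<xi>. complex_of_real (a \<bullet> \<xi>) * g \<xi>) * L2_norm \<psi>"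
  have est: "norm (LINT x|lborel. f x * cnj (D k x)) \<le> S" for k
  proof -
    \<comment> \<open>\<open>FD\<close> compares moduli only, so Cauchy-Schwarz is applied to the
      moduli, regarded as complex functions.\<close>
    have nn: "square_integrable (\<lambda>\<xi>. complex_of_real (norm (h \<xi>)))" "L2_norm (\<lambda>\<xi>. complex_of_real (norm (h \<xi>))) = L2_norm h"
      if "square_integrable h" for h :: "real ^ 'n \<Rightarrow> complex"
      using that by (auto simp: square_integrable_def L2_norm_def)
    define w where "w \<xi> = complex_of_real (a \<bullet> \<xi>) * g \<xi>" for \<xi>
    have sw: "square_integrable w" unfolding w_def by (rule sg)
    have "norm (LINT x|lborel. f x * cnj (D k x)) = norm (LINT \<xi>|lborel. g \<xi> * cnj (fourier_integral (D k) \<xi>))"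
      by (subst has_fourier_Parseval[OF fg Dc Dbd]) (rule refl)
    also have "\<dots> \<le> (LINT \<xi>|lborel. norm (g \<xi> * cnj (fourier_integral (D k) \<xi>)))"
      by (rule integral_norm_bound)
    also have "\<dots> \<le> (LINT \<xi>|lborel. norm (w \<xi> * fourier_integral \<psi> \<xi>))"
    proof (rule integral_mono)
      show "integrable lborel (\<lambda>\<xi>. norm (g \<xi> * cnj (fourier_integral (D k) \<xi>)))"
        by (intro integrable_norm Cauchy_Schwarz_norm g fourier_integral_L2 continuous_bounded_support_integrable Dc Dbd)
      show "integrable lborel (\<lambda>\<xi>. norm (w \<xi> * fourier_integral \<psi> \<xi>))"
        by (intro integrable_norm Cauchy_Schwarz_norm sw F\<psi>)
    qed (use FD in \<open>simp add: w_def\<close>)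
    also have "\<dots> = norm (LINT \<xi>|lborel. complex_of_real (norm (w \<xi>)) * complex_of_real (norm (fourier_integral \<psi> \<xi>)))"
      by (simp only: of_real_mult[symmetric] integral_complex_of_real norm_of_real norm_mult) (simp add: abs_of_nonneg integral_nonneg_AE)
    also have "\<dots> \<le> L2_norm w * L2_norm (fourier_integral \<psi>)"
      using Cauchy_Schwarz_norm(3)[OF nn(1)[OF sw] nn(1)[OF F\<psi>(1)]] unfolding nn(2)[OF sw] nn(2)[OF F\<psi>(1)] .
    also have "\<dots> \<le> S"
      unfolding S_def w_def by (intro mult_left_mono F\<psi>) simp
    finally show ?thesis .
  qed
  have "(\<lambda>k. LINT x|lborel. f x * cnj (D k x)) \<longlonglongrightarrow> (LINT x|lborel. f x * cnj (\<psi>' x a))"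
  proof (rule integral_dominated_convergence)
    have [measurable]: "f \<in> borel_measurable borel" using f by (simp add: square_integrable_def)
    show "(\<lambda>x. f x * cnj (\<psi>' x a)) \<in> borel_measurable lborel"
      using borel_measurable_continuous_onI[OF d(2)[of a]] by measurable
    show "(\<lambda>x. f x * cnj (D k x)) \<in> borel_measurable lborel" for k
      using borel_measurable_continuous_onI[OF Dc[of k]] by measurable
    \<comment> \<open>As steps are at most 1, all quotients vanish outside one ball of radius R +
      |a|; cutting f off there makes the majorant integrable although f is only in L2.\<close>
    show "integrable lborel (\<lambda>x. B * norm (indicator (cball 0 (R + norm a)) x * f x))"
      by (intro integrable_mult_right integrable_norm truncation_integrable f)
    show "AE x in lborel. (\<lambda>k. f x * cnj (D k x)) \<longlonglongrightarrow> f x * cnj (\<psi>' x a)"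
      using Dlim by (auto intro!: tendsto_intros)
    have "norm (f x * cnj (D k x)) \<le> B * norm (indicator (cball 0 (R + norm a)) x * f x)" for k x
      using DB[of k x] Db[of x k]
      by (cases "norm x \<le> R + norm a") (auto simp: norm_mult mult.commute[of "norm (f x)"] intro!: mult_right_mono)
    thus "AE x in lborel. norm (f x * cnj (D k x)) \<le> B * norm (indicator (cball 0 (R + norm a)) x * f x)" for k by simp
  qed
  from tendsto_norm[OF this] show ?thesis
    unfolding S_def[symmetric] by (rule tendsto_upperbound) (auto simp: est)
qed

text \<open>Duality is applied to each component, with weight xi_j. Summing the squares of these
  weights restores |xi|^2, so the constant is 1 in every dimension.\<close>

lemma L2_norm_gradient_le:
  fixes f g :: "real ^ 'n::finite \<Rightarrow> complex"
  assumes fg: "has_fourier f g" and wg: "weak_gradient f G"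
    and sg: "square_integrable (\<lambda>\<xi>. complex_of_real (norm \<xi>) * g \<xi>)"
  shows "L2_norm G \<le> L2_norm (\<lambda>\<xi>. complex_of_real (norm \<xi>) * g \<xi>)"
proof -
  have G: "square_integrable G" and weak: "\<And>\<phi> \<phi>' j. (\<And>x. (\<phi> has_derivative \<phi>' x) (at x)) \<Longrightarrow> (\<And>h. continuous_on UNIV (\<lambda>x. \<phi>' x h)) \<Longrightarrow>
      bounded {x. \<phi> x \<noteq> (0::complex)} \<Longrightarrow> (LINT x|lborel. f x * \<phi>' x (axis j 1)) = - (LINT x|lborel. (G x $ j) * \<phi> x)"
    using wg unfolding weak_gradient_def by blast+
  have g: "square_integrable g" using fg by (simp add: has_fourier_def)
  note [measurable] = square_integrable_measurable[OF g, simplified] square_integrable_measurable[OF G, simplified]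
  have nm: "norm (complex_of_real (axis j 1 \<bullet> \<xi>) * g \<xi>) \<le> norm (complex_of_real (norm \<xi>) * g \<xi>)" for j :: 'n and \<xi>
    using component_le_norm_cart[of \<xi> j] by (auto simp: norm_mult inner_axis' intro!: mult_right_mono)
  have sj: "square_integrable (\<lambda>\<xi>. complex_of_real (axis j 1 \<bullet> \<xi>) * g \<xi>)" for j :: 'n
    by (rule square_integrable_bound[OF sg]) (use nm in auto)
  have mG: "(\<lambda>x. G x $ j) \<in> borel_measurable lborel" for j
  proof -
    have "(\<lambda>z::complex ^ 'n. z $ j) \<in> borel_measurable borel"
      by (intro borel_measurable_continuous_onI continuous_intros)
    from measurable_compose[OF _ this, of G lborel] show ?thesis by simp
  qed
  have Gj: "square_integrable (\<lambda>x. G x $ j)" for j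
    by (rule square_integrable_bound[OF G mG]) (simp add: Finite_Cartesian_Product.norm_nth_le)
  have comp: "L2_norm (\<lambda>x. G x $ j) \<le> L2_norm (\<lambda>\<xi>. complex_of_real (axis j 1 \<bullet> \<xi>) * g \<xi>)" for j
  proof (rule L2_norm_le_by_duality[OF Gj L2_norm_nonneg])
    fix \<psi> :: "real ^ 'n \<Rightarrow> complex" assume "test_function \<psi>"
    then obtain \<psi>' where d: "\<And>x. (\<psi> has_derivative \<psi>' x) (at x)" "\<And>h. continuous_on UNIV (\<lambda>x. \<psi>' x h)" "bounded {x. \<psi> x \<noteq> 0}"
      unfolding test_function_def C1_def by blast
    \<comment> \<open>\<open>weak_gradient\<close> pairs without conjugation while the duality lemma
      conjugates, so the conjugate of \<psi> is the function tested against.\<close>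
    have "(LINT x|lborel. f x * cnj (\<psi>' x (axis j 1))) = - (LINT x|lborel. (G x $ j) * cnj (\<psi> x))"
    proof (rule weak)
      show "((\<lambda>x. cnj (\<psi> x)) has_derivative (\<lambda>h. cnj (\<psi>' x h))) (at x)" for x
        by (rule bounded_linear.has_derivative[OF bounded_linear_cnj d(1)])
    qed (use d in \<open>auto intro!: continuous_intros\<close>)
    hence "norm (LINT x|lborel. (G x $ j) * cnj (\<psi> x)) = norm (LINT x|lborel. f x * cnj (\<psi>' x (axis j 1)))"
      by (simp only: norm_minus_cancel)
    also have "\<dots> \<le> L2_norm (\<lambda>\<xi>. complex_of_real (axis j 1 \<bullet> \<xi>) * g \<xi>) * L2_norm \<psi>"
      by (rule fourier_pairing_derivative_le[OF fg d sj])
    finally show "norm (LINT x|lborel. (G x $ j) * cnj (\<psi> x)) \<le> L2_norm (\<lambda>\<xi>. complex_of_real (axis j 1 \<bullet> \<xi>) * g \<xi>) * L2_norm \<psi>" .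
  qed
  have sum: "(norm z)\<^sup>2 = (\<Sum>j\<in>UNIV. (norm (z $ j))\<^sup>2)" for z :: "'b::real_normed_vector ^ 'n"
    by (simp add: norm_vec_def L2_set_def sum_nonneg)
  have "(L2_norm G)\<^sup>2 = (\<Sum>j\<in>UNIV. (L2_norm (\<lambda>x. G x $ j))\<^sup>2)"
    unfolding L2_norm_square sum using Gj by (intro Bochner_Integration.integral_sum) (auto dest: square_integrableD)
  also have "\<dots> \<le> (\<Sum>j\<in>UNIV. (L2_norm (\<lambda>\<xi>. complex_of_real (axis j 1 \<bullet> \<xi>) * g \<xi>))\<^sup>2)"
    by (intro sum_mono power_mono comp) simp
  also have "\<dots> = (LINT \<xi>|lborel. (\<Sum>j\<in>UNIV. (norm (complex_of_real (axis j 1 \<bullet> \<xi>) * g \<xi>))\<^sup>2))"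
    unfolding L2_norm_square using sj by (intro Bochner_Integration.integral_sum[symmetric]) (auto dest: square_integrableD)
  also have "\<dots> = (L2_norm (\<lambda>\<xi>. complex_of_real (norm \<xi>) * g \<xi>))\<^sup>2"
    unfolding L2_norm_square
    by (intro Bochner_Integration.integral_cong refl)
      (simp add: norm_mult power_mult_distrib sum inner_axis' sum_distrib_right)
  finally show ?thesis by (rule power2_le_imp_le) simp
qed

section \<open>Energy decay in Fourier space\<close>

text \<open>The summand with r^4/2 in \<open>L\<close> cancels the product of w and w' that the
  damping produces, leaving L' = -(r^4 - \<rho>)|w'|^2 - \<rho> r^2 |w|^2. With 2\<rho> \<le> r^4
  this is at most -\<rho> times the energy. The conditions 2\<rho> \<le> r and 2\<rho> r^2 \<le> 1
  bound the two corrections in \<open>L\<close> by a quarter of the energy e each; the second is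
  nonnegative, so e/4 \<le> L \<le> e. This is the origin of the factor 4.\<close>

lemma damped_oscillator_energy_decay:
  fixes w w' :: "real \<Rightarrow> complex"
  assumes w: "\<And>t. (w has_vector_derivative w' t) (at t)"
    and w': "\<And>t. (w' has_vector_derivative - complex_of_real (r ^ 4) * w' t - complex_of_real (r ^ 2) * w t) (at t)"
    and r: "0 \<le> r" "0 \<le> \<rho>" "2 * \<rho> \<le> r ^ 4" "2 * \<rho> \<le> r" "2 * \<rho> * r\<^sup>2 \<le> 1"
    and t: "0 \<le> t"
  shows "(norm (w' t))\<^sup>2 + r\<^sup>2 * (norm (w t))\<^sup>2 \<le> 4 * exp (- \<rho> * t) * ((norm (w' 0))\<^sup>2 + r\<^sup>2 * (norm (w 0))\<^sup>2)"
proof -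
  define e where "e s = (norm (w' s))\<^sup>2 + r\<^sup>2 * (norm (w s))\<^sup>2" for s
  define L where "L s = (w' s \<bullet> w' s + r\<^sup>2 * (w s \<bullet> w s)) / 2 + \<rho> * (w' s \<bullet> w s + r ^ 4 / 2 * (w s \<bullet> w s))" for s
  define L' where "L' s = - (r ^ 4 - \<rho>) * (w' s \<bullet> w' s) - \<rho> * r\<^sup>2 * (w s \<bullet> w s)" for s
  have e0: "0 \<le> e s" for s by (simp add: e_def)
  have nn: "w s \<bullet> w s = (norm (w s))\<^sup>2" "w' s \<bullet> w' s = (norm (w' s))\<^sup>2" for s
    by (simp_all add: power2_norm_eq_inner)
  have dL: "(L has_real_derivative L' s) (at s)" for s
  proof -
    define a where "a = - complex_of_real (r ^ 4) * w' s - complex_of_real (r ^ 2) * w s"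
    have a: "a = (- (r ^ 4)) *\<^sub>R w' s - r\<^sup>2 *\<^sub>R w s" by (simp add: a_def scaleR_conv_of_real)
    note dw = w[of s, unfolded has_vector_derivative_def] and dw' = w'[of s, folded a_def, unfolded has_vector_derivative_def]
    note i = has_derivative_inner[OF dw' dw'] has_derivative_inner[OF dw dw] has_derivative_inner[OF dw' dw]
    have i': "((\<lambda>s. w' s \<bullet> w' s) has_real_derivative 2 * (w' s \<bullet> a)) (at s)"
      "((\<lambda>s. w s \<bullet> w s) has_real_derivative 2 * (w s \<bullet> w' s)) (at s)"
      "((\<lambda>s. w' s \<bullet> w s) has_real_derivative (w' s \<bullet> w' s + a \<bullet> w s)) (at s)"
    proof -
      have "(\<lambda>h. w' s \<bullet> (h *\<^sub>R a) + (h *\<^sub>R a) \<bullet> w' s) = (*) (2 * (w' s \<bullet> a))"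
        by (rule ext) (simp add: inner_commute[of a "w' s"])
      with i(1) show "((\<lambda>s. w' s \<bullet> w' s) has_real_derivative 2 * (w' s \<bullet> a)) (at s)"
        unfolding has_field_derivative_def by simp
      have "(\<lambda>h. w s \<bullet> (h *\<^sub>R w' s) + (h *\<^sub>R w' s) \<bullet> w s) = (*) (2 * (w s \<bullet> w' s))"
        by (rule ext) (simp add: inner_commute[of "w' s" "w s"])
      with i(2) show "((\<lambda>s. w s \<bullet> w s) has_real_derivative 2 * (w s \<bullet> w' s)) (at s)"
        unfolding has_field_derivative_def by simp
      have "(\<lambda>h. w' s \<bullet> (h *\<^sub>R w' s) + (h *\<^sub>R a) \<bullet> w s) = (*) (w' s \<bullet> w' s + a \<bullet> w s)"
        by (rule ext) (simp add: distrib_left mult.commute)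
      with i(3) show "((\<lambda>s. w' s \<bullet> w s) has_real_derivative (w' s \<bullet> w' s + a \<bullet> w s)) (at s)"
        unfolding has_field_derivative_def by simp
    qed
    have "(L has_real_derivative (2 * (w' s \<bullet> a) + r\<^sup>2 * (2 * (w s \<bullet> w' s))) / 2 + \<rho> * ((w' s \<bullet> w' s + a \<bullet> w s) + r ^ 4 / 2 * (2 * (w s \<bullet> w' s)))) (at s)"
      unfolding L_def
      by (intro DERIV_add DERIV_cdivide DERIV_cmult i')
    moreover have "(2 * (w' s \<bullet> a) + r\<^sup>2 * (2 * (w s \<bullet> w' s))) / 2 + \<rho> * ((w' s \<bullet> w' s + a \<bullet> w s) + r ^ 4 / 2 * (2 * (w s \<bullet> w' s))) = L' s"
    proof -
      have c: "w s \<bullet> w' s = w' s \<bullet> w s" by (rule inner_commute)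
      have "w' s \<bullet> a = - (r ^ 4) * (w' s \<bullet> w' s) - r\<^sup>2 * (w' s \<bullet> w s)"
        "a \<bullet> w s = - (r ^ 4) * (w' s \<bullet> w s) - r\<^sup>2 * (w s \<bullet> w s)"
        unfolding a by (simp_all only: inner_diff_left inner_diff_right inner_scaleR_left inner_scaleR_right)
      moreover have "(2 * (- R * P - q * X) + q * (2 * X)) / 2 + \<rho> * (P + (- R * X - q * Q) + R / 2 * (2 * X))
          = - (R - \<rho>) * P - \<rho> * q * Q" for P X Q R q :: real
        by (simp add: field_simps)
      ultimately show ?thesis unfolding L'_def c by (simp only:)
    qed
    ultimately show ?thesis by simp
  qed
  have cross: "\<bar>\<rho> * (w' s \<bullet> w s)\<bar> \<le> e s / 4" for s
  proof -
    have "\<bar>\<rho> * (w' s \<bullet> w s)\<bar> \<le> \<rho> * (norm (w' s) * norm (w s))"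
      using r Cauchy_Schwarz_ineq2[of "w' s" "w s"] by (simp add: abs_mult mult_left_mono)
    also have "\<dots> \<le> r / 2 * (norm (w' s) * norm (w s))"
      using r by (intro mult_right_mono) auto
    also have "\<dots> \<le> e s / 4"
      using sum_squares_bound[of "norm (w' s)" "r * norm (w s)"]
      by (simp add: e_def power_mult_distrib mult_ac)
    finally show ?thesis .
  qed
  have pot: "0 \<le> \<rho> * (r ^ 4 / 2 * (w s \<bullet> w s))" "\<rho> * (r ^ 4 / 2 * (w s \<bullet> w s)) \<le> e s / 4" for s
  proof -
    show "0 \<le> \<rho> * (r ^ 4 / 2 * (w s \<bullet> w s))" using r by simp
    have "\<rho> * (r ^ 4 / 2 * (w s \<bullet> w s)) = (2 * \<rho> * r\<^sup>2) * (r\<^sup>2 * (norm (w s))\<^sup>2 / 4)"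
      unfolding nn by (simp add: power2_eq_square power4_eq_xxxx)
    also have "\<dots> \<le> 1 * (r\<^sup>2 * (norm (w s))\<^sup>2 / 4)"
      using r by (intro mult_right_mono) auto
    also have "\<dots> \<le> e s / 4" by (simp add: e_def)
    finally show "\<rho> * (r ^ 4 / 2 * (w s \<bullet> w s)) \<le> e s / 4" .
  qed
  have Le: "L s = e s / 2 + \<rho> * (w' s \<bullet> w s) + \<rho> * (r ^ 4 / 2 * (w s \<bullet> w s))" for s
    unfolding L_def e_def nn by (simp add: algebra_simps)
  have "E \<le> 4 * (E / 2 + A + B) \<and> E / 2 + A + B \<le> E"
    if "\<bar>A\<bar> \<le> E / 4" "0 \<le> B" "B \<le> E / 4" for A B E :: real
    using that by auto
  from this[OF cross pot] have low: "e s \<le> 4 * L s" and up: "L s \<le> e s" for s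
    unfolding Le by auto
  have L'e: "L' s \<le> - \<rho> * L s" for s
  proof -
    have "\<rho> * (norm (w' s))\<^sup>2 \<le> (r ^ 4 - \<rho>) * (norm (w' s))\<^sup>2"
      using r by (intro mult_right_mono) auto
    hence "L' s \<le> - \<rho> * e s" unfolding L'_def e_def nn by (simp add: algebra_simps)
    also have "\<dots> \<le> - \<rho> * L s" using up[of s] r by (simp add: mult_left_mono)
    finally show ?thesis .
  qed
  have "exp (\<rho> * t) * L t \<le> exp (\<rho> * 0) * L 0"
  proof (rule DERIV_nonpos_imp_nonincreasing[OF t])
    fix s
    have "((\<lambda>s. exp (\<rho> * s) * L s) has_real_derivative exp (\<rho> * s) * (\<rho> * L s + L' s)) (at s)"
      by (auto intro!: derivative_eq_intros dL simp: algebra_simps)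
    moreover have "exp (\<rho> * s) * (\<rho> * L s + L' s) \<le> 0"
      using L'e[of s] by (intro mult_nonneg_nonpos) auto
    ultimately show "\<exists>y. ((\<lambda>s. exp (\<rho> * s) * L s) has_real_derivative y) (at s) \<and> y \<le> 0" by blast
  qed
  hence "exp (- \<rho> * t) * (exp (\<rho> * t) * L t) \<le> exp (- \<rho> * t) * e 0"
    using up[of 0] by (intro mult_left_mono) auto
  hence "L t \<le> exp (- \<rho> * t) * e 0" by (simp add: mult.assoc[symmetric] exp_add[symmetric])
  with low[of t] show ?thesis unfolding e_def by simp
qed

text \<open>
  Up to constants, the largest \<open>\<rho>\<close> admissible in the previous lemma; the four bounds below are its
  hypotheses.
\<close>

definition decay_rate :: "real \<Rightarrow> real" where
  "decay_rate r = (if r \<le> 1 then r ^ 4 / 2 else 1 / (2 * r\<^sup>2))"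

lemma decay_rate_bounds:
  assumes "0 \<le> r"
  shows "0 \<le> decay_rate r" "2 * decay_rate r \<le> r ^ 4" "2 * decay_rate r \<le> r" "2 * decay_rate r * r\<^sup>2 \<le> 1"
proof -
  show "0 \<le> decay_rate r" by (simp add: decay_rate_def)
  show "2 * decay_rate r \<le> r ^ 4" "2 * decay_rate r \<le> r" "2 * decay_rate r * r\<^sup>2 \<le> 1"
  proof (atomize (full), cases "r \<le> 1")
    case True
    have "r ^ 4 \<le> r" using power_decreasing[of 1 4 r] assms True by simp
    moreover have "r ^ 4 * r\<^sup>2 \<le> 1" using assms True by (intro mult_le_one power_le_one) auto
    ultimately show "2 * decay_rate r \<le> r ^ 4 \<and> 2 * decay_rate r \<le> r \<and> 2 * decay_rate r * r\<^sup>2 \<le> 1"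
      using True by (simp add: decay_rate_def)
  next
    case False
    hence *: "2 * decay_rate r = 1 / r\<^sup>2" by (simp add: decay_rate_def)
    have "1 / r\<^sup>2 \<le> 1" using False one_le_power[of r 2] by simp
    moreover have "1 \<le> r ^ 4" using False by (intro one_le_power) simp
    ultimately show "2 * decay_rate r \<le> r ^ 4 \<and> 2 * decay_rate r \<le> r \<and> 2 * decay_rate r * r\<^sup>2 \<le> 1"
      using False unfolding * by (intro conjI; (linarith | simp))
  qed
qed

definition energy_bound :: "real \<Rightarrow> real \<Rightarrow> complex \<Rightarrow> complex \<Rightarrow> real" where
  "energy_bound t r a b = 4 * exp (- decay_rate r * t) * ((norm b)\<^sup>2 + r\<^sup>2 * (norm a)\<^sup>2)"

lemma energy_bound_nonneg: "0 \<le> energy_bound t r a b"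
  by (simp add: energy_bound_def)

text \<open>The second bound is the mean value inequality on [t, s]: since
  \<open>energy_bound\<close> is nonincreasing in time, its value at t controls |w'| from t onwards.
  It has the form that \<open>L2_norm_velocity_le\<close> asks for, with M the square root of
  \<open>energy_bound\<close>.\<close>

lemma solution_multiplier_energy:
  assumes r: "0 \<le> r" and t: "0 \<le> t"
  shows "r\<^sup>2 * (norm (solution_multiplier t r a b))\<^sup>2 \<le> energy_bound t r a b"
    and "t \<le> s \<Longrightarrow> norm (solution_multiplier s r a b - solution_multiplier t r a b) \<le> (s - t) * sqrt (energy_bound t r a b)"
proof -
  define w where "w = (\<lambda>t. solution_multiplier t r a b)"
  obtain w' where w': "\<And>t. (w has_vector_derivative w' t) (at t)"
    "\<And>t. (w' has_vector_derivative - complex_of_real (r ^ 4) * w' t - complex_of_real (r ^ 2) * w t) (at t)"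
    "w 0 = a" "w' 0 = b"
    using solution_multiplier_ode[OF r, of a b] unfolding w_def by metis
  have en: "(norm (w' s))\<^sup>2 + r\<^sup>2 * (norm (w s))\<^sup>2 \<le> energy_bound t r a b" if s: "t \<le> s" for s
  proof -
    have "(norm (w' s))\<^sup>2 + r\<^sup>2 * (norm (w s))\<^sup>2 \<le> energy_bound s r a b"
      using damped_oscillator_energy_decay[OF w'(1,2) r decay_rate_bounds[OF r], of s] s t
      by (simp add: energy_bound_def w')
    also have "\<dots> \<le> energy_bound t r a b"
      unfolding energy_bound_def using s decay_rate_bounds(1)[OF r]
      by (intro mult_right_mono mult_left_mono) (auto intro!: mult_left_mono)
    finally show ?thesis .
  qed
  show "r\<^sup>2 * (norm (solution_multiplier t r a b))\<^sup>2 \<le> energy_bound t r a b"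
    using en[of t] zero_le_power2[of "norm (w' t)"] unfolding w_def by linarith
  have v: "norm (w' s) \<le> sqrt (energy_bound t r a b)" if "t \<le> s" for s
  proof (rule real_le_rsqrt)
    have "0 \<le> r\<^sup>2 * (norm (w s))\<^sup>2" by simp
    with en[OF that] show "(norm (w' s))\<^sup>2 \<le> energy_bound t r a b" by linarith
  qed
  assume "t \<le> s"
  from norm_diff_le_has_vector_derivative[OF w'(1) v this]
  show "norm (solution_multiplier s r a b - solution_multiplier t r a b) \<le> (s - t) * sqrt (energy_bound t r a b)"
    by (simp add: w_def mult.commute)
qed

section \<open>Decay at low and high frequencies\<close>

lemma integrable_power_exp_quartic:
  assumes p: "p = 0 \<or> p = 2"
  shows "integrable lborel (\<lambda>x::'a::euclidean_space. norm x ^ p * exp (- (norm x ^ 4) / 2))"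
proof (rule Bochner_Integration.integrable_bound)
  show "integrable lborel (\<lambda>x::'a. exp (1 / 2) * exp (- (norm x)\<^sup>2 / 2))"
    using integral_std_gaussian(1)[of "0::'a", THEN integrable_Re] by simp
  have "norm x ^ p * exp (- (norm x ^ 4) / 2) \<le> exp (1 / 2) * exp (- (norm x)\<^sup>2 / 2)" for x :: 'a
  proof -
    \<comment> \<open>A Gaussian majorant: the power is at most exp(s/2), and s^2/2 \<ge> s - 1/2,
      so the product is at most exp(1/2 - s/2).\<close>
    define s where "s = (norm x)\<^sup>2"
    have s: "0 \<le> s" "norm x ^ 4 = s\<^sup>2" by (auto simp: s_def power2_eq_square power4_eq_xxxx)
    have "s \<le> (1 + s / 4)\<^sup>2"
      using sum_squares_bound[of 1 "s / 4"] by (simp add: power2_sum)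
    also have "\<dots> \<le> (exp (s / 4))\<^sup>2"
      using exp_ge_add_one_self[of "s / 4"] s by (intro power_mono) auto
    also have "\<dots> = exp (s / 2)" by (simp add: exp_double[symmetric])
    finally have "norm x ^ p \<le> exp (s / 2)"
      using p s by (auto simp: s_def)
    moreover have "exp (- (norm x ^ 4) / 2) \<le> exp (1 / 2 - s)"
      unfolding s(2) using sum_squares_bound[of 1 s] by simp
    ultimately have "norm x ^ p * exp (- (norm x ^ 4) / 2) \<le> exp (s / 2) * exp (1 / 2 - s)"
      by (intro mult_mono) auto
    also have "\<dots> = exp (1 / 2) * exp (- s / 2)" by (simp add: exp_add[symmetric])
    finally show ?thesis by (simp add: s_def)
  qed
  thus "AE x in lborel. norm (norm x ^ p * exp (- (norm x ^ 4) / 2)) \<le> norm (exp (1 / 2) * exp (- (norm (x::'a))\<^sup>2 / 2))"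
    by (simp add: abs_mult)
qed measurable

text \<open>The case p = 0 is for \<open>u1\<close>, and p = 2 for \<open>u0\<close>, whose
  transform carries the weight |xi|^2 in the energy. In the exponent of 1 + t, the dimension comes
  from the Jacobian of the rescaling and p from the power of |x|.\<close>

lemma low_frequency_integral:
  assumes p: "p = 0 \<or> p = 2"
  obtains C where "0 \<le> C"
    "\<And>t. 0 \<le> t \<Longrightarrow> integrable lborel (\<lambda>x::'a::euclidean_space. indicator (cball 0 1) x * (norm x ^ p * exp (- (norm x ^ 4 / 2) * t)))"
    "\<And>t. 0 \<le> t \<Longrightarrow> (LINT x|(lborel :: 'a measure). indicator (cball 0 1) x * (norm x ^ p * exp (- (norm x ^ 4 / 2) * t)))
       \<le> C * (1 + t) powr (- (real DIM('a) + real p) / 4)"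
proof -
  define h where "h x = norm x ^ p * exp (- (norm x ^ 4) / 2)" for x :: 'a
  have hi: "integrable lborel h" unfolding h_def using integrable_power_exp_quartic[OF p] .
  have [measurable]: "h \<in> borel_measurable borel" unfolding h_def[abs_def] by measurable
  have [measurable]: "cball (0::'a) 1 \<in> sets borel" by auto
  define C where "C = exp (1 / 2) * (LINT x|lborel. h x)"
  have main: "integrable lborel (\<lambda>x::'a. indicator (cball 0 1) x * (norm x ^ p * exp (- (norm x ^ 4 / 2) * t))) \<and>
      (LINT x|(lborel :: 'a measure). indicator (cball 0 1) x * (norm x ^ p * exp (- (norm x ^ 4 / 2) * t)))
       \<le> C * (1 + t) powr (- (real DIM('a) + real p) / 4)" if t: "0 \<le> t" for t
  proof -
    define c where "c = (1 + t) powr (1 / 4)"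
    have c: "0 < c" "c ^ 4 = 1 + t"
      using t by (auto simp: c_def powr_power)
    have hc: "h (0 + c *\<^sub>R x) = c ^ p * (norm x ^ p * exp (- (1 + t) * norm x ^ 4 / 2))" for x
      using c(1) by (simp add: h_def power_mult_distrib c(2)[symmetric])
    have le: "norm (indicator (cball 0 1) x * (norm x ^ p * exp (- (norm x ^ 4 / 2) * t))) \<le> exp (1 / 2) / c ^ p * h (0 + c *\<^sub>R x)" for x :: 'a
    proof (cases "norm x \<le> 1")
      case True
      \<comment> \<open>On the unit ball t may be replaced by 1 + t at the cost of the factor
        exp(1/2); the rescaled bound then stays finite as t tends to 0.\<close>
      have "exp (- (norm x ^ 4 / 2) * t) \<le> exp (1 / 2 + (- (1 + t) * norm x ^ 4 / 2))"
      proof -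
        have "- (norm x ^ 4 / 2) * t = norm x ^ 4 / 2 + (- (1 + t) * norm x ^ 4 / 2)"
          by (simp add: field_simps)
        thus ?thesis using power_le_one[OF norm_ge_zero True, of 4] by simp
      qed
      hence "norm x ^ p * exp (- (norm x ^ 4 / 2) * t) \<le> norm x ^ p * (exp (1 / 2) * exp (- (1 + t) * norm x ^ 4 / 2))"
        unfolding exp_add by (rule mult_left_mono) simp
      also have "\<dots> = exp (1 / 2) / c ^ p * h (0 + c *\<^sub>R x)"
        unfolding hc using c(1) by simp
      finally show ?thesis using True by simp
    next
      case False
      thus ?thesis using c(1) by (simp add: h_def)
    qed
    have hci: "integrable lborel (\<lambda>x. exp (1 / 2) / c ^ p * h (0 + c *\<^sub>R x))"
      using hi lborel_integrable_affine_iff[of c h 0] c(1) by (intro integrable_mult_right) auto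
    have int: "integrable lborel (\<lambda>x::'a. indicator (cball 0 1) x * (norm x ^ p * exp (- (norm x ^ 4 / 2) * t)))"
    proof (rule Bochner_Integration.integrable_bound[OF hci])
      show "AE x in lborel. norm (indicator (cball 0 1) x * (norm x ^ p * exp (- (norm x ^ 4 / 2) * t))) \<le> norm (exp (1 / 2) / c ^ p * h (0 + c *\<^sub>R x))"
        by (intro AE_I2 order_trans[OF le]) (simp only: real_norm_def abs_ge_self)
    qed measurable
    have "(LINT x|(lborel :: 'a measure). indicator (cball 0 1) x * (norm x ^ p * exp (- (norm x ^ 4 / 2) * t)))
        \<le> (LINT x|lborel. exp (1 / 2) / c ^ p * h (0 + c *\<^sub>R x))"
      by (intro integral_mono int hci order_trans[OF _ le]) (simp only: real_norm_def abs_ge_self)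
    also have "\<dots> = exp (1 / 2) / c ^ p * (LINT x|lborel. h (0 + c *\<^sub>R x))" by (rule integral_mult_right_zero)
    also have "(LINT x|lborel. h (0 + c *\<^sub>R x)) = (LINT x|lborel. h x) / c ^ DIM('a)"
    proof -
      have "(LINT x|lborel. h x) = c ^ DIM('a) * (LINT x|lborel. h (0 + c *\<^sub>R x))"
        using lborel_integral_affine[of c h 0] c(1) by (simp only: abs_of_pos real_scaleR_def) simp
      moreover have "c ^ DIM('a) \<noteq> 0" using c(1) by simp
      ultimately show ?thesis by (simp only: nonzero_mult_div_cancel_left not_False_eq_True)
    qed
    also have "exp (1 / 2) / c ^ p * ((LINT x|lborel. h x) / c ^ DIM('a)) = C * inverse (c ^ (DIM('a) + p))"
      by (simp only: C_def power_add divide_inverse inverse_mult_distrib mult_ac)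
    also have "inverse (c ^ (DIM('a) + p)) = (1 + t) powr (- (real DIM('a) + real p) / 4)"
      using t by (simp add: c_def powr_power powr_minus[symmetric] add_divide_distrib diff_divide_distrib)
    finally show ?thesis using int by simp
  qed
  have "0 \<le> C" unfolding C_def by (intro mult_nonneg_nonneg integral_nonneg_AE) (auto simp: h_def)
  with main show thesis by (intro that) auto
qed

text \<open>From ln z \<le> z - 1 at z = y/(2l + 2). The denominator 2l + 2 instead of 2l stays
  positive at l = 0, and l/(2l + 2) is still at most 1/2.\<close>

lemma powr_le_exp:
  fixes y :: real
  assumes y: "0 < y" and l: "0 \<le> l"
  shows "y powr l \<le> (2 * l + 2) powr l * exp (y / 2)"
proof -
  have "ln (y / (2 * l + 2)) \<le> y / (2 * l + 2) - 1"
    using y l by (intro ln_le_minus_one) auto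
  hence "ln y \<le> y / (2 * l + 2) + ln (2 * l + 2)"
    using y l by (simp add: ln_div)
  hence "l * ln y \<le> l * (y / (2 * l + 2) + ln (2 * l + 2))" using l by (rule mult_left_mono)
  also have "\<dots> = y / 2 * (l / (l + 1)) + l * ln (2 * l + 2)" using l by (simp add: field_simps)
  also have "\<dots> \<le> y / 2 * 1 + l * ln (2 * l + 2)"
    using l y by (intro add_right_mono mult_left_mono) auto
  finally have "exp (l * ln y) \<le> exp (l * ln (2 * l + 2)) * exp (y / 2)"
    by (simp add: exp_add[symmetric] add.commute)
  thus ?thesis using y l by (simp add: powr_def)
qed

text \<open>The loss of regularity: as the rate falls like r^(-2), a decay of (1 + t)^(-l) uniform
  in r costs r^(2l), which is l derivatives inside a squared norm.\<close>

lemma high_frequency_decay: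
  assumes r: "1 < r" and t: "0 \<le> t" and l: "0 \<le> l"
  shows "exp (- decay_rate r * t) \<le> exp (1 / 2) * (2 * l + 2) powr l * (1 + t) powr (- l) * (r powr l)\<^sup>2"
proof -
  define y where "y = (1 + t) / r\<^sup>2"
  have y: "0 < y" using r t by (simp add: y_def)
  have yl: "y powr l = (1 + t) powr l / (r powr l)\<^sup>2"
  proof -
    have "r\<^sup>2 powr l = (r powr l)\<^sup>2"
      using r by (simp add: powr_powr powr_realpow[symmetric] mult.commute flip: powr_numeral)
    thus ?thesis using r t by (simp add: y_def powr_divide)
  qed
  \<comment> \<open>Passing from t to 1 + t adds 1/(2 r^2), at most 1/2 because r > 1; hence the
    factor exp(1/2).\<close>
  have "- decay_rate r * t = 1 / (2 * r\<^sup>2) - y / 2"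
    using r by (simp add: decay_rate_def y_def field_simps)
  also have "\<dots> \<le> 1 / 2 - y / 2"
    using r one_le_power[of r 2] by simp
  finally have "exp (- decay_rate r * t) \<le> exp (1 / 2 - y / 2)" by simp
  also have "\<dots> = exp (1 / 2) * exp (- (y / 2))" by (simp add: exp_add[symmetric])
  also have "exp (- (y / 2)) \<le> (2 * l + 2) powr l / y powr l"
    using powr_le_exp[OF y l] y by (simp add: exp_minus divide_simps mult.commute)
  also have "(2 * l + 2) powr l / y powr l = (2 * l + 2) powr l * (1 + t) powr (- l) * (r powr l)\<^sup>2"
    unfolding yl using t by (simp add: powr_minus field_simps)
  finally show ?thesis by (simp add: mult.assoc)
qed

section \<open>The decay estimate\<close>

lemma borel_measurable_energy_bound:
  fixes a b :: "'a::euclidean_space \<Rightarrow> complex"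
  assumes [measurable]: "a \<in> borel_measurable borel" "b \<in> borel_measurable borel"
  shows "(\<lambda>\<xi>. energy_bound t (norm \<xi>) (a \<xi>) (b \<xi>)) \<in> borel_measurable borel"
  unfolding energy_bound_def[abs_def] decay_rate_def[abs_def] by measurable

lemma energy_bound_integrable:
  fixes a b :: "'a::euclidean_space \<Rightarrow> complex"
  assumes a: "square_integrable (\<lambda>\<xi>. complex_of_real (norm \<xi>) * a \<xi>)" and ma: "a \<in> borel_measurable borel"
    and b: "square_integrable b" and t: "0 \<le> t"
  shows "integrable lborel (\<lambda>\<xi>. energy_bound t (norm \<xi>) (a \<xi>) (b \<xi>))"
proof (rule Bochner_Integration.integrable_bound)
  have mb: "b \<in> borel_measurable borel" using b by (simp add: square_integrable_def)
  show "(\<lambda>\<xi>. energy_bound t (norm \<xi>) (a \<xi>) (b \<xi>)) \<in> borel_measurable lborel"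
    using borel_measurable_energy_bound[OF ma mb] by simp
  show "integrable lborel (\<lambda>\<xi>. 4 * ((norm (b \<xi>))\<^sup>2 + (norm (complex_of_real (norm \<xi>) * a \<xi>))\<^sup>2))"
    by (intro integrable_mult_right Bochner_Integration.integrable_add square_integrableD a b)
  have "energy_bound t (norm \<xi>) (a \<xi>) (b \<xi>) \<le> 4 * 1 * ((norm (b \<xi>))\<^sup>2 + (norm \<xi>)\<^sup>2 * (norm (a \<xi>))\<^sup>2)" for \<xi>
    unfolding energy_bound_def using t decay_rate_bounds(1)[of "norm \<xi>"]
    by (intro mult_right_mono mult_left_mono) auto
  thus "AE \<xi> in lborel. norm (energy_bound t (norm \<xi>) (a \<xi>) (b \<xi>)) \<le> norm (4 * ((norm (b \<xi>))\<^sup>2 + (norm (complex_of_real (norm \<xi>) * a \<xi>))\<^sup>2))"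
    by (simp add: energy_bound_nonneg norm_mult power_mult_distrib)
qed

text \<open>For r \<le> 1 the first two terms already suffice and the third is nonnegative; for r >
  1 the third does all the work. There the factor r^2 in front of |a|^2 accounts for the additional
  derivative on a. The power \<open>r ^ 0\<close> matches \<open>low_frequency_integral\<close> at p
  = 0.\<close>

lemma energy_bound_split:
  assumes A: "norm a \<le> A" and B: "norm b \<le> B" and r: "0 \<le> r" and t: "0 \<le> t" and l: "0 \<le> l"
  defines "D \<equiv> exp (1 / 2) * (2 * l + 2) powr l"
  shows "energy_bound t r a b \<le>
      4 * A\<^sup>2 * (if r \<le> 1 then r ^ 2 * exp (- (r ^ 4 / 2) * t) else 0)
    + 4 * B\<^sup>2 * (if r \<le> 1 then r ^ 0 * exp (- (r ^ 4 / 2) * t) else 0)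
    + 4 * D * (1 + t) powr (- l) * ((norm (complex_of_real (r powr (l + 1)) * a))\<^sup>2 + (norm (complex_of_real (r powr l) * b))\<^sup>2)"
proof (cases "r \<le> 1")
  case True
  have "(norm a)\<^sup>2 \<le> A\<^sup>2" "(norm b)\<^sup>2 \<le> B\<^sup>2"
    using A B by (auto intro: power_mono)
  hence "(norm b)\<^sup>2 + r\<^sup>2 * (norm a)\<^sup>2 \<le> B\<^sup>2 + r\<^sup>2 * A\<^sup>2"
    by (intro add_mono mult_left_mono) auto
  hence "energy_bound t r a b \<le> 4 * exp (- (r ^ 4 / 2) * t) * (B\<^sup>2 + r\<^sup>2 * A\<^sup>2)"
    using True unfolding energy_bound_def decay_rate_def by (simp add: mult_left_mono)
  also have "\<dots> = 4 * A\<^sup>2 * (r ^ 2 * exp (- (r ^ 4 / 2) * t)) + 4 * B\<^sup>2 * (r ^ 0 * exp (- (r ^ 4 / 2) * t))"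
    by (simp add: algebra_simps)
  finally have *: "energy_bound t r a b \<le> 4 * A\<^sup>2 * (r ^ 2 * exp (- (r ^ 4 / 2) * t)) + 4 * B\<^sup>2 * (r ^ 0 * exp (- (r ^ 4 / 2) * t))" .
  have "0 \<le> 4 * D * (1 + t) powr (- l) * ((norm (complex_of_real (r powr (l + 1)) * a))\<^sup>2 + (norm (complex_of_real (r powr l) * b))\<^sup>2)"
    using l by (simp add: D_def)
  with * True show ?thesis by (simp only: if_True)
next
  case False
  hence r: "1 < r" by simp
  have rl: "(r powr (l + 1))\<^sup>2 = (r powr l)\<^sup>2 * r\<^sup>2" using r by (simp add: powr_add power_mult_distrib)
  have "energy_bound t r a b \<le> 4 * (D * (1 + t) powr (- l) * (r powr l)\<^sup>2) * ((norm b)\<^sup>2 + r\<^sup>2 * (norm a)\<^sup>2)"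
    unfolding energy_bound_def D_def using high_frequency_decay[OF r t l]
    by (intro mult_right_mono mult_left_mono) auto
  also have "\<dots> = 4 * D * (1 + t) powr (- l) * ((norm (complex_of_real (r powr (l + 1)) * a))\<^sup>2 + (norm (complex_of_real (r powr l) * b))\<^sup>2)"
    unfolding norm_mult norm_of_real power_mult_distrib power2_abs rl
    by (simp only: distrib_left mult_ac add_ac)
  finally show ?thesis using False by simp
qed

lemma powr_le_bracket_powr:
  fixes r :: real
  assumes "0 \<le> r" "0 \<le> s"
  shows "r powr s \<le> (1 + r\<^sup>2) powr (s / 2)"
\<comment> \<open>At r = 0 the left side is \<open>0 powr s\<close>, which is 0 even for s =
  0.\<close>
proof (cases "r = 0")
  case False
  hence "r powr s = (r\<^sup>2) powr (s / 2)"
    using assms by (simp add: powr_powr flip: powr_numeral)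
  also have "\<dots> \<le> (1 + r\<^sup>2) powr (s / 2)" using assms by (intro powr_mono2) auto
  finally show ?thesis .
qed simp

lemma sobolevD:
  fixes f :: "real ^ 'n::finite \<Rightarrow> complex"
  assumes f: "f \<in> sobolev s"
  shows "has_fourier f (fourier f)"
    and "\<And>s'. 0 \<le> s' \<Longrightarrow> s' \<le> s \<Longrightarrow> square_integrable (\<lambda>\<xi>. complex_of_real (norm \<xi> powr s') * fourier f \<xi>)"
proof -
  from f obtain g where "has_fourier f g" by (auto simp: sobolev_def)
  thus hf: "has_fourier f (fourier f)" unfolding fourier_def by (rule someI[of "has_fourier f"])
  hence "square_integrable (fourier f)" by (simp add: has_fourier_def)
  hence [measurable]: "fourier f \<in> borel_measurable borel" by (simp add: square_integrable_def)
  have w: "square_integrable (\<lambda>\<xi>. complex_of_real ((1 + (norm \<xi>)\<^sup>2) powr (s / 2)) * fourier f \<xi>)"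
    using f by (simp add: sobolev_def)
  fix s' assume s': "0 \<le> s'" "s' \<le> s"
  have "norm \<xi> powr s' \<le> (1 + (norm \<xi>)\<^sup>2) powr (s / 2)" for \<xi> :: "real ^ 'n"
    using powr_le_bracket_powr[of "norm \<xi>" s'] powr_mono[of "s' / 2" "s / 2" "1 + (norm \<xi>)\<^sup>2"] s' by simp
  hence "norm (complex_of_real (norm \<xi> powr s') * fourier f \<xi>) \<le> norm (complex_of_real ((1 + (norm \<xi>)\<^sup>2) powr (s / 2)) * fourier f \<xi>)" for \<xi>
    by (simp only: norm_mult norm_of_real abs_of_nonneg powr_ge_zero) (simp add: mult_right_mono)
  thus "square_integrable (\<lambda>\<xi>. complex_of_real (norm \<xi> powr s') * fourier f \<xi>)"
    by (intro square_integrable_bound[OF w]) auto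
qed

text \<open>Velocity and gradient are each compared with the same M, whose square already bounds
  kinetic and potential energy together; adding the two estimates gives the factor 2.\<close>

lemma energy_le_energy_bound:
  fixes u0 u1 :: "real ^ 'n::finite \<Rightarrow> complex"
  assumes a: "square_integrable (\<lambda>\<xi>. complex_of_real (norm \<xi>) * fourier u0 \<xi>)" and ma: "fourier u0 \<in> borel_measurable borel"
    and b: "square_integrable (fourier u1)"
    and u: "mild_solution u0 u1 u ut" and G: "weak_gradient (u t) G" and t: "0 \<le> t"
  shows "(L2_norm (ut t))\<^sup>2 + (L2_norm G)\<^sup>2 \<le> 2 * (LINT \<xi>|lborel. energy_bound t (norm \<xi>) (fourier u0 \<xi>) (fourier u1 \<xi>))"
proof -
  define M where "M \<xi> = sqrt (energy_bound t (norm \<xi>) (fourier u0 \<xi>) (fourier u1 \<xi>))" for \<xi> :: "real ^ 'n"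
  define g where "g s \<xi> = solution_multiplier s (norm \<xi>) (fourier u0 \<xi>) (fourier u1 \<xi>)" for s and \<xi> :: "real ^ 'n"
  have M2: "(norm (M \<xi>))\<^sup>2 = energy_bound t (norm \<xi>) (fourier u0 \<xi>) (fourier u1 \<xi>)" for \<xi>
    by (simp add: M_def energy_bound_nonneg)
  have mb: "fourier u1 \<in> borel_measurable borel" using b by (simp add: square_integrable_def)
  have M: "square_integrable M"
    unfolding square_integrable_def M2
  proof
    show "M \<in> borel_measurable lborel"
      unfolding M_def[abs_def] using borel_measurable_energy_bound[OF ma mb, of t] by measurable
    show "integrable lborel (\<lambda>\<xi>. energy_bound t (norm \<xi>) (fourier u0 \<xi>) (fourier u1 \<xi>))"
      by (rule energy_bound_integrable[OF a ma b t])
  qed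
  have hf: "has_fourier (u s) (g s)" if "t \<le> s" for s
    using u t that unfolding mild_solution_def g_def[abs_def] by auto
  have ut: "square_integrable (ut t)"
    "((\<lambda>s. L2_norm (\<lambda>x. (u s x - u t x) / complex_of_real (s - t) - ut t x)) \<longlongrightarrow> 0) (at t within {0..})"
    using u t unfolding mild_solution_def by auto
  have "L2_norm (ut t) \<le> L2_norm M"
  proof (rule L2_norm_velocity_le[OF hf t ut(1) M ut(2)])
    show "norm (g s \<xi> - g t \<xi>) \<le> (s - t) * norm (M \<xi>)" if "t < s" for s \<xi>
      using solution_multiplier_energy(2)[OF norm_ge_zero t less_imp_le[OF that]]
      by (simp add: g_def M_def energy_bound_nonneg)
  qed
  moreover have "L2_norm G \<le> L2_norm M"
  proof -
    have gt: "square_integrable (g t)" using hf[of t] by (simp add: has_fourier_def)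
    hence [measurable]: "g t \<in> borel_measurable borel" by (simp add: square_integrable_def)
    have le: "norm (complex_of_real (norm \<xi>) * g t \<xi>) \<le> norm (M \<xi>)" for \<xi>
    proof (rule power2_le_imp_le)
      show "(norm (complex_of_real (norm \<xi>) * g t \<xi>))\<^sup>2 \<le> (norm (M \<xi>))\<^sup>2"
        unfolding M2 g_def norm_mult power_mult_distrib norm_of_real power2_abs
        by (rule solution_multiplier_energy(1)[OF norm_ge_zero t])
    qed simp
    have m: "(\<lambda>\<xi>. complex_of_real (norm \<xi>) * g t \<xi>) \<in> borel_measurable lborel" by measurable
    have "L2_norm G \<le> L2_norm (\<lambda>\<xi>. complex_of_real (norm \<xi>) * g t \<xi>)"
      by (rule L2_norm_gradient_le[OF hf[OF order_refl] G square_integrable_bound[OF M m]]) (use le in auto)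
    also have "\<dots> \<le> L2_norm M"
      by (rule L2_norm_mono[OF M m]) (use le in auto)
    finally show ?thesis .
  qed
  ultimately have "(L2_norm (ut t))\<^sup>2 \<le> (L2_norm M)\<^sup>2" "(L2_norm G)\<^sup>2 \<le> (L2_norm M)\<^sup>2"
    by (auto intro: power_mono)
  thus ?thesis unfolding L2_norm_square[of M] M2 by simp
qed

theorem theorem1p2:
  fixes l :: real
  assumes "l \<ge> 0"
  shows "\<exists>C>0. \<forall>(u0 :: real ^ 'n::finite \<Rightarrow> complex) u1 u ut grad_u.
    u0 \<in> sobolev (l + 1) \<longrightarrow> integrable lborel u0 \<longrightarrow>
    u1 \<in> sobolev l \<longrightarrow> integrable lborel u1 \<longrightarrow>
    mild_solution u0 u1 u ut \<longrightarrow>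
    (\<forall>t>0. weak_gradient (u t) (grad_u t)) \<longrightarrow>
    (\<forall>t>0. (L2_norm (ut t))\<^sup>2 + (L2_norm (grad_u t))\<^sup>2 \<le>
        C * (1 + t) powr (- (real CARD('n) + 2) / 4) * (L1_norm u0)\<^sup>2
      + C * (1 + t) powr (- real CARD('n) / 4) * (L1_norm u1)\<^sup>2
      + C * (1 + t) powr (- l) * ((D_norm (l + 1) u0)\<^sup>2 + (D_norm l u1)\<^sup>2))"
proof -
  define c where "c = (2 * pi) powr (- real CARD('n) / 2)"
  define D where "D = exp (1 / 2) * (2 * l + 2) powr l"
  define I where "I p t \<xi> = indicator (cball 0 1) \<xi> * (norm \<xi> ^ p * exp (- (norm \<xi> ^ 4 / 2) * t))"
    for p :: nat and t and \<xi> :: "real ^ 'n"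
  obtain C0 where C0: "0 \<le> C0" "\<And>t. 0 \<le> t \<Longrightarrow> integrable lborel (I 0 t)"
    "\<And>t. 0 \<le> t \<Longrightarrow> (LINT \<xi>|lborel. I 0 t \<xi>) \<le> C0 * (1 + t) powr (- real CARD('n) / 4)"
    using low_frequency_integral[of 0, where 'a = "real ^ 'n"] unfolding I_def[abs_def] by auto
  obtain C2 where C2: "0 \<le> C2" "\<And>t. 0 \<le> t \<Longrightarrow> integrable lborel (I 2 t)"
    "\<And>t. 0 \<le> t \<Longrightarrow> (LINT \<xi>|lborel. I 2 t \<xi>) \<le> C2 * (1 + t) powr (- (real CARD('n) + 2) / 4)"
    using low_frequency_integral[of 2, where 'a = "real ^ 'n"] unfolding I_def[abs_def] by auto
  have D: "0 \<le> D" by (simp add: D_def)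
  \<comment> \<open>The 8 is the 2 of \<open>energy_le_energy_bound\<close> times the 4 of
    \<open>energy_bound\<close>, and c^2 comes from squaring the L1 bound on the transforms. The
    summand 1 ensures positivity.\<close>
  define C where "C = 8 * c\<^sup>2 * C0 + 8 * c\<^sup>2 * C2 + 8 * D + 1"
  have nonneg: "0 \<le> 8 * c\<^sup>2 * C0" "0 \<le> 8 * c\<^sup>2 * C2" using C0(1) C2(1) by auto
  have C: "C > 0" "8 * c\<^sup>2 * C0 \<le> C" "8 * c\<^sup>2 * C2 \<le> C" "8 * D \<le> C"
    unfolding C_def using nonneg D by linarith+
  show ?thesis
  proof (intro exI[of _ C] conjI C(1) allI impI)
    fix u0 u1 :: "real ^ 'n \<Rightarrow> complex" and u ut grad_u and t :: real
    assume u0: "u0 \<in> sobolev (l + 1)" "integrable lborel u0" and u1: "u1 \<in> sobolev l" "integrable lborel u1"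
      and sol: "mild_solution u0 u1 u ut" and grad: "\<forall>t>0. weak_gradient (u t) (grad_u t)" and t: "0 < t"
    let ?a = "fourier u0" and ?b = "fourier u1"
    note ha = sobolevD(1)[OF u0(1)] and hb = sobolevD(1)[OF u1(1)]
    have b: "square_integrable ?b" using hb by (simp add: has_fourier_def)
    have ma: "?a \<in> borel_measurable borel" using ha by (simp add: has_fourier_def square_integrable_def)
    \<comment> \<open>As l \<ge> 0, the weight |xi| of the gradient is controlled by the Sobolev
      weight of order l + 1.\<close>
    have a: "square_integrable (\<lambda>\<xi>. complex_of_real (norm \<xi>) * ?a \<xi>)"
      using sobolevD(2)[OF u0(1), of 1] assms by simp
    have Da: "square_integrable (\<lambda>\<xi>. complex_of_real (norm \<xi> powr (l + 1)) * ?a \<xi>)"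
      using sobolevD(2)[OF u0(1), of "l + 1"] assms by simp
    have Db: "square_integrable (\<lambda>\<xi>. complex_of_real (norm \<xi> powr l) * ?b \<xi>)"
      using sobolevD(2)[OF u1(1), of l] assms by simp
    define A where "A = c * L1_norm u0"
    define B where "B = c * L1_norm u1"
    define T where "T = (1 + t) powr (- l)"
    define H where "H \<xi> = (norm (complex_of_real (norm \<xi> powr (l + 1)) * ?a \<xi>))\<^sup>2 + (norm (complex_of_real (norm \<xi> powr l) * ?b \<xi>))\<^sup>2" for \<xi>
    have Hi: "integrable lborel H"
      unfolding H_def by (intro Bochner_Integration.integrable_add square_integrableD Da Db)
    have HI: "(LINT \<xi>|lborel. H \<xi>) = (D_norm (l + 1) u0)\<^sup>2 + (D_norm l u1)\<^sup>2"
      unfolding H_def D_norm_def L2_norm_square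
      by (intro Bochner_Integration.integral_add square_integrableD Da Db)
    have "(LINT \<xi>|lborel. energy_bound t (norm \<xi>) (?a \<xi>) (?b \<xi>)) \<le>
        (LINT \<xi>|lborel. 4 * A\<^sup>2 * I 2 t \<xi> + 4 * B\<^sup>2 * I 0 t \<xi> + 4 * D * T * H \<xi>)"
    proof (rule integral_mono_AE)
      show "integrable lborel (\<lambda>\<xi>. energy_bound t (norm \<xi>) (?a \<xi>) (?b \<xi>))"
        using t by (intro energy_bound_integrable a ma b) simp
      show "integrable lborel (\<lambda>\<xi>. 4 * A\<^sup>2 * I 2 t \<xi> + 4 * B\<^sup>2 * I 0 t \<xi> + 4 * D * T * H \<xi>)"
        using t by (intro Bochner_Integration.integrable_add integrable_mult_right C0 C2 Hi) auto
      \<comment> \<open>Only almost everywhere, because \<open>fourier\<close> chooses an arbitrary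
        representative and the L1 bounds hold off a null set.\<close>
      show "AE \<xi> in lborel. energy_bound t (norm \<xi>) (?a \<xi>) (?b \<xi>) \<le> 4 * A\<^sup>2 * I 2 t \<xi> + 4 * B\<^sup>2 * I 0 t \<xi> + 4 * D * T * H \<xi>"
        using has_fourier_AE_bound[OF ha u0(2)] has_fourier_AE_bound[OF hb u1(2)]
      proof eventually_elim
        case (elim \<xi>)
        have "I p t \<xi> = (if norm \<xi> \<le> 1 then norm \<xi> ^ p * exp (- (norm \<xi> ^ 4 / 2) * t) else 0)" for p
          by (simp add: I_def indicator_def)
        with energy_bound_split[OF elim norm_ge_zero[of \<xi>] less_imp_le[OF t] assms] show ?case
          unfolding A_def B_def c_def D_def T_def H_def by simp
      qed
    qed
    also have "\<dots> = 4 * A\<^sup>2 * (LINT \<xi>|lborel. I 2 t \<xi>) + 4 * B\<^sup>2 * (LINT \<xi>|lborel. I 0 t \<xi>) + 4 * D * T * (LINT \<xi>|lborel. H \<xi>)"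
      using C0(2)[of t] C2(2)[of t] t Hi by simp
    also have "\<dots> \<le> 4 * A\<^sup>2 * (C2 * (1 + t) powr (- (real CARD('n) + 2) / 4)) + 4 * B\<^sup>2 * (C0 * (1 + t) powr (- real CARD('n) / 4))
        + 4 * D * T * ((D_norm (l + 1) u0)\<^sup>2 + (D_norm l u1)\<^sup>2)"
      unfolding HI using t by (intro add_mono mult_left_mono C0(3) C2(3)) (auto simp: T_def D)
    finally have J: "2 * (LINT \<xi>|lborel. energy_bound t (norm \<xi>) (?a \<xi>) (?b \<xi>)) \<le>
        8 * c\<^sup>2 * C2 * ((1 + t) powr (- (real CARD('n) + 2) / 4) * (L1_norm u0)\<^sup>2)
      + 8 * c\<^sup>2 * C0 * ((1 + t) powr (- real CARD('n) / 4) * (L1_norm u1)\<^sup>2)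
      + 8 * D * (T * ((D_norm (l + 1) u0)\<^sup>2 + (D_norm l u1)\<^sup>2))"
      by (simp add: A_def B_def power_mult_distrib algebra_simps)
    have "(L2_norm (ut t))\<^sup>2 + (L2_norm (grad_u t))\<^sup>2 \<le> 2 * (LINT \<xi>|lborel. energy_bound t (norm \<xi>) (?a \<xi>) (?b \<xi>))"
      using grad t by (intro energy_le_energy_bound[OF a ma b sol]) auto
    also note J
    also have "8 * c\<^sup>2 * C2 * ((1 + t) powr (- (real CARD('n) + 2) / 4) * (L1_norm u0)\<^sup>2)
      + 8 * c\<^sup>2 * C0 * ((1 + t) powr (- real CARD('n) / 4) * (L1_norm u1)\<^sup>2)
      + 8 * D * (T * ((D_norm (l + 1) u0)\<^sup>2 + (D_norm l u1)\<^sup>2)) \<le>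
        C * ((1 + t) powr (- (real CARD('n) + 2) / 4) * (L1_norm u0)\<^sup>2)
      + C * ((1 + t) powr (- real CARD('n) / 4) * (L1_norm u1)\<^sup>2)
      + C * (T * ((D_norm (l + 1) u0)\<^sup>2 + (D_norm l u1)\<^sup>2))"
      by (intro add_mono mult_right_mono C) (auto simp: T_def)
    finally show "(L2_norm (ut t))\<^sup>2 + (L2_norm (grad_u t))\<^sup>2 \<le>
        C * (1 + t) powr (- (real CARD('n) + 2) / 4) * (L1_norm u0)\<^sup>2
      + C * (1 + t) powr (- real CARD('n) / 4) * (L1_norm u1)\<^sup>2
      + C * (1 + t) powr (- l) * ((D_norm (l + 1) u0)\<^sup>2 + (D_norm l u1)\<^sup>2)"
      by (simp only: T_def mult.assoc)
  qed
qed

end
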